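(* For any Polish group $G$, there exists a separable real Banach space $X$ such that $\{-1,1\}\times G$ is displayable on $X$.
   Context: A Polish group is a topological group whose topology is separable and completely metrizable. $\{-1,1\}$ is the two-element multiplicative group with the discrete topology, and $\{-1,1\}\times G$ has the product group structure and topology. For a Banach space $X$ with norm $|\!|\!|\cdot|\!|\!|$, $\mathrm{Isom}(X,|\!|\!|\cdot|\!|\!|)$ is the group of surjective linear isometries, equipped with the strong operator topology (pointwise convergence on $X$), and $GL(X)$ is the group of linear automorphisms (bounded with bounded inverse), also with the strong operator topology. A display of a topological group $H$ on $X$ is a group homomorphism $\rho\colon H\to GL(X)$ which is a topological isomorphism onto its image $\rho(H)$ (with the strong operator topology) and such that $\rho(H)=\mathrm{Isom}(X,|\!|\!|\cdot|\!|\!|)$ for some equivalent norm $|\!|\!|\cdot|\!|\!|$ on $X$. $H$ is displayable on $X$ if there exists a display of $H$ on $X$. *)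

theory Defs
  imports
    "HOL-Analysis.Analysis"
    "HOL-Algebra.Bij"
    "HOL-Algebra.Module"
    "HOL-Algebra.Algebraic_Closure_Type"
begin

section \<open>Polish groups\<close>

locale topological_group = group G for G (structure) and T +
  assumes topspace_eq_carrier: "topspace T = carrier G"
    and continuous_mult: "continuous_map (prod_topology T T) T (\<lambda>(x, y). x \<otimes> y)"
    and continuous_inv: "continuous_map T T (m_inv G)"

locale polish_group = topological_group +
  assumes separable: "separable_space T"
    and completely_metrizable: "completely_metrizable_space T"

definition sign_group :: "int monoid" where
  "sign_group = \<lparr>carrier = {-1, 1}, mult = (*), one = 1\<rparr>"

definition sign_topology :: "int topology" where
  "sign_topology = discrete_topology {-1, 1}"


section \<open>Real Banach spaces with explicit carrier\<close>

text \<open>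
  A Banach space whose existence is asserted cannot be given by a type class, so vector spaces
  are modules with an explicit carrier over the field of real numbers. The fields
  \<^const>\<open>mult\<close> and \<^const>\<open>one\<close>, which the record type of modules inherits from
  rings, are not constrained and play no role.
  A separable Banach space has at most as many points as there are real sequences; hence, up to
  transport of structure along a bijection, every one of them is given by a carrier
  contained in the type \<^typ>\<open>nat \<Rightarrow> real\<close>.
\<close>

locale real_normed_space = module "ring_of_type_algebra :: real ring" V
  for V :: "(real, 'v, 'm) module_scheme" (structure) and N :: "'v \<Rightarrow> real" +
  assumes norm_nonneg: "x \<in> carrier V \<Longrightarrow> 0 \<le> N x"
    and norm_eq_zero: "x \<in> carrier V \<Longrightarrow> N x = 0 \<longleftrightarrow> x = \<zero>"
    and norm_triangle: "x \<in> carrier V \<Longrightarrow> y \<in> carrier V \<Longrightarrow> N (x \<oplus> y) \<le> N x + N y"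
    and norm_smult: "x \<in> carrier V \<Longrightarrow> N (c \<odot> x) = \<bar>c\<bar> * N x"

text \<open>
  The locale \<^locale>\<open>Metric_space\<close> demands nonnegativity and symmetry on the whole type,
  hence the default value outside the carrier.
\<close>

definition norm_dist ::
    "(real, 'v, 'm) module_scheme \<Rightarrow> ('v \<Rightarrow> real) \<Rightarrow> 'v \<Rightarrow> 'v \<Rightarrow> real" where
  "norm_dist V N x y =
    (if x \<in> carrier V \<and> y \<in> carrier V then N (x \<ominus>\<^bsub>V\<^esub> y) else 0)"

definition norm_topology ::
    "(real, 'v, 'm) module_scheme \<Rightarrow> ('v \<Rightarrow> real) \<Rightarrow> 'v topology" where
  "norm_topology V N = Metric_space.mtopology (carrier V) (norm_dist V N)"

lemma (in real_normed_space) Metric_space_norm_dist: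
  "Metric_space (carrier V) (norm_dist V N)"
proof
  have minus: "N (\<ominus> x) = N x" if "x \<in> carrier V" for x
  proof -
    have c: "carrier (ring_of_type_algebra :: real ring) = UNIV"
      and m: "\<ominus>\<^bsub>ring_of_type_algebra :: real ring\<^esub> 1 = -1"
      and o: "\<one>\<^bsub>ring_of_type_algebra :: real ring\<^esub> = 1"
      subgoal by (simp add: ring_of_type_algebra_def)
      subgoal
        using R.minus_equality[of "-1" "1"]
        by (simp add: ring_of_type_algebra_def)
      subgoal by (simp add: ring_of_type_algebra_def)
      done
    have "(-1) \<odot> x = \<ominus> x"
      using smult_l_minus[of 1 x] smult_one[of x] that by (simp add: c m o)
    then show ?thesis
      using norm_smult[OF that, of "-1"] by simp
  qed
  fix x y z
  show "0 \<le> norm_dist V N x y"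
    by (simp add: norm_dist_def norm_nonneg)
  show "norm_dist V N x y = norm_dist V N y x"
  proof (cases "x \<in> carrier V \<and> y \<in> carrier V")
    case True
    then have "y \<ominus> x = \<ominus> (x \<ominus> y)"
      by (simp add: a_minus_def minus_add a_comm)
    then show ?thesis
      using True minus[of "x \<ominus> y"] by (simp add: norm_dist_def)
  qed (auto simp: norm_dist_def)
  assume x: "x \<in> carrier V" and y: "y \<in> carrier V"
  have "x \<ominus> y = \<zero> \<longleftrightarrow> x = y"
    using x y by (metis M.minus_equality M.minus_minus M.r_neg a_inv_closed a_minus_def a_comm)
  then show "norm_dist V N x y = 0 \<longleftrightarrow> x = y"
    using x y by (simp add: norm_dist_def norm_eq_zero)
  assume z: "z \<in> carrier V"
  have "x \<ominus> z = (x \<ominus> y) \<oplus> (y \<ominus> z)"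
    using x y z by (simp add: a_minus_def a_assoc M.r_neg1)
  then show "norm_dist V N x z \<le> norm_dist V N x y + norm_dist V N y z"
    using x y z norm_triangle[of "x \<ominus> y" "y \<ominus> z"] by (simp add: norm_dist_def)
qed

locale real_banach_space = real_normed_space +
  assumes complete: "Metric_space.mcomplete (carrier V) (norm_dist V N)"

definition equivalent_norm ::
    "(real, 'v, 'm) module_scheme \<Rightarrow> ('v \<Rightarrow> real) \<Rightarrow> ('v \<Rightarrow> real) \<Rightarrow> bool" where
  "equivalent_norm V N N' \<longleftrightarrow> real_normed_space V N' \<and>
    (\<exists>a > 0. \<exists>b > 0. \<forall>x \<in> carrier V. a * N x \<le> N' x \<and> N' x \<le> b * N x)"


section \<open>Automorphisms, isometries and displays\<close>

text \<open>
  Operators are extensional functions on the carrier (undefined outside), as in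
  \<^const>\<open>BijGroup\<close>, so that equality of operators is equality on the space.
\<close>

definition linear_operators :: "(real, 'v, 'm) module_scheme \<Rightarrow> ('v \<Rightarrow> 'v) set" where
  "linear_operators V =
    {f \<in> carrier V \<rightarrow>\<^sub>E carrier V.
      (\<forall>x \<in> carrier V. \<forall>y \<in> carrier V. f (x \<oplus>\<^bsub>V\<^esub> y) = f x \<oplus>\<^bsub>V\<^esub> f y) \<and>
      (\<forall>c. \<forall>x \<in> carrier V. f (c \<odot>\<^bsub>V\<^esub> x) = c \<odot>\<^bsub>V\<^esub> f x)}"

definition bounded_operators ::
    "(real, 'v, 'm) module_scheme \<Rightarrow> ('v \<Rightarrow> real) \<Rightarrow> ('v \<Rightarrow> 'v) set" where
  "bounded_operators V N =
    {f \<in> linear_operators V. \<exists>K. \<forall>x \<in> carrier V. N (f x) \<le> K * N x}"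

definition GL :: "(real, 'v, 'm) module_scheme \<Rightarrow> ('v \<Rightarrow> real) \<Rightarrow> ('v \<Rightarrow> 'v) monoid" where
  "GL V N = BijGroup (carrier V)
    \<lparr>carrier := {f \<in> bounded_operators V N. bij_betw f (carrier V) (carrier V) \<and>
       restrict (inv_into (carrier V) f) (carrier V) \<in> bounded_operators V N}\<rparr>"

definition Isom :: "(real, 'v, 'm) module_scheme \<Rightarrow> ('v \<Rightarrow> real) \<Rightarrow> ('v \<Rightarrow> 'v) set" where
  "Isom V N =
    {f \<in> linear_operators V. f ` carrier V = carrier V \<and> (\<forall>x \<in> carrier V. N (f x) = N x)}"

text \<open>The strong operator topology: pointwise convergence with respect to the norm.\<close>

definition strong_operator_topology ::
    "(real, 'v, 'm) module_scheme \<Rightarrow> ('v \<Rightarrow> real) \<Rightarrow> ('v \<Rightarrow> 'v) topology" where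
  "strong_operator_topology V N = product_topology (\<lambda>_. norm_topology V N) (carrier V)"

definition display ::
    "('h, 'b) monoid_scheme \<Rightarrow> 'h topology \<Rightarrow> (real, 'v, 'm) module_scheme \<Rightarrow> ('v \<Rightarrow> real) \<Rightarrow>
      ('h \<Rightarrow> 'v \<Rightarrow> 'v) \<Rightarrow> bool" where
  "display H T V N \<rho> \<longleftrightarrow>
    \<rho> \<in> hom H (GL V N) \<and>
    homeomorphic_map T (subtopology (strong_operator_topology V N) (\<rho> ` carrier H)) \<rho> \<and>
    (\<exists>N'. equivalent_norm V N N' \<and> \<rho> ` carrier H = Isom V N')"

definition displayable ::
    "('h, 'b) monoid_scheme \<Rightarrow> 'h topology \<Rightarrow> (real, 'v, 'm) module_scheme \<Rightarrow> ('v \<Rightarrow> real) \<Rightarrow> bool"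
  where "displayable H T V N \<longleftrightarrow> (\<exists>\<rho>. display H T V N \<rho>)"

end

theory Submission
  imports Defs "HOL-Probability.Discrete_Topology" "HOL-Real_Asymp.Real_Asymp"
begin

text \<open>
  Choose a left-invariant metric \<open>d\<close> on \<open>G\<close> and right translations by a dense sequence of elements.
  Countably many copies of \<open>G\<close>, with mutual distances that encode these right translations, form a
  bounded metric space \<open>P\<close>. A self-isometry of the completion of \<open>P\<close> commutes with the encoded
  translations, so it is a pointwise limit of left translations by some \<open>g n\<close>; by Baire category it
  sends some point of \<open>G\<close> to a point of \<open>G\<close>, which forces \<open>g n\<close> to converge in \<open>G\<close>.

  Let \<open>X\<close> be the closed linear span, in the supremum norm, of the peak functions
  \<open>f p = 1 - d p\<close>, and consider on \<open>X \<times> \<real>\<close> the norm \<open>N x + K x t\<close>, where the unit ball of \<open>N\<close> is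
  the hull of the \<open>\<plusminus>f p\<close> and a small ball, and \<open>K\<close> is a sum of Euclidean norms of
  \<open>(t - c * l x, \<parallel>x\<parallel>)\<close> for an invariant functional \<open>l\<close>. This norm is rough in every transversal direction
  only along the axis \<open>{0} \<times> \<real>\<close>, so an isometry preserves the axis; up to a sign it fixes
  \<open>(0, 1)\<close>, and letting \<open>t\<close> tend to \<open>\<plusminus>\<infinity>\<close> shows that it is \<open>S \<times> id\<close> with \<open>S\<close> preserving both \<open>N\<close> and
  \<open>K\<close>. The closure of the \<open>f p\<close> is the set of \<open>u\<close> with \<open>N u \<le> 1\<close> and \<open>\<parallel>u\<parallel> = l u = 1\<close>, a condition
  expressible by \<open>N\<close> and \<open>K\<close>; hence \<open>S\<close> restricts to a self-isometry of the completion of \<open>P\<close>.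
\<close>

section \<open>Left-invariant metrics\<close>

text \<open>A Polish group need not have a complete left-invariant metric, so \<open>P\<close> is in
  general not complete, and passing to completions threatens to create isometries foreign to
  \<open>G\<close> in two ways. Maps that are no limits of left translations are excluded by the
  levels. What remains are limits of translations by some \<open>g n\<close> that may diverge in
  \<open>G\<close>; such a limit preserves distances but may fail to be onto. Surjectivity is
  therefore what the category argument has to exploit: it makes the preimage of \<open>G\<close>
  dense as well, while a second metric \<open>e\<close>, complete but not invariant, describes
  \<open>G\<close> as a countable intersection of open sets. On the linear side, the sup norm alone
  gives no hold on the peaks. The additional real coordinate stores a whole family of functions in
  one norm: once an isometry is known to be \<open>S \<times> id\<close>, it preserves
  \<open>tilt x t\<close> for each \<open>t\<close> separately, and \<open>norm\<close> and
  \<open>ell\<close> can be recovered from these values where they are needed.\<close>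

context topological_group
begin

lemma continuous_map_left_mult:
  assumes "a \<in> carrier G"
  shows "continuous_map T T (\<lambda>x. a \<otimes> x)"
proof -
  have "continuous_map T (prod_topology T T) (\<lambda>x. (a, x))"
    using assms by (intro continuous_map_pairedI) (auto simp: topspace_eq_carrier)
  from continuous_map_compose[OF this continuous_mult] show ?thesis
    by (simp add: o_def)
qed

lemma openin_left_mult_vimage:
  assumes "a \<in> carrier G" "openin T U"
  shows "openin T {x \<in> carrier G. a \<otimes> x \<in> U}"
  using openin_continuous_map_preimage[OF continuous_map_left_mult[OF assms(1)] assms(2)]
  by (simp add: topspace_eq_carrier)

lemma nhd_one_square:
  assumes "openin T U" "\<one> \<in> U"
  obtains V where "openin T V" "\<one> \<in> V" "\<And>x y. x \<in> V \<Longrightarrow> y \<in> V \<Longrightarrow> x \<otimes> y \<in> U"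
proof -
  have "openin (prod_topology T T) {z \<in> topspace (prod_topology T T). (case z of (x, y) \<Rightarrow> x \<otimes> y) \<in> U}"
    by (rule openin_continuous_map_preimage[OF continuous_mult assms(1)])
  moreover have "(\<one>, \<one>) \<in> {z \<in> topspace (prod_topology T T). (case z of (x, y) \<Rightarrow> x \<otimes> y) \<in> U}"
    using assms by (simp add: topspace_eq_carrier)
  ultimately obtain A B where AB: "openin T A" "openin T B" "\<one> \<in> A" "\<one> \<in> B"
    "A \<times> B \<subseteq> {z \<in> topspace (prod_topology T T). (case z of (x, y) \<Rightarrow> x \<otimes> y) \<in> U}"
    unfolding openin_prod_topology_alt by meson
  show ?thesis
    by (rule that[of "A \<inter> B"]) (use AB in auto)
qed

text \<open>Three factors, because \<open>list_prod_in_U\<close> cuts a chain into an initial part,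
  one middle factor and a rest.\<close>

lemma nhd_one_cube:
  assumes U: "openin T U" "\<one> \<in> U"
  obtains V where "openin T V" "\<one> \<in> V" "\<And>x. x \<in> V \<Longrightarrow> inv x \<in> V"
    "\<And>x y z. x \<in> V \<Longrightarrow> y \<in> V \<Longrightarrow> z \<in> V \<Longrightarrow> x \<otimes> y \<otimes> z \<in> U"
proof -
  obtain W where W: "openin T W" "\<one> \<in> W" "\<And>x y. x \<in> W \<Longrightarrow> y \<in> W \<Longrightarrow> x \<otimes> y \<in> U"
    using nhd_one_square[OF U] by metis
  obtain V where V: "openin T V" "\<one> \<in> V" "\<And>x y. x \<in> V \<Longrightarrow> y \<in> V \<Longrightarrow> x \<otimes> y \<in> W"
    using nhd_one_square[OF W(1,2)] by metis
  have VW: "x \<in> W" if "x \<in> V" for x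
    using V(3)[OF that V(2)] openin_subset[OF V(1)] that by (auto simp: topspace_eq_carrier)
  define V' where "V' = V \<inter> {x \<in> carrier G. inv x \<in> V}"
  have "openin T {x \<in> carrier G. inv x \<in> V}"
    using openin_continuous_map_preimage[OF continuous_inv V(1)] by (simp add: topspace_eq_carrier)
  then have "openin T V'" using V(1) by (simp add: V'_def openin_Int)
  moreover have "\<one> \<in> V'" using V(2) by (simp add: V'_def)
  moreover have "inv x \<in> V'" if "x \<in> V'" for x
    using that by (auto simp: V'_def)
  moreover have "x \<otimes> y \<otimes> z \<in> U" if "x \<in> V'" "y \<in> V'" "z \<in> V'" for x y z
    using that V(3) VW by (intro W(3)) (auto simp: V'_def)
  ultimately show ?thesis using that by blast
qed

end

text \<open>The Birkhoff-Kakutani construction: \<open>gauge\<close> measures the depth of an element in a chain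
  of neighbourhoods \<open>U n\<close> of the unit, and \<open>chain_norm\<close> is the largest subadditive function
  below it.\<close>

locale nhd_chain = group G for G (structure) +
  fixes U :: "nat \<Rightarrow> 'a set"
  assumes U_subset: "U n \<subseteq> carrier G"
    and one_in_U: "\<one> \<in> U n"
    and inv_in_U: "x \<in> U n \<Longrightarrow> inv x \<in> U n"
    and cube_in_U: "x \<in> U (Suc n) \<Longrightarrow> y \<in> U (Suc n) \<Longrightarrow> z \<in> U (Suc n) \<Longrightarrow> x \<otimes> y \<otimes> z \<in> U n"
begin

lemma U_Suc_subset: "U (Suc n) \<subseteq> U n"
proof
  fix x assume x: "x \<in> U (Suc n)"
  then have "x \<otimes> \<one> \<otimes> \<one> \<in> U n" by (intro cube_in_U one_in_U)
  then show "x \<in> U n" using x U_subset[of "Suc n"] by (simp add: subset_iff)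
qed

lemma U_antimono: "m \<le> n \<Longrightarrow> U n \<subseteq> U m"
  by (rule lift_Suc_antimono_le[of U, OF U_Suc_subset])

definition gauge :: "'a \<Rightarrow> real" where
  "gauge x = (if \<forall>n. x \<in> U n then 0 else 2 * (1/2) ^ (LEAST n. x \<notin> U n))"

text \<open>The factor 2 in \<open>gauge\<close> causes the shift to \<open>Suc n\<close>. It is
  deliberate: in \<open>list_prod_in_U\<close> the middle factor is only known to have gauge below
  \<open>(1/2) ^ n\<close>, and it still has to lie in \<open>U (Suc n)\<close>.\<close>

lemma gauge_less_iff: "gauge x < (1/2) ^ n \<longleftrightarrow> x \<in> U (Suc n)"
proof (cases "\<forall>n. x \<in> U n")
  case True
  then show ?thesis by (simp add: gauge_def)
next
  case False
  define L where "L = (LEAST n. x \<notin> U n)"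
  have notL: "x \<notin> U L" unfolding L_def using False by (metis LeastI)
  have below: "x \<in> U m" if "m < L" for m using not_less_Least[of m "\<lambda>n. x \<notin> U n"] that by (auto simp: L_def)
  have "gauge x = 2 * (1/2) ^ L"
    using False by (simp only: gauge_def L_def if_False)
  moreover have "2 * (1/2) ^ L < (1/2::real) ^ n \<longleftrightarrow> (1/2::real) ^ L < (1/2) ^ Suc n"
    by auto
  ultimately have "gauge x < (1/2) ^ n \<longleftrightarrow> (1/2::real) ^ L < (1/2) ^ Suc n"
    by simp
  also have "\<dots> \<longleftrightarrow> Suc n < L"
    by (rule power_strict_decreasing_iff) auto
  also have "\<dots> \<longleftrightarrow> x \<in> U (Suc n)"
    using notL below U_antimono[of L "Suc n"] by (meson not_less subsetD)
  finally show ?thesis .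
qed

lemma gauge_nonneg: "0 \<le> gauge x"
  by (simp add: gauge_def)

lemma gauge_inv: "x \<in> carrier G \<Longrightarrow> gauge (inv x) = gauge x"
proof -
  assume x: "x \<in> carrier G"
  have "inv x \<in> U n \<longleftrightarrow> x \<in> U n" for n
    using inv_in_U[of x n] inv_in_U[of "inv x" n] x by auto
  then show ?thesis by (simp add: gauge_def)
qed

definition list_prod :: "'a list \<Rightarrow> 'a" where
  "list_prod xs = foldr (\<otimes>) xs \<one>"

lemma list_prod_simps [simp]: "list_prod [] = \<one>" "list_prod (x # xs) = x \<otimes> list_prod xs"
  by (auto simp: list_prod_def)

lemma list_prod_closed [simp]: "set xs \<subseteq> carrier G \<Longrightarrow> list_prod xs \<in> carrier G"
  by (induction xs) auto

lemma list_prod_append: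
  "set xs \<subseteq> carrier G \<Longrightarrow> set ys \<subseteq> carrier G \<Longrightarrow> list_prod (xs @ ys) = list_prod xs \<otimes> list_prod ys"
  by (induction xs) (auto simp: m_assoc)

lemma list_prod_rev_inv:
  "set xs \<subseteq> carrier G \<Longrightarrow> list_prod (rev (map (m_inv G) xs)) = inv (list_prod xs)"
proof (induction xs)
  case (Cons x xs)
  then have "list_prod (rev (map (m_inv G) xs) @ [inv x]) = list_prod (rev (map (m_inv G) xs)) \<otimes> list_prod [inv x]"
    by (intro list_prod_append) auto
  then show ?case using Cons by (auto simp: inv_mult_group)
qed simp

text \<open>Split a chain at the last point where its first part still has less than half of the
  available length.\<close>

lemma list_prod_in_U:
  assumes "set xs \<subseteq> carrier G" "sum_list (map gauge xs) < (1/2) ^ n"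
  shows "list_prod xs \<in> U n"
  using assms
proof (induction "length xs" arbitrary: xs n rule: less_induct)
  case less
  show ?case
  proof (cases "xs = []")
    case True
    then show ?thesis by (simp add: one_in_U)
  next
    case False
    let ?s = "\<lambda>k. sum_list (map gauge (take k xs))"
    define K where "K = {k. k < length xs \<and> ?s k < (1/2) ^ Suc n}"
    have K: "finite K" "0 \<in> K" using False by (auto simp: K_def)
    define k where "k = Max K"
    have "k \<in> K" unfolding k_def using K by (intro Max_in) auto
    then have k: "k < length xs" "?s k < (1/2) ^ Suc n" by (auto simp: K_def)
    have split: "xs = take k xs @ xs ! k # drop (Suc k) xs"
      using k(1) by (rule id_take_nth_drop)
    have sets: "set (take k xs) \<subseteq> carrier G" "xs ! k \<in> carrier G" "set (drop (Suc k) xs) \<subseteq> carrier G"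
      using less.prems(1) k(1) by (auto dest: in_set_takeD in_set_dropD)
    have total: "sum_list (map gauge xs) = ?s k + (gauge (xs ! k) + sum_list (map gauge (drop (Suc k) xs)))"
      by (subst split) simp
    have nn: "0 \<le> sum_list (map gauge ys)" for ys
      by (rule sum_list_nonneg) (auto simp: gauge_nonneg)
    have "gauge (xs ! k) < (1/2) ^ n"
      using total less.prems(2) nn[of "take k xs"] nn[of "drop (Suc k) xs"] by linarith
    then have 2: "xs ! k \<in> U (Suc n)" by (simp add: gauge_less_iff)
    have 1: "list_prod (take k xs) \<in> U (Suc n)"
      using k sets by (intro less.hyps) auto
    have 3: "list_prod (drop (Suc k) xs) \<in> U (Suc n)"
    proof (cases "Suc k < length xs")
      case True
      have "Suc k \<notin> K" using Max_ge[OF K(1), of "Suc k"] by (auto simp: k_def)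
      then have "(1/2) ^ Suc n \<le> ?s (Suc k)" using True by (auto simp: K_def)
      moreover have "?s (Suc k) = ?s k + gauge (xs ! k)"
        using k(1) by (simp add: take_Suc_conv_app_nth)
      ultimately have "sum_list (map gauge (drop (Suc k) xs)) < (1/2) ^ Suc n"
        using total less.prems(2) by simp
      then show ?thesis
        using sets k(1) by (intro less.hyps) auto
    next
      case False
      then show ?thesis by (simp add: one_in_U)
    qed
    have "list_prod xs = list_prod (take k xs) \<otimes> (xs ! k \<otimes> list_prod (drop (Suc k) xs))"
      by (subst split, subst list_prod_append) (use sets in auto)
    also have "\<dots> = list_prod (take k xs) \<otimes> xs ! k \<otimes> list_prod (drop (Suc k) xs)"
      using sets by (simp add: m_assoc)
    also have "\<dots> \<in> U n" by (rule cube_in_U[OF 1 2 3])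
    finally show ?thesis .
  qed
qed

definition chain_norm :: "'a \<Rightarrow> real" where
  "chain_norm x = Inf {sum_list (map gauge xs) | xs. set xs \<subseteq> carrier G \<and> list_prod xs = x}"

lemma chain_norm_le:
  assumes "set xs \<subseteq> carrier G"
  shows "chain_norm (list_prod xs) \<le> sum_list (map gauge xs)"
  unfolding chain_norm_def
  by (rule cInf_lower)
    (use assms in \<open>auto intro!: bdd_belowI[of _ 0] sum_list_nonneg simp: gauge_nonneg\<close>)

lemma chain_norm_approx:
  assumes "x \<in> carrier G" "chain_norm x < r"
  obtains xs where "set xs \<subseteq> carrier G" "list_prod xs = x" "sum_list (map gauge xs) < r"
proof -
  have "sum_list (map gauge [x]) \<in> {sum_list (map gauge xs) | xs. set xs \<subseteq> carrier G \<and> list_prod xs = x}"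
    using assms(1) by (intro CollectI exI[of _ "[x]"]) simp
  then have "\<exists>y\<in>{sum_list (map gauge xs) | xs. set xs \<subseteq> carrier G \<and> list_prod xs = x}. y < r"
    using assms(2) unfolding chain_norm_def by (intro cInf_lessD) auto
  then show ?thesis using that by auto
qed

lemma chain_norm_nonneg: "0 \<le> chain_norm x" if x: "x \<in> carrier G"
proof (rule ccontr)
  assume "\<not> 0 \<le> chain_norm x"
  then obtain xs where "sum_list (map gauge xs) < 0"
    using chain_norm_approx[OF x, of 0] by auto
  moreover have "0 \<le> sum_list (map gauge xs)"
    by (rule sum_list_nonneg) (auto simp: gauge_nonneg)
  ultimately show False by simp
qed

lemma chain_norm_le_gauge: "x \<in> carrier G \<Longrightarrow> chain_norm x \<le> gauge x"
  using chain_norm_le[of "[x]"] by simp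

text \<open>This is where the cube condition pays off: it keeps the infimum over factorisations from
  collapsing to 0. Together with \<open>chain_norm_le_gauge\<close> it traps the balls of
  \<open>chain_norm\<close> between the sets \<open>U n\<close>.\<close>

lemma chain_norm_less_imp: "x \<in> carrier G \<Longrightarrow> chain_norm x < (1/2) ^ n \<Longrightarrow> x \<in> U n"
  using list_prod_in_U by (metis chain_norm_approx)

lemma chain_norm_one: "chain_norm \<one> = 0"
  using chain_norm_le[of "[]"] chain_norm_nonneg[of \<one>] by simp

lemma chain_norm_mult:
  assumes "x \<in> carrier G" "y \<in> carrier G"
  shows "chain_norm (x \<otimes> y) \<le> chain_norm x + chain_norm y"
proof (rule field_le_epsilon)
  fix e :: real assume e: "0 < e"
  obtain xs where xs: "set xs \<subseteq> carrier G" "list_prod xs = x" "sum_list (map gauge xs) < chain_norm x + e/2"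
    using chain_norm_approx[OF assms(1), of "chain_norm x + e/2"] e by auto
  obtain ys where ys: "set ys \<subseteq> carrier G" "list_prod ys = y" "sum_list (map gauge ys) < chain_norm y + e/2"
    using chain_norm_approx[OF assms(2), of "chain_norm y + e/2"] e by auto
  show "chain_norm (x \<otimes> y) \<le> chain_norm x + chain_norm y + e"
    using chain_norm_le[of "xs @ ys"] xs ys by (simp add: list_prod_append)
qed

lemma chain_norm_inv_le:
  assumes "x \<in> carrier G"
  shows "chain_norm (inv x) \<le> chain_norm x"
proof (rule field_le_epsilon)
  fix e :: real assume e: "0 < e"
  obtain xs where xs: "set xs \<subseteq> carrier G" "list_prod xs = x" "sum_list (map gauge xs) < chain_norm x + e"
    using chain_norm_approx[OF assms, of "chain_norm x + e"] e by auto
  have "map gauge (map (m_inv G) xs) = map gauge xs"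
    using xs(1) by (auto simp: gauge_inv)
  then have "sum_list (map gauge (rev (map (m_inv G) xs))) = sum_list (map gauge xs)"
    by (simp add: rev_map[symmetric] del: map_map)
  moreover have "set (rev (map (m_inv G) xs)) \<subseteq> carrier G" using xs(1) by auto
  ultimately show "chain_norm (inv x) \<le> chain_norm x + e"
    using chain_norm_le[of "rev (map (m_inv G) xs)"] xs by (simp add: list_prod_rev_inv)
qed

lemma chain_norm_inv: "x \<in> carrier G \<Longrightarrow> chain_norm (inv x) = chain_norm x"
  using chain_norm_inv_le[of x] chain_norm_inv_le[of "inv x"] by simp

end

lemma (in topological_group) left_invariant_metric:
  assumes "metrizable_space T" "0 < (r::real)"
  obtains d where "Metric_space (carrier G) d" "Metric_space.mtopology (carrier G) d = T"
    "\<And>a x y. a \<in> carrier G \<Longrightarrow> x \<in> carrier G \<Longrightarrow> y \<in> carrier G \<Longrightarrow> d (a \<otimes> x) (a \<otimes> y) = d x y"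
    "\<And>x y. d x y \<le> r"
proof -
  obtain M e where Me: "Metric_space M e" and T: "T = Metric_space.mtopology M e"
    using assms by (auto simp: metrizable_space_def)
  interpret E: Metric_space M e by (rule Me)
  have M: "M = carrier G" using T topspace_eq_carrier by simp
  have ball: "openin T (E.mball \<one> ((1/2) ^ n))" "\<one> \<in> E.mball \<one> ((1/2) ^ n)" for n
    unfolding T by (rule E.openin_mball, rule E.centre_in_mball_iff[THEN iffD2]) (simp add: M)
  \<comment> \<open>Shrinking into the balls of a compatible metric serves twice: the chain has
    trivial intersection, so \<open>chain_norm\<close> separates points, and it is a base of
    neighbourhoods of the unit.\<close>
  define P where "P n V \<longleftrightarrow> openin T V \<and> \<one> \<in> V \<and> (\<forall>x\<in>V. inv x \<in> V) \<and> V \<subseteq> E.mball \<one> ((1/2) ^ n)" for n V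
  have step: "\<exists>V'. P n V' \<and> (\<forall>x\<in>V'. \<forall>y\<in>V'. \<forall>z\<in>V'. x \<otimes> y \<otimes> z \<in> V)" if V: "openin T V" "\<one> \<in> V" for V n
  proof -
    have "openin T (V \<inter> E.mball \<one> ((1/2) ^ n))" "\<one> \<in> V \<inter> E.mball \<one> ((1/2) ^ n)"
      using V ball[of n] by (auto simp: openin_Int)
    then obtain V' where V': "openin T V'" "\<one> \<in> V'" "\<And>x. x \<in> V' \<Longrightarrow> inv x \<in> V'"
      "\<And>x y z. x \<in> V' \<Longrightarrow> y \<in> V' \<Longrightarrow> z \<in> V' \<Longrightarrow> x \<otimes> y \<otimes> z \<in> V \<inter> E.mball \<one> ((1/2) ^ n)"
      by (rule nhd_one_cube) blast
    have "V' \<subseteq> E.mball \<one> ((1/2) ^ n)"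
    proof
      fix x assume x: "x \<in> V'"
      then have "x \<in> carrier G" using openin_subset[OF V'(1)] by (auto simp: topspace_eq_carrier)
      then show "x \<in> E.mball \<one> ((1/2) ^ n)" using V'(4)[OF x V'(2) V'(2)] by simp
    qed
    then have "P n V'" using V' by (simp add: P_def)
    moreover have "\<forall>x\<in>V'. \<forall>y\<in>V'. \<forall>z\<in>V'. x \<otimes> y \<otimes> z \<in> V" using V'(4) by blast
    ultimately show ?thesis by blast
  qed
  have "\<exists>U. \<forall>n. P n (U n) \<and> (\<forall>x\<in>U (Suc n). \<forall>y\<in>U (Suc n). \<forall>z\<in>U (Suc n). x \<otimes> y \<otimes> z \<in> U n)"
  proof (rule dependent_nat_choice)
    show "\<exists>V. P 0 V" using step[OF ball[of 0], of 0] by blast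
    show "\<exists>V'. P (Suc n) V' \<and> (\<forall>x\<in>V'. \<forall>y\<in>V'. \<forall>z\<in>V'. x \<otimes> y \<otimes> z \<in> V)" if "P n V" for V n
      by (rule step) (use that in \<open>simp_all add: P_def\<close>)
  qed
  then obtain U where U: "\<And>n. P n (U n)"
    "\<And>n x y z. x \<in> U (Suc n) \<Longrightarrow> y \<in> U (Suc n) \<Longrightarrow> z \<in> U (Suc n) \<Longrightarrow> x \<otimes> y \<otimes> z \<in> U n"
    by metis
  interpret C: nhd_chain G U
  proof
    show "U n \<subseteq> carrier G" for n
      using U(1)[of n] openin_subset[of T "U n"] by (auto simp: P_def topspace_eq_carrier)
  qed (use U in \<open>auto simp: P_def\<close>)
  \<comment> \<open>Translating both points on the left does not change
    \<open>inv x \<otimes> y\<close>. The cut-off at \<open>r\<close> gives the bound; the value 0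
    off the carrier is there because \<open>Metric_space\<close> requires nonnegativity and symmetry
    on the whole type.\<close>
  define d where "d x y = (if x \<in> carrier G \<and> y \<in> carrier G then min r (C.chain_norm (inv x \<otimes> y)) else 0)" for x y
  have d: "d x y = min r (C.chain_norm (inv x \<otimes> y))" if "x \<in> carrier G" "y \<in> carrier G" for x y
    using that by (simp add: d_def)
  have MS: "Metric_space (carrier G) d"
  proof
    fix x y
    show "0 \<le> d x y" using assms(2) by (auto simp: d_def C.chain_norm_nonneg)
    have "C.chain_norm (inv x \<otimes> y) = C.chain_norm (inv y \<otimes> x)" if "x \<in> carrier G" "y \<in> carrier G"
      using C.chain_norm_inv[of "inv x \<otimes> y"] that by (simp add: inv_mult_group)
    then show "d x y = d y x" by (auto simp: d_def)
    assume x: "x \<in> carrier G" and y: "y \<in> carrier G"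
    show "d x y = 0 \<longleftrightarrow> x = y"
    proof
      assume "d x y = 0"
      then have 0: "C.chain_norm (inv x \<otimes> y) = 0" using x y assms(2) by (auto simp: d min_def split: if_splits)
      have "e \<one> (inv x \<otimes> y) \<le> s" if "s > 0" for s
      proof -
        obtain n where n: "(1/2) ^ n < s" using real_arch_pow_inv[OF \<open>s > 0\<close>, of "1/2"] by auto
        have "inv x \<otimes> y \<in> U n" using C.chain_norm_less_imp[of "inv x \<otimes> y" n] 0 x y by simp
        then have "inv x \<otimes> y \<in> E.mball \<one> ((1/2) ^ n)" using U(1)[of n] by (auto simp: P_def)
        then show ?thesis using n by simp
      qed
      then have "e \<one> (inv x \<otimes> y) \<le> 0" using field_le_epsilon[of "e \<one> (inv x \<otimes> y)" 0] by simp
      then have "inv x \<otimes> y = \<one>" using x y M E.nonneg[of \<one> "inv x \<otimes> y"] E.zero[of \<one> "inv x \<otimes> y"]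
        by auto
      then show "x = y" using x y by (metis inv_closed inv_equality inv_inv)
    qed (use x in \<open>simp add: d C.chain_norm_one assms(2) less_imp_le\<close>)
    fix z assume z: "z \<in> carrier G"
    have "inv x \<otimes> z = (inv x \<otimes> y) \<otimes> (inv y \<otimes> z)"
      using x y z by (simp add: m_assoc r_cancel_one' flip: m_assoc[of y "inv y" z])
    then have "C.chain_norm (inv x \<otimes> z) \<le> C.chain_norm (inv x \<otimes> y) + C.chain_norm (inv y \<otimes> z)"
      using C.chain_norm_mult[of "inv x \<otimes> y" "inv y \<otimes> z"] x y z by simp
    moreover have "0 \<le> C.chain_norm (inv x \<otimes> y)" "0 \<le> C.chain_norm (inv y \<otimes> z)"
      using x y z by (auto intro: C.chain_norm_nonneg)
    ultimately show "d x z \<le> d x y + d y z"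
      using x y z assms(2) by (auto simp: d min_def)
  qed
  interpret D: Metric_space "carrier G" d by (rule MS)
  have U_openin: "openin T (U n)" for n using U(1)[of n] by (simp add: P_def)
  have "openin D.mtopology W \<longleftrightarrow> openin T W" for W
  proof
    assume W: "openin T W"
    have "\<exists>s>0. D.mball x s \<subseteq> W" if x: "x \<in> W" for x
    proof -
      have xG: "x \<in> carrier G" using x openin_subset[OF W] topspace_eq_carrier by blast
      have "openin T {y \<in> carrier G. x \<otimes> y \<in> W}" by (rule openin_left_mult_vimage[OF xG W])
      moreover have "\<one> \<in> {y \<in> carrier G. x \<otimes> y \<in> W}" using x xG by simp
      ultimately obtain s where s: "s > 0" "E.mball \<one> s \<subseteq> {y \<in> carrier G. x \<otimes> y \<in> W}"
        unfolding T E.openin_mtopology by blast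
      obtain n where n: "(1/2) ^ n < s" using real_arch_pow_inv[OF s(1), of "1/2"] by auto
      \<comment> \<open>A radius of at most \<open>r\<close> keeps the cut-off in \<open>d\<close>
        inactive.\<close>
      have "D.mball x (min r ((1/2) ^ n)) \<subseteq> W"
      proof
        fix y assume "y \<in> D.mball x (min r ((1/2) ^ n))"
        then have y: "y \<in> carrier G" "C.chain_norm (inv x \<otimes> y) < (1/2) ^ n"
          using xG by (auto simp: d min_def split: if_splits)
        then have "inv x \<otimes> y \<in> U n" using xG by (intro C.chain_norm_less_imp) auto
        then have "inv x \<otimes> y \<in> E.mball \<one> ((1/2) ^ n)" using U(1)[of n] by (auto simp: P_def)
        then have "inv x \<otimes> y \<in> E.mball \<one> s" using n by simp
        then have "x \<otimes> (inv x \<otimes> y) \<in> W" using s(2) by blast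
        then show "y \<in> W" using xG y(1) by (simp add: m_assoc[symmetric])
      qed
      then show ?thesis using assms(2) by (intro exI[of _ "min r ((1/2) ^ n)"]) simp
    qed
    then show "openin D.mtopology W"
      using openin_subset[OF W] by (auto simp: D.openin_mtopology topspace_eq_carrier)
  next
    assume W: "openin D.mtopology W"
    show "openin T W"
    proof (subst openin_subopen, intro ballI)
      fix x assume x: "x \<in> W"
      then have xG: "x \<in> carrier G" using openin_subset[OF W] by auto
      obtain s where s: "s > 0" "D.mball x s \<subseteq> W" using W x unfolding D.openin_mtopology by blast
      obtain n where n: "(1/2) ^ n < s" using real_arch_pow_inv[OF s(1), of "1/2"] by auto
      \<comment> \<open>\<open>Suc n\<close>, since \<open>gauge_less_iff\<close> turns membership
        there into a gauge below \<open>(1/2) ^ n\<close>.\<close>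
      let ?V = "{y \<in> carrier G. inv x \<otimes> y \<in> U (Suc n)}"
      have "openin T ?V" by (rule openin_left_mult_vimage[OF _ U_openin]) (use xG in simp)
      moreover have "x \<in> ?V" using xG C.one_in_U by simp
      moreover have "?V \<subseteq> W"
      proof
        fix y assume y: "y \<in> ?V"
        then have "C.chain_norm (inv x \<otimes> y) < (1/2) ^ n"
          using C.chain_norm_le_gauge[of "inv x \<otimes> y"] C.gauge_less_iff[of "inv x \<otimes> y" n] xG by auto
        then have "d x y < s" using xG y n by (auto simp: d)
        then show "y \<in> W" using s(2) xG y by auto
      qed
      ultimately show "\<exists>V. openin T V \<and> x \<in> V \<and> V \<subseteq> W" by blast
    qed
  qed
  then have "D.mtopology = T" by (simp add: topology_eq)
  moreover have "d (a \<otimes> x) (a \<otimes> y) = d x y" if "a \<in> carrier G" "x \<in> carrier G" "y \<in> carrier G" for a x y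
  proof -
    have "inv (a \<otimes> x) \<otimes> (a \<otimes> y) = inv x \<otimes> (inv a \<otimes> (a \<otimes> y))"
      using that by (simp add: inv_mult_group m_assoc)
    also have "inv a \<otimes> (a \<otimes> y) = y" using that by (simp add: m_assoc[symmetric])
    finally show ?thesis using that by (simp add: d)
  qed
  moreover have "d x y \<le> r" for x y using assms(2) by (auto simp: d_def)
  ultimately show ?thesis using that MS by blast
qed

section \<open>A rough norm over a metric space\<close>

text \<open>Isometries of a closed span carry no information outside it, so linearity is relativised
  to a set instead of using the type-wide \<open>linear\<close>.\<close>

definition linear_map_on :: "'a::real_vector set \<Rightarrow> ('a \<Rightarrow> 'b::real_vector) \<Rightarrow> bool" where
  "linear_map_on S f \<longleftrightarrow> (\<forall>x\<in>S. \<forall>y\<in>S. f (x + y) = f x + f y) \<and> (\<forall>c. \<forall>x\<in>S. f (c *\<^sub>R x) = c *\<^sub>R f x)"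

lemma linear_map_onD:
  assumes "linear_map_on S f"
  shows linear_map_on_add: "x \<in> S \<Longrightarrow> y \<in> S \<Longrightarrow> f (x + y) = f x + f y"
    and linear_map_on_scale: "x \<in> S \<Longrightarrow> f (c *\<^sub>R x) = c *\<^sub>R f x"
  using assms by (auto simp: linear_map_on_def)

lemma linear_map_on_diff:
  assumes "linear_map_on S f" "subspace S" "x \<in> S" "y \<in> S"
  shows "f (x - y) = f x - f y"
proof -
  have "f (x + (-1) *\<^sub>R y) = f x + (-1) *\<^sub>R f y"
    using assms by (metis linear_map_on_add linear_map_on_scale subspace_scale)
  then show ?thesis by simp
qed

text \<open>The bound 1/2 confines every peak to values in \<open>[1/2, 1]\<close>. Hence a peak has
  sup norm 1, and it can be close to 1 only at an index naming a point close to its own.\<close>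

locale small_metric = Metric_space M d for M :: "'p set" and d +
  assumes d_le_half: "p \<in> M \<Longrightarrow> q \<in> M \<Longrightarrow> d p q \<le> 1/2"
begin

text \<open>A Kuratowski embedding turned upside down. The wrapper \<open>discrete\<close> makes
  every bounded function continuous, so the Banach space of bounded continuous functions serves an
  arbitrary index set. Indices outside \<open>M\<close> get the same constant as
  \<open>None\<close>, the index reserved for \<open>ell\<close>.\<close>

definition pt :: "'p \<Rightarrow> 'p option discrete \<Rightarrow>\<^sub>C real" where
  "pt p = Bcontfun (\<lambda>i. case of_discrete i of None \<Rightarrow> 1/2
     | Some q \<Rightarrow> if q \<in> M then 1 - d p q else 1/2)"

lemma apply_pt:
  assumes "p \<in> M"
  shows "apply_bcontfun (pt p) i = (case of_discrete i of None \<Rightarrow> 1/2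
     | Some q \<Rightarrow> if q \<in> M then 1 - d p q else 1/2)"
proof -
  have "(\<lambda>i. case of_discrete i of None \<Rightarrow> 1/2 | Some q \<Rightarrow> if q \<in> M then 1 - d p q else 1/2)
      \<in> (bcontfun :: ('p option discrete \<Rightarrow> real) set)"
  proof (rule bcontfun_normI[where b = 1])
    show "continuous_on UNIV (\<lambda>i. case of_discrete i of None \<Rightarrow> 1/2
        | Some q \<Rightarrow> if q \<in> M then 1 - d p q else (1/2::real))"
      by (simp add: continuous_on_open_vimage open_discrete)
    show "norm (case of_discrete i of None \<Rightarrow> 1/2
        | Some q \<Rightarrow> if q \<in> M then 1 - d p q else (1/2::real)) \<le> 1" for i :: "'p option discrete"
      using d_le_half[OF assms] by (fastforce split: option.split)
  qed
  then show ?thesis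
    by (simp add: pt_def Bcontfun_inverse)
qed

lemma pt_at_None: "p \<in> M \<Longrightarrow> apply_bcontfun (pt p) (discrete None) = 1/2"
  by (simp add: apply_pt discrete_inverse)

lemma pt_at_Some: "p \<in> M \<Longrightarrow> q \<in> M \<Longrightarrow> apply_bcontfun (pt p) (discrete (Some q)) = 1 - d p q"
  by (simp add: apply_pt discrete_inverse)

lemma pt_ge_half: "p \<in> M \<Longrightarrow> 1/2 \<le> apply_bcontfun (pt p) i"
  using d_le_half by (fastforce simp: apply_pt split: option.split)

lemma pt_le_1: "p \<in> M \<Longrightarrow> apply_bcontfun (pt p) i \<le> 1"
  by (auto simp: apply_pt split: option.split)

lemma norm_pt: assumes "p \<in> M" shows "norm (pt p) = 1"
proof (rule antisym)
  show "norm (pt p) \<le> 1"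
    using pt_ge_half[OF assms] pt_le_1[OF assms] by (intro norm_bound) (smt (verit) divide_pos_pos real_norm_def)
  show "1 \<le> norm (pt p)"
    using norm_bounded[of "pt p" "discrete (Some p)"] assms by (simp add: pt_at_Some)
qed

text \<open>As for the Kuratowski embedding, the triangle inequality bounds each coordinate, and the
  coordinate of \<open>q\<close> attains the bound.\<close>

lemma norm_pt_diff: assumes "p \<in> M" "q \<in> M" shows "norm (pt p - pt q) = d p q"
proof (rule antisym)
  show "norm (pt p - pt q) \<le> d p q"
  proof (rule norm_bound)
    fix i
    show "norm (apply_bcontfun (pt p - pt q) i) \<le> d p q"
      using assms mdist_reverse_triangle[of p q] triangle commute
      by (auto simp: apply_pt abs_le_iff split: option.split) (smt (verit) triangle commute)+
  qed
  show "d p q \<le> norm (pt p - pt q)"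
    using norm_bounded[of "pt p - pt q" "discrete (Some q)"] assms by (simp add: pt_at_Some)
qed

text \<open>A coordinate functional is automatically bounded for the sup norm, and this one is
  invariant under \<open>translate\<close> because relabellings fix \<open>None\<close>. The factor
  2 gives it the value 1 at every peak.\<close>

definition ell :: "('p option discrete \<Rightarrow>\<^sub>C real) \<Rightarrow> real" where
  "ell x = 2 * apply_bcontfun x (discrete None)"

lemma linear_ell: "linear ell"
  by (rule linearI) (auto simp: ell_def algebra_simps)

lemmas ell_add = linear_add[OF linear_ell] and ell_diff = linear_diff[OF linear_ell]
  and ell_scale = linear_scale[OF linear_ell] and ell_sum = linear_sum[OF linear_ell]

lemma ell_pt: "p \<in> M \<Longrightarrow> ell (pt p) = 1"
  by (simp add: ell_def pt_at_None)

lemma abs_ell_le: "\<bar>ell x\<bar> \<le> 2 * norm x"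
  using norm_bounded[of x "discrete None"] by (simp add: ell_def)

text \<open>The remainder is charged with factor 2 for two reasons: this covers the bound
  \<open>abs_ell_le\<close>, so that \<open>hull_norm\<close> controls \<open>ell\<close>; and as 2
  exceeds 1, a nearly optimal combination for a vector with \<open>norm\<close> 1 and
  \<open>hull_norm\<close> at most 1 has a small remainder.\<close>

definition comb_costs :: "('p option discrete \<Rightarrow>\<^sub>C real) \<Rightarrow> real set" where
  "comb_costs x = {(\<Sum>p\<in>A. \<bar>c p\<bar>) + 2 * norm (x - (\<Sum>p\<in>A. c p *\<^sub>R pt p)) | A c. finite A \<and> A \<subseteq> M}"

text \<open>The unit ball of \<open>hull_norm\<close> is, up to closure, the convex hull of the points
  \<open>\<plusminus>pt p\<close> and of the ball of radius \<open>1/2\<close>.\<close>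

definition hull_norm :: "('p option discrete \<Rightarrow>\<^sub>C real) \<Rightarrow> real" where
  "hull_norm x = Inf (comb_costs x)"

lemma norm_comb_le:
  assumes "A \<subseteq> M"
  shows "norm (\<Sum>p\<in>A. c p *\<^sub>R pt p) \<le> (\<Sum>p\<in>A. \<bar>c p\<bar>)"
  using assms by (intro order_trans[OF norm_sum] sum_mono) (auto simp: norm_pt)

lemma ell_comb: "A \<subseteq> M \<Longrightarrow> ell (\<Sum>p\<in>A. c p *\<^sub>R pt p) = (\<Sum>p\<in>A. c p)"
  by (auto simp: ell_sum ell_scale ell_pt subset_iff intro!: sum.cong)

lemma comb_costs_lower:
  assumes "y \<in> comb_costs x"
  shows "norm x \<le> y" "\<bar>ell x\<bar> \<le> y"
proof -
  obtain A c where A: "finite A" "A \<subseteq> M"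
    and y: "y = (\<Sum>p\<in>A. \<bar>c p\<bar>) + 2 * norm (x - (\<Sum>p\<in>A. c p *\<^sub>R pt p))"
    using assms by (auto simp: comb_costs_def)
  let ?v = "\<Sum>p\<in>A. c p *\<^sub>R pt p"
  show "norm x \<le> y"
    using norm_triangle_sub[of x ?v] norm_comb_le[OF A(2), of c] y by (smt (verit) norm_ge_zero)
  have "\<bar>ell ?v\<bar> \<le> (\<Sum>p\<in>A. \<bar>c p\<bar>)"
    by (simp add: ell_comb A)
  moreover have "\<bar>ell x - ell ?v\<bar> \<le> 2 * norm (x - ?v)"
    using abs_ell_le[of "x - ?v"] by (simp add: ell_diff)
  ultimately show "\<bar>ell x\<bar> \<le> y"
    using y by linarith
qed

lemma comb_costs_nonempty: "2 * norm x \<in> comb_costs x"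
  unfolding comb_costs_def by (intro CollectI exI[of _ "{}"]) auto

lemma bdd_below_comb_costs: "bdd_below (comb_costs x)"
  using comb_costs_lower(1) by (meson bdd_below.I)

lemma hull_norm_le:
  assumes "finite A" "A \<subseteq> M"
  shows "hull_norm x \<le> (\<Sum>p\<in>A. \<bar>c p\<bar>) + 2 * norm (x - (\<Sum>p\<in>A. c p *\<^sub>R pt p))"
  unfolding hull_norm_def
  by (rule cInf_lower[OF _ bdd_below_comb_costs]) (use assms in \<open>auto simp: comb_costs_def\<close>)

lemma hull_norm_approx:
  assumes "hull_norm x < b"
  obtains A c where "finite A" "A \<subseteq> M"
    "(\<Sum>p\<in>A. \<bar>c p\<bar>) + 2 * norm (x - (\<Sum>p\<in>A. c p *\<^sub>R pt p)) < b"
proof -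
  have "\<exists>y\<in>comb_costs x. y < b"
    using assms comb_costs_nonempty unfolding hull_norm_def
    by (metis cInf_lessD empty_iff)
  then show ?thesis using that by (auto simp: comb_costs_def)
qed

lemma hull_norm_ge: "norm x \<le> hull_norm x" "\<bar>ell x\<bar> \<le> hull_norm x"
  using comb_costs_nonempty[of x] comb_costs_lower[of _ x] unfolding hull_norm_def
  by (intro cInf_greatest; fastforce)+

lemma hull_norm_le_norm: "hull_norm x \<le> 2 * norm x"
  using hull_norm_le[of "{}" x] by simp

lemma hull_norm_nonneg: "0 \<le> hull_norm x"
  using hull_norm_ge(1)[of x] norm_ge_zero[of x] by linarith

lemma hull_norm_pt: "p \<in> M \<Longrightarrow> hull_norm (pt p) \<le> 1"
  using hull_norm_le[of "{p}" "pt p" "\<lambda>_. 1"] by simp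

lemma hull_norm_triangle: "hull_norm (x + y) \<le> hull_norm x + hull_norm y"
proof (rule field_le_epsilon)
  fix e :: real assume e: "e > 0"
  obtain A c where A: "finite A" "A \<subseteq> M"
    "(\<Sum>p\<in>A. \<bar>c p\<bar>) + 2 * norm (x - (\<Sum>p\<in>A. c p *\<^sub>R pt p)) < hull_norm x + e/2"
    using hull_norm_approx[of x "hull_norm x + e/2"] e by auto
  obtain B c' where B: "finite B" "B \<subseteq> M"
    "(\<Sum>p\<in>B. \<bar>c' p\<bar>) + 2 * norm (y - (\<Sum>p\<in>B. c' p *\<^sub>R pt p)) < hull_norm y + e/2"
    using hull_norm_approx[of y "hull_norm y + e/2"] e by auto
  define a where "a p = (if p \<in> A then c p else 0)" for p
  define b where "b p = (if p \<in> B then c' p else 0)" for p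
  let ?v = "\<Sum>p\<in>A. c p *\<^sub>R pt p" and ?w = "\<Sum>p\<in>B. c' p *\<^sub>R pt p"
  have fin: "finite (A \<union> B)" using A B by auto
  have v: "(\<Sum>p\<in>A \<union> B. a p *\<^sub>R pt p) = ?v" and w: "(\<Sum>p\<in>A \<union> B. b p *\<^sub>R pt p) = ?w"
    by (rule sum.mono_neutral_cong_right[OF fin]; auto simp: a_def b_def)+
  have av: "(\<Sum>p\<in>A \<union> B. \<bar>a p\<bar>) = (\<Sum>p\<in>A. \<bar>c p\<bar>)" and bw: "(\<Sum>p\<in>A \<union> B. \<bar>b p\<bar>) = (\<Sum>p\<in>B. \<bar>c' p\<bar>)"
    by (rule sum.mono_neutral_cong_right[OF fin]; auto simp: a_def b_def)+
  have "hull_norm (x + y) \<le> (\<Sum>p\<in>A \<union> B. \<bar>a p + b p\<bar>)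
      + 2 * norm (x + y - (\<Sum>p\<in>A \<union> B. (a p + b p) *\<^sub>R pt p))"
    by (rule hull_norm_le) (use A B in auto)
  also have "(\<Sum>p\<in>A \<union> B. (a p + b p) *\<^sub>R pt p) = ?v + ?w"
    by (simp add: scaleR_add_left sum.distrib v w)
  finally have "hull_norm (x + y) \<le> (\<Sum>p\<in>A \<union> B. \<bar>a p + b p\<bar>) + 2 * norm (x + y - (?v + ?w))" .
  moreover have "norm (x + y - (?v + ?w)) \<le> norm (x - ?v) + norm (y - ?w)"
    using norm_triangle_ineq[of "x - ?v" "y - ?w"] by (simp add: algebra_simps)
  moreover have "(\<Sum>p\<in>A \<union> B. \<bar>a p + b p\<bar>) \<le> (\<Sum>p\<in>A. \<bar>c p\<bar>) + (\<Sum>p\<in>B. \<bar>c' p\<bar>)"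
    unfolding av[symmetric] bw[symmetric] sum.distrib[symmetric] by (intro sum_mono) auto
  ultimately show "hull_norm (x + y) \<le> hull_norm x + hull_norm y + e"
    using A(3) B(3) by linarith
qed

lemma hull_norm_scale_le: "hull_norm (a *\<^sub>R x) \<le> \<bar>a\<bar> * hull_norm x"
proof (cases "a = 0")
  case True
  then show ?thesis using hull_norm_le_norm[of 0] by simp
next
  case a: False
  show ?thesis
  proof (rule field_le_epsilon)
    fix e :: real assume e: "e > 0"
    obtain A c where A: "finite A" "A \<subseteq> M"
      "(\<Sum>p\<in>A. \<bar>c p\<bar>) + 2 * norm (x - (\<Sum>p\<in>A. c p *\<^sub>R pt p)) < hull_norm x + e / \<bar>a\<bar>"
      using hull_norm_approx[of x "hull_norm x + e / \<bar>a\<bar>"] e a by auto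
    have "hull_norm (a *\<^sub>R x) \<le> (\<Sum>p\<in>A. \<bar>a * c p\<bar>) + 2 * norm (a *\<^sub>R x - (\<Sum>p\<in>A. (a * c p) *\<^sub>R pt p))"
      by (rule hull_norm_le[OF A(1,2)])
    also have "a *\<^sub>R x - (\<Sum>p\<in>A. (a * c p) *\<^sub>R pt p) = a *\<^sub>R (x - (\<Sum>p\<in>A. c p *\<^sub>R pt p))"
      by (simp add: scaleR_diff_right scaleR_sum_right)
    also have "(\<Sum>p\<in>A. \<bar>a * c p\<bar>) + 2 * norm \<dots>
        = \<bar>a\<bar> * ((\<Sum>p\<in>A. \<bar>c p\<bar>) + 2 * norm (x - (\<Sum>p\<in>A. c p *\<^sub>R pt p)))"
      by (simp add: abs_mult sum_distrib_left distrib_left)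
    also have "\<dots> \<le> \<bar>a\<bar> * (hull_norm x + e / \<bar>a\<bar>)"
      using A(3) by (intro mult_left_mono) auto
    also have "\<dots> = \<bar>a\<bar> * hull_norm x + e"
      using a by (simp add: distrib_left)
    finally show "hull_norm (a *\<^sub>R x) \<le> \<bar>a\<bar> * hull_norm x + e" .
  qed
qed

lemma hull_norm_scale: "hull_norm (a *\<^sub>R x) = \<bar>a\<bar> * hull_norm x"
proof (cases "a = 0")
  case True
  then show ?thesis using hull_norm_le_norm[of 0] hull_norm_nonneg[of 0] by simp
next
  case a: False
  have "hull_norm x \<le> \<bar>inverse a\<bar> * hull_norm (a *\<^sub>R x)"
    using hull_norm_scale_le[of "inverse a" "a *\<^sub>R x"] a by simp
  then have "\<bar>a\<bar> * hull_norm x \<le> hull_norm (a *\<^sub>R x)"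
    using a by (simp add: field_simps)
  then show ?thesis
    using hull_norm_scale_le[of a x] by simp
qed

text \<open>A nearly optimal combination for a vector of \<open>ell\<close>-value 1 is nearly a probability measure;
  if such a combination has a value close to 1 at \<open>q\<close>, then its mass sits close to \<open>q\<close>.\<close>

lemma near_point:
  assumes "hull_norm u \<le> 1" "norm u = 1" "ell u = 1" and e: "0 < e" "e < 1/8"
  shows "\<exists>q\<in>M. norm (u - pt q) \<le> 10 * e"
proof -
  obtain A c where A: "finite A" "A \<subseteq> M"
    and Ac: "(\<Sum>p\<in>A. \<bar>c p\<bar>) + 2 * norm (u - (\<Sum>p\<in>A. c p *\<^sub>R pt p)) < 1 + e"
    using hull_norm_approx[of u "1 + e"] assms by auto
  define v where "v = (\<Sum>p\<in>A. c p *\<^sub>R pt p)"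
  \<comment> \<open>With \<open>r = norm (u - v)\<close>, the total mass is at least
    \<open>1 - r\<close>, so that \<open>1 - r + 2 * r < 1 + e\<close>.\<close>
  have uv: "norm (u - v) \<le> e"
    using Ac norm_comb_le[OF A(2), of c] norm_triangle_sub[of u v] assms unfolding v_def
    by linarith
  have sc: "(\<Sum>p\<in>A. \<bar>c p\<bar>) + 2 * norm (u - v) < 1 + e"
    using Ac by (simp add: v_def)
  have ev: "ell v = (\<Sum>p\<in>A. c p)"
    unfolding v_def by (rule ell_comb[OF A(2)])
  have lv: "\<bar>1 - (\<Sum>p\<in>A. c p)\<bar> \<le> 2 * norm (u - v)"
    using abs_ell_le[of "u - v"] assms by (simp add: ell_diff ev)
  \<comment> \<open>The cost of the remainder cancels exactly against the bound for
    \<open>ell\<close>; so the negative coefficients have mass at most \<open>e / 2\<close>.\<close>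
  have neg: "(\<Sum>p\<in>A. \<bar>c p\<bar>) - (\<Sum>p\<in>A. c p) \<le> e"
    using sc lv by linarith
  have "\<exists>i. 1 - e < \<bar>apply_bcontfun u i\<bar>"
  proof (rule ccontr)
    assume "\<not> ?thesis"
    then have "norm u \<le> 1 - e" by (intro norm_bound) (auto simp: not_less)
    then show False using assms by simp
  qed
  then obtain i where i: "1 - e < \<bar>apply_bcontfun u i\<bar>" by blast
  have uvi: "\<bar>apply_bcontfun u i - apply_bcontfun v i\<bar> \<le> e"
    using norm_bounded[of "u - v" i] uv by simp
  have vi: "apply_bcontfun v i = (\<Sum>p\<in>A. c p * apply_bcontfun (pt p) i)"
    unfolding v_def using A(1) by (induction rule: finite_induct) auto
  \<comment> \<open>Rules out a value of \<open>u\<close> close to -1 at \<open>i\<close>: peaks are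
    nonnegative and \<open>c\<close> has little negative mass.\<close>
  have low: "- e \<le> apply_bcontfun v i"
  proof -
    have "apply_bcontfun v i \<ge> (\<Sum>p\<in>A. (c p - \<bar>c p\<bar>) )"
      unfolding vi
    proof (rule sum_mono)
      fix p assume "p \<in> A"
      then have "0 \<le> apply_bcontfun (pt p) i" "apply_bcontfun (pt p) i \<le> 1"
        using pt_ge_half[of p i] pt_le_1[of p i] A(2) by auto
      then show "c p - \<bar>c p\<bar> \<le> c p * apply_bcontfun (pt p) i"
        using mult_left_le[of "apply_bcontfun (pt p) i" "- c p"]
        by (cases "c p \<ge> 0") simp_all
    qed
    then show ?thesis using neg by (simp add: sum_subtractf)
  qed
  have vi_high: "apply_bcontfun v i > 1 - 2 * e"
    using low i uvi e by linarith
  \<comment> \<open>At any other index all peaks have the value 1/2, so \<open>v\<close> would be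
    only about 1/2 there.\<close>
  have "\<exists>q\<in>M. i = discrete (Some q)"
  proof (rule ccontr)
    assume no: "\<not> (\<exists>q\<in>M. i = discrete (Some q))"
    have "apply_bcontfun (pt p) i = 1/2" if "p \<in> A" for p
    proof -
      have "p \<in> M" using that A(2) by auto
      then show ?thesis
        using no by (cases i) (auto simp: apply_pt discrete_inverse split: option.split)
    qed
    then have "apply_bcontfun v i = (\<Sum>p\<in>A. c p) / 2"
      unfolding vi sum_divide_distrib by (intro sum.cong) simp_all
    moreover have "(\<Sum>p\<in>A. c p) \<le> (\<Sum>p\<in>A. \<bar>c p\<bar>)" by (rule sum_mono) simp
    ultimately show False using vi_high sc e norm_ge_zero[of "u - v"] by linarith
  qed
  then obtain q where q: "q \<in> M" "i = discrete (Some q)" by blast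
  have "apply_bcontfun v i = (\<Sum>p\<in>A. c p) - (\<Sum>p\<in>A. c p * d p q)"
    unfolding vi sum_subtractf[symmetric] using A(2) q
    by (intro sum.cong) (auto simp: pt_at_Some algebra_simps)
  moreover have "(\<Sum>p\<in>A. c p) \<le> 1 + e"
    using sc norm_ge_zero[of "u - v"] sum_mono[of A c "\<lambda>p. \<bar>c p\<bar>", OF abs_ge_self] by linarith
  ultimately have cd: "(\<Sum>p\<in>A. c p * d p q) \<le> 3 * e"
    using vi_high by linarith
  have "(\<Sum>p\<in>A. \<bar>c p\<bar> * d p q) - (\<Sum>p\<in>A. c p * d p q) \<le> (\<Sum>p\<in>A. \<bar>c p\<bar>) - (\<Sum>p\<in>A. c p)"
    unfolding sum_subtractf[symmetric]
  proof (rule sum_mono)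
    fix p assume "p \<in> A"
    then have "0 \<le> d p q" "d p q \<le> 1" using d_le_half[of p q] q(1) A(2) by auto
    then show "\<bar>c p\<bar> * d p q - c p * d p q \<le> \<bar>c p\<bar> - c p"
      using mult_left_le[of "d p q" "\<bar>c p\<bar> - c p"] by (simp add: algebra_simps)
  qed
  then have acd: "(\<Sum>p\<in>A. \<bar>c p\<bar> * d p q) \<le> 4 * e"
    using cd neg by linarith
  have "v - (\<Sum>p\<in>A. c p) *\<^sub>R pt q = (\<Sum>p\<in>A. c p *\<^sub>R (pt p - pt q))"
    by (simp add: v_def scaleR_sum_left scaleR_diff_right sum_subtractf)
  then have "norm (v - (\<Sum>p\<in>A. c p) *\<^sub>R pt q) \<le> (\<Sum>p\<in>A. \<bar>c p\<bar> * d p q)"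
    using A(2) q(1) by (auto intro!: sum_norm_le simp: norm_pt_diff subset_iff)
  then have 1: "norm (v - (\<Sum>p\<in>A. c p) *\<^sub>R pt q) \<le> 4 * e"
    using acd by linarith
  have "norm ((\<Sum>p\<in>A. c p) *\<^sub>R pt q - pt q) = \<bar>1 - (\<Sum>p\<in>A. c p)\<bar>"
    using norm_pt[OF q(1)] norm_scaleR[of "(\<Sum>p\<in>A. c p) - 1" "pt q"]
    by (simp add: scaleR_diff_left abs_minus_commute)
  then have 2: "norm ((\<Sum>p\<in>A. c p) *\<^sub>R pt q - pt q) \<le> 2 * e"
    using lv uv by linarith
  have "norm (u - pt q) \<le> norm (u - v) + norm (v - (\<Sum>p\<in>A. c p) *\<^sub>R pt q)
      + norm ((\<Sum>p\<in>A. c p) *\<^sub>R pt q - pt q)"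
    using norm_triangle_ineq[of "u - v" "v - pt q"]
      norm_triangle_ineq[of "v - (\<Sum>p\<in>A. c p) *\<^sub>R pt q" "(\<Sum>p\<in>A. c p) *\<^sub>R pt q - pt q"] by simp
  then show ?thesis
    using 1 2 uv q(1) e by (intro bexI[of _ q]) linarith+
qed

text \<open>One direction passes three continuous conditions to the limit, the other lets
  \<open>e\<close> shrink in \<open>near_point\<close>. The gain is a description of the completed
  metric space by quantities that isometries can be shown to respect.\<close>

lemma closure_pt_iff:
  "u \<in> closure (pt ` M) \<longleftrightarrow> hull_norm u \<le> 1 \<and> norm u = 1 \<and> ell u = 1"
proof
  assume u: "u \<in> closure (pt ` M)"
  have *: "\<exists>p\<in>M. norm (u - pt p) < e" if "e > 0" for e
    using u that by (auto simp: closure_approachable dist_norm norm_minus_commute)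
  show "hull_norm u \<le> 1 \<and> norm u = 1 \<and> ell u = 1"
  proof (intro conjI)
    show "hull_norm u \<le> 1"
    proof (rule field_le_epsilon)
      fix e :: real assume "e > 0"
      then obtain p where p: "p \<in> M" "norm (u - pt p) < e/2" using *[of "e/2"] by auto
      show "hull_norm u \<le> 1 + e"
        using hull_norm_triangle[of "u - pt p" "pt p"] hull_norm_le_norm[of "u - pt p"] p hull_norm_pt[OF p(1)]
        by simp
    qed
    have "\<bar>norm u - 1\<bar> \<le> e" if "e > 0" for e
    proof -
      obtain p where p: "p \<in> M" "norm (u - pt p) < e" using *[of e] \<open>e > 0\<close> by auto
      then show ?thesis
        using norm_triangle_ineq3[of u "pt p"] by (simp add: norm_pt)
    qed
    then show "norm u = 1"
      using field_le_epsilon[of "\<bar>norm u - 1\<bar>" 0] by auto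
    have "\<bar>ell u - 1\<bar> \<le> e" if "e > 0" for e
    proof -
      obtain p where p: "p \<in> M" "norm (u - pt p) < e/2" using *[of "e/2"] \<open>e > 0\<close> by auto
      then show ?thesis
        using abs_ell_le[of "u - pt p"] by (simp add: ell_diff ell_pt)
    qed
    then show "ell u = 1"
      using field_le_epsilon[of "\<bar>ell u - 1\<bar>" 0] by auto
  qed
next
  assume u: "hull_norm u \<le> 1 \<and> norm u = 1 \<and> ell u = 1"
  show "u \<in> closure (pt ` M)"
    unfolding closure_approachable
  proof (intro allI impI)
    fix e :: real assume "e > 0"
    then have "0 < min (e/20) (1/16)" "min (e/20) (1/16) < 1/8" by auto
    from near_point[OF _ _ _ this] u obtain q where "q \<in> M" "norm (u - pt q) \<le> 10 * min (e/20) (1/16)"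
      by blast
    moreover have "10 * min (e/20) (1/16) < e" using \<open>e > 0\<close> by (auto simp: min_def)
    ultimately show "\<exists>y\<in>pt ` M. dist y u < e"
      by (intro bexI[of _ "pt q"]) (auto simp: dist_norm norm_minus_commute)
  qed
qed

end

section \<open>Monotonicity, asymptotics and second differences of the Euclidean norm of the
  plane\<close>

lemma norm_Pair_mono:
  fixes a b b' :: real
  assumes "0 \<le> b" "b \<le> b'"
  shows "norm (a, b) \<le> norm (a, b')"
  using assms by (auto simp: norm_Pair power_mono)

lemma norm_Pair_tendsto: "((\<lambda>s. norm (s, m::real) - s) \<longlongrightarrow> 0) at_top"
  unfolding norm_Pair by simp real_asymp

lemma norm_Pair_shift_tendsto: "((\<lambda>t. norm (t + a, m::real) - (t + a)) \<longlongrightarrow> 0) at_top"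
  by (rule filterlim_compose[OF norm_Pair_tendsto]) real_asymp

text \<open>The second derivative of \<open>sqrt (a\<^sup>2 + m\<^sup>2)\<close> in \<open>a\<close>
  is at most \<open>1 / m\<close>. Instead of derivatives, the tangent bound
  \<open>sqrt (N\<^sup>2 + r) \<le> N + r / (2 * N)\<close> is applied for \<open>s\<close> and
  \<open>- s\<close>, and the linear terms cancel.\<close>

lemma norm_Pair_second_difference:
  fixes a :: real
  assumes "m > 0"
  shows "norm (a + s, m) + norm (a - s, m) \<le> 2 * norm (a, m) + s\<^sup>2 / m"
proof -
  define N where "N = norm (a, m)"
  have N2: "N\<^sup>2 = a\<^sup>2 + m\<^sup>2" and Nm: "m \<le> N"
    using assms by (auto simp: N_def norm_Pair real_le_rsqrt)
  have N: "N > 0" using Nm assms by simp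
  have *: "norm (a + t, m) \<le> N + r / (2 * N)" if r: "r = 2 * a * t + t\<^sup>2" for t r
  proof -
    have at: "(a + t)\<^sup>2 + m\<^sup>2 = N\<^sup>2 + r"
      using N2 r by (simp add: power2_sum)
    also have "\<dots> \<le> N\<^sup>2 + r + (r / (2 * N))\<^sup>2" by simp
    also have "\<dots> = (N + r / (2 * N))\<^sup>2"
      using N by (simp add: power2_sum)
    finally have le: "(a + t)\<^sup>2 + m\<^sup>2 \<le> (N + r / (2 * N))\<^sup>2" .
    have "0 \<le> N\<^sup>2 + r" unfolding at[symmetric] by simp
    then have "- (N * N) \<le> r" by (simp add: power2_eq_square)
    then have "- N \<le> r / N" using N by (simp add: pos_le_divide_eq)
    then have "0 \<le> N + r / (2 * N)" using N by simp
    then show ?thesis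
      using le by (simp add: norm_Pair real_le_lsqrt)
  qed
  have "norm (a + s, m) + norm (a - s, m)
      \<le> (N + (2 * a * s + s\<^sup>2) / (2 * N)) + (N + (2 * a * (- s) + (- s)\<^sup>2) / (2 * N))"
    using add_mono[OF *[OF refl, of s] *[OF refl, of "- s"]] by simp
  also have "\<dots> = 2 * N + ((2 * a * s + s\<^sup>2) + (2 * a * (- s) + (- s)\<^sup>2)) / (2 * N)"
    by (simp only: add_divide_distrib)
  also have "\<dots> = 2 * N + s\<^sup>2 / N" by simp
  also have "s\<^sup>2 / N \<le> s\<^sup>2 / m"
    using Nm assms by (intro divide_left_mono) auto
  finally show ?thesis by (simp add: N_def)
qed

lemma subspace_closure:
  fixes S :: "'a::real_normed_vector set"
  assumes "subspace S"
  shows "subspace (closure S)"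
proof (rule subspaceI)
  show "0 \<in> closure S"
    using subspace_0[OF assms] closure_subset[of S] by blast
  fix x y assume "x \<in> closure S" and "y \<in> closure S"
  then obtain f g where fg: "\<forall>n. f n \<in> S" "f \<longlonglongrightarrow> x" "\<forall>n. g n \<in> S" "g \<longlonglongrightarrow> y"
    unfolding closure_sequential by metis
  have "(\<lambda>n. f n + g n) \<longlonglongrightarrow> x + y" using fg by (intro tendsto_intros)
  then show "x + y \<in> closure S"
    unfolding closure_sequential using fg subspace_add[OF assms] by (intro exI[of _ "\<lambda>n. f n + g n"]) simp
next
  fix x and c :: real assume "x \<in> closure S"
  then obtain f where f: "\<forall>n. f n \<in> S" "f \<longlonglongrightarrow> x"
    unfolding closure_sequential by metis
  have "(\<lambda>n. c *\<^sub>R f n) \<longlonglongrightarrow> c *\<^sub>R x" using f by (intro tendsto_intros)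
  then show "c *\<^sub>R x \<in> closure S"
    unfolding closure_sequential using f subspace_scale[OF assms] by (intro exI[of _ "\<lambda>n. c *\<^sub>R f n"]) simp
qed

section \<open>The norm on the product with the real line, and its isometries\<close>

context small_metric
begin

text \<open>The weights 2, 1 and the shifts 1, -2 are chosen so that \<open>tilt x t - 3 \<bar>t\<bar>\<close> vanishes at
  infinity although \<open>tilt x \<noteq> tilt (- x)\<close> when \<open>ell x \<noteq> 0\<close>; this asymmetry is what prevents
  \<open>(x, t) \<mapsto> (- x, t)\<close> from being an isometry.\<close>

definition tilt :: "('p option discrete \<Rightarrow>\<^sub>C real) \<Rightarrow> real \<Rightarrow> real" where
  "tilt x t = 2 * norm (t - ell x, norm x) + norm (t + 2 * ell x, norm x)"

definition disp_norm :: "('p option discrete \<Rightarrow>\<^sub>C real) \<times> real \<Rightarrow> real" where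
  "disp_norm z = hull_norm (fst z) + tilt (fst z) (snd z)"

lemma tilt_ge: "3 * \<bar>t\<bar> \<le> tilt x t"
proof -
  have "\<bar>t - ell x\<bar> \<le> norm (t - ell x, norm x)" "\<bar>t + 2 * ell x\<bar> \<le> norm (t + 2 * ell x, norm x)"
    using norm_fst_le[of "t - ell x" "norm x"] norm_fst_le[of "t + 2 * ell x" "norm x"] by auto
  then show ?thesis unfolding tilt_def by linarith
qed

lemma tilt_zero: "tilt 0 t = 3 * \<bar>t\<bar>"
  by (simp add: tilt_def linear_0[OF linear_ell] norm_Pair)

lemma tilt_triangle: "tilt (x + y) (s + t) \<le> tilt x s + tilt y t"
proof -
  have *: "norm (a + b, norm (x + y)) \<le> norm (a, norm x) + norm (b, norm y)" for a b :: real
  proof -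
    have "norm (a + b, norm (x + y)) \<le> norm (a + b, norm x + norm y)"
      by (rule norm_Pair_mono) (auto simp: norm_triangle_ineq)
    also have "\<dots> \<le> norm (a, norm x) + norm (b, norm y)"
      using norm_triangle_ineq[of "(a, norm x)" "(b, norm y)"] by simp
    finally show ?thesis .
  qed
  show ?thesis
    using *[of "s - ell x" "t - ell y"] *[of "s + 2 * ell x" "t + 2 * ell y"]
    unfolding tilt_def ell_add by (simp add: algebra_simps)
qed

lemma tilt_scale: "tilt (c *\<^sub>R x) (c * t) = \<bar>c\<bar> * tilt x t"
proof -
  have *: "norm (c * a, norm (c *\<^sub>R x)) = \<bar>c\<bar> * norm (a, norm x)" for a :: real
  proof -
    have "norm (c * a, norm (c *\<^sub>R x)) = norm (c *\<^sub>R (a, norm x))"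
      by (simp add: norm_Pair abs_mult power_mult_distrib)
    then show ?thesis by (simp only: norm_scaleR)
  qed
  show ?thesis
    using *[of "t - ell x"] *[of "t + 2 * ell x"]
    unfolding tilt_def ell_scale by (simp add: algebra_simps)
qed

lemma tilt_le: "tilt x t \<le> 3 * \<bar>t\<bar> + 11 * norm x"
proof -
  have "norm (t - ell x, norm x) \<le> \<bar>t\<bar> + 2 * norm x + norm x"
    using norm_Pair_le[of "t - ell x" "norm x"] abs_ell_le[of x] by simp
  moreover have "norm (t + 2 * ell x, norm x) \<le> \<bar>t\<bar> + 4 * norm x + norm x"
    using norm_Pair_le[of "t + 2 * ell x" "norm x"] abs_ell_le[of x] by simp
  ultimately show ?thesis unfolding tilt_def by linarith
qed

lemma disp_norm_triangle: "disp_norm (z + w) \<le> disp_norm z + disp_norm w"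
  using hull_norm_triangle[of "fst z" "fst w"] tilt_triangle[of "fst z" "fst w" "snd z" "snd w"]
  by (simp add: disp_norm_def)

lemma disp_norm_scale: "disp_norm (c *\<^sub>R z) = \<bar>c\<bar> * disp_norm z"
  using hull_norm_scale[of c "fst z"] tilt_scale[of c "fst z" "snd z"]
  by (simp add: disp_norm_def distrib_left)

lemma disp_norm_ge: "norm z \<le> disp_norm z"
  using hull_norm_ge(1)[of "fst z"] tilt_ge[of "snd z" "fst z"] norm_Pair_le[of "fst z" "snd z"]
  by (auto simp: disp_norm_def)

lemma disp_norm_le: "disp_norm z \<le> 16 * norm z"
  using hull_norm_le_norm[of "fst z"] tilt_le[of "fst z" "snd z"] norm_fst_le[of "fst z" "snd z"]
    norm_snd_le[of "snd z" "fst z"]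
  by (auto simp: disp_norm_def)

lemma disp_norm_axis: "disp_norm (0, t) = 3 * \<bar>t\<bar>"
proof -
  have "hull_norm 0 = 0" using hull_norm_scale[of 0 0] by simp
  then show ?thesis by (simp add: disp_norm_def tilt_zero)
qed

lemma tilt_tendsto: "((\<lambda>t. tilt x t - 3 * t) \<longlongrightarrow> 0) at_top"
proof -
  have "((\<lambda>t. 2 * (norm (t + (- ell x), norm x) - (t + (- ell x)))
      + (norm (t + 2 * ell x, norm x) - (t + 2 * ell x))) \<longlongrightarrow> 2 * 0 + 0) at_top"
    by (intro tendsto_intros norm_Pair_shift_tendsto)
  then show ?thesis by (simp add: tilt_def algebra_simps)
qed

text \<open>Far out on the axis \<open>tilt\<close> forgets \<open>x\<close>, so the limit isolates
  \<open>hull_norm x\<close>. The term in \<open>s\<close> changes sign under negation while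
  \<open>hull_norm\<close> does not, which lets \<open>isometry_fixing_axis\<close> separate the
  two.\<close>

lemma disp_norm_tendsto: "((\<lambda>t. disp_norm (x, t + s) - 3 * t) \<longlongrightarrow> hull_norm x + 3 * s) at_top"
proof -
  have "((\<lambda>t. tilt x (t + s) - 3 * (t + s)) \<longlongrightarrow> 0) at_top"
    by (rule filterlim_compose[OF tilt_tendsto]) real_asymp
  then have "((\<lambda>t. (tilt x (t + s) - 3 * (t + s)) + (hull_norm x + 3 * s))
      \<longlongrightarrow> 0 + (hull_norm x + 3 * s)) at_top"
    by (intro tendsto_intros)
  then show ?thesis by (simp add: disp_norm_def algebra_simps)
qed

lemma disp_norm_minus: "disp_norm (- z) = disp_norm z"
  using disp_norm_scale[of "-1" z] by simp

text \<open>The norm is smooth in the direction \<open>(0, 1)\<close> away from the line through \<open>(0, 1)\<close> ...\<close>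

lemma disp_norm_second_difference:
  assumes "x \<noteq> 0"
  shows "disp_norm (x, t + s) + disp_norm (x, t - s) \<le> 2 * disp_norm (x, t) + 3 * s\<^sup>2 / norm x"
proof -
  have e: "t + s - ell x = t - ell x + s" "t - s - ell x = t - ell x - s"
    "t + s + 2 * ell x = t + 2 * ell x + s" "t - s + 2 * ell x = t + 2 * ell x - s"
    by simp_all
  have 1: "norm (t + s - ell x, norm x) + norm (t - s - ell x, norm x)
      \<le> 2 * norm (t - ell x, norm x) + s\<^sup>2 / norm x"
    unfolding e by (rule norm_Pair_second_difference) (use assms in simp)
  have 2: "norm (t + s + 2 * ell x, norm x) + norm (t - s + 2 * ell x, norm x)
      \<le> 2 * norm (t + 2 * ell x, norm x) + s\<^sup>2 / norm x"
    unfolding e by (rule norm_Pair_second_difference) (use assms in simp)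
  have 3: "3 * s\<^sup>2 / norm x = 3 * (s\<^sup>2 / norm x)" by simp
  show ?thesis
    unfolding 3 disp_norm_def tilt_def fst_conv snd_conv using 1 2 by argo
qed

text \<open>... and at \<open>(0, 1)\<close> it is rough in all directions but its own.\<close>

lemma disp_norm_rough:
  "6 + 2 * \<bar>s\<bar> * norm (fst w) \<le> disp_norm ((0, 1) + s *\<^sub>R w) + disp_norm ((0, 1) - s *\<^sub>R w)"
proof -
  have 1: "\<bar>s\<bar> * norm (fst w) \<le> hull_norm (s *\<^sub>R fst w)"
    using hull_norm_ge(1)[of "s *\<^sub>R fst w"] by simp
  have 2: "hull_norm (- (s *\<^sub>R fst w)) = hull_norm (s *\<^sub>R fst w)"
    using hull_norm_scale[of "-1" "s *\<^sub>R fst w"] by simp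
  have "6 \<le> 3 * \<bar>1 + a\<bar> + 3 * \<bar>1 - a\<bar>" for a :: real
    by argo
  from this[of "s * snd w"]
  have "6 \<le> 3 * \<bar>1 + s * snd w\<bar> + 3 * \<bar>1 - s * snd w\<bar>" .
  also have "\<dots> \<le> tilt (s *\<^sub>R fst w) (1 + s * snd w) + tilt (- (s *\<^sub>R fst w)) (1 - s * snd w)"
    by (intro add_mono tilt_ge)
  finally have 3: "6 \<le> tilt (s *\<^sub>R fst w) (1 + s * snd w) + tilt (- (s *\<^sub>R fst w)) (1 - s * snd w)" .
  have 4: "disp_norm ((0, 1) + s *\<^sub>R w) = hull_norm (s *\<^sub>R fst w) + tilt (s *\<^sub>R fst w) (1 + s * snd w)"
    "disp_norm ((0, 1) - s *\<^sub>R w) = hull_norm (s *\<^sub>R fst w) + tilt (- (s *\<^sub>R fst w)) (1 - s * snd w)"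
    using 2 by (simp_all add: disp_norm_def)
  show ?thesis
    unfolding 4 mult.assoc using 1 3 by argo
qed

definition pt_span :: "('p option discrete \<Rightarrow>\<^sub>C real) set" where
  "pt_span = closure (span (pt ` M))"

lemma subspace_pt_span: "subspace pt_span"
  unfolding pt_span_def by (intro subspace_closure subspace_span)

lemma closed_pt_span: "closed pt_span"
  unfolding pt_span_def by simp

lemma closure_pt_subset: "closure (pt ` M) \<subseteq> pt_span"
  unfolding pt_span_def by (intro closure_mono span_superset)

lemma pt_in_span: "p \<in> M \<Longrightarrow> pt p \<in> pt_span"
  using closure_pt_subset closure_subset[of "pt ` M"] by blast

text \<open>When \<open>norm u\<close> and \<open>\<bar>ell u\<bar>\<close> are at most 1, the value
  prescribed at 0 is the largest possible and forces both squares to be 1. The value at 1 then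
  decides the sign: \<open>ell u = -1\<close> would give \<open>2 * sqrt 5 + sqrt 2\<close>
  instead.\<close>

lemma tilt_determines:
  assumes "hull_norm u \<le> 1" "tilt u 0 = 2 * sqrt 2 + sqrt 5" "tilt u 1 = 2 + sqrt 10"
  shows "norm u = 1" "ell u = 1"
proof -
  have n1: "norm u \<le> 1" and l1: "\<bar>ell u\<bar> \<le> 1"
    using hull_norm_ge[of u] assms(1) by linarith+
  have sq: "(ell u)\<^sup>2 \<le> 1" "(norm u)\<^sup>2 \<le> 1"
    using n1 l1 by (simp_all add: abs_square_le_1)
  have t0: "tilt u 0 = 2 * sqrt ((ell u)\<^sup>2 + (norm u)\<^sup>2) + sqrt (4 * (ell u)\<^sup>2 + (norm u)\<^sup>2)"
    by (simp add: tilt_def norm_Pair power_mult_distrib)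
  have a: "sqrt ((ell u)\<^sup>2 + (norm u)\<^sup>2) \<le> sqrt 2"
    using sq by simp
  have b: "sqrt (4 * (ell u)\<^sup>2 + (norm u)\<^sup>2) \<le> sqrt 5"
    using sq by simp
  have "sqrt ((ell u)\<^sup>2 + (norm u)\<^sup>2) = sqrt 2"
    using a b t0 assms(2) by linarith
  then have "(ell u)\<^sup>2 = 1" "(norm u)\<^sup>2 = 1"
    using sq by auto
  then show nu: "norm u = 1"
    by (metis norm_ge_zero power2_eq_iff_nonneg one_power2 zero_le_one)
  have "ell u = 1 \<or> ell u = -1"
    using \<open>(ell u)\<^sup>2 = 1\<close> by (simp add: power2_eq_1_iff)
  moreover have "ell u \<noteq> -1"
  proof
    assume "ell u = -1"
    then have "tilt u 1 = 2 * sqrt 5 + sqrt 2"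
      by (simp add: tilt_def norm_Pair nu)
    then have "2 * sqrt 5 + sqrt 2 = 2 + sqrt 10" using assms(3) by simp
    moreover have "2.2 < sqrt 5" "1.4 < sqrt 2" "sqrt 10 < 3.2"
      by ((rule real_less_rsqrt real_less_lsqrt; simp add: power2_eq_square)+)
    ultimately show False by simp
  qed
  ultimately show "ell u = 1" by blast
qed

lemma closure_pt_iff_tilt:
  "u \<in> closure (pt ` M) \<longleftrightarrow>
    hull_norm u \<le> 1 \<and> tilt u 0 = 2 * sqrt 2 + sqrt 5 \<and> tilt u 1 = 2 + sqrt 10"
proof
  assume "u \<in> closure (pt ` M)"
  then show "hull_norm u \<le> 1 \<and> tilt u 0 = 2 * sqrt 2 + sqrt 5 \<and> tilt u 1 = 2 + sqrt 10"
    by (simp add: closure_pt_iff tilt_def norm_Pair)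
qed (use tilt_determines in \<open>auto simp: closure_pt_iff\<close>)

text \<open>Second differences are compared as \<open>s\<close> tends to 0. At \<open>(0, 1)\<close>
  they exceed 6 by at least a multiple of \<open>s\<close>, unless the direction is that of the
  axis; at \<open>(x, t)\<close> with \<open>x \<noteq> 0\<close>, in direction
  \<open>(0, 1)\<close>, by at most a multiple of \<open>s\<^sup>2\<close>.\<close>

lemma isometry_axis:
  assumes lin: "linear_map_on (pt_span \<times> UNIV) T"
    and surj: "T ` (pt_span \<times> UNIV) = pt_span \<times> UNIV"
    and iso: "\<And>z. z \<in> pt_span \<times> UNIV \<Longrightarrow> disp_norm (T z) = disp_norm z"
  shows "T (0, 1) = (0, 1) \<or> T (0, 1) = (0, -1)"
proof -
  let ?Y = "pt_span \<times> (UNIV :: real set)"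
  have sY: "subspace ?Y"
    by (intro subspace_Times subspace_pt_span subspace_UNIV)
  have e: "(0, 1) \<in> ?Y" using subspace_0[OF subspace_pt_span] by simp
  define x where "x = fst (T (0, 1))"
  define t where "t = snd (T (0, 1))"
  have T: "T (0, 1) = (x, t)" by (simp add: x_def t_def)
  have "x = 0"
  proof (rule ccontr)
    assume x: "x \<noteq> 0"
    \<comment> \<open>The direction \<open>w\<close> is the one that \<open>T\<close> carries to the
      direction in which the norm is smooth at \<open>(x, t)\<close>.\<close>
    have "(0, 1) \<in> T ` ?Y"
      unfolding surj by (rule e)
    then obtain w where w: "w \<in> ?Y" "T w = (0, 1)"
      by (elim imageE) simp
    have "2 * s * norm (fst w) \<le> 3 * s\<^sup>2 / norm x" if s: "s > 0" for s
    proof -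
      have sw: "s *\<^sub>R w \<in> ?Y" by (rule subspace_scale[OF sY w(1)])
      have Tsw: "T (s *\<^sub>R w) = (0, s)"
        using linear_map_on_scale[OF lin w(1), of s] w(2) by simp
      have "T ((0, 1) + s *\<^sub>R w) = (x, t + s)"
        unfolding linear_map_on_add[OF lin e sw] T Tsw by simp
      moreover have "T ((0, 1) - s *\<^sub>R w) = (x, t - s)"
        unfolding linear_map_on_diff[OF lin sY e sw] T Tsw by simp
      moreover have "(0, 1) + s *\<^sub>R w \<in> ?Y" "(0, 1) - s *\<^sub>R w \<in> ?Y"
        by (rule subspace_add[OF sY e sw] subspace_diff[OF sY e sw])+
      ultimately have "disp_norm ((0, 1) + s *\<^sub>R w) = disp_norm (x, t + s)"
        "disp_norm ((0, 1) - s *\<^sub>R w) = disp_norm (x, t - s)"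
        using iso[of "(0, 1) + s *\<^sub>R w"] iso[of "(0, 1) - s *\<^sub>R w"] by simp_all
      moreover have "disp_norm (x, t) = 3"
        using iso[OF e] T disp_norm_axis[of 1] by simp
      ultimately show ?thesis
        using disp_norm_rough[of s w] disp_norm_second_difference[OF x, of t s] s by simp
    qed
    then have *: "2 * norm (fst w) \<le> s * (3 / norm x)" if "s > 0" for s
    proof -
      have "s * (2 * norm (fst w)) \<le> s * (s * (3 / norm x))"
        using \<open>\<And>s. s > 0 \<Longrightarrow> 2 * s * norm (fst w) \<le> 3 * s\<^sup>2 / norm x\<close>[OF that]
        by (simp add: power2_eq_square mult_ac)
      then show ?thesis using that by (simp only: mult_le_cancel_left_pos)
    qed
    have "2 * norm (fst w) \<le> 0"
    proof (rule field_le_epsilon)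
      fix r :: real assume "r > 0"
      then show "2 * norm (fst w) \<le> 0 + r"
        using *[of "r * norm x / 3"] x by simp
    qed
    \<comment> \<open>So \<open>w\<close> lies on the axis and its image is a multiple of
      \<open>(x, t)\<close>, which cannot be \<open>(0, 1)\<close> when
      \<open>x \<noteq> 0\<close>.\<close>
    then have "w = snd w *\<^sub>R (0, 1)" by (simp add: prod_eq_iff)
    then have "(0, 1) = snd w *\<^sub>R (x, t)"
      using linear_map_on_scale[OF lin e, of "snd w"] T w(2) by simp
    then show False using x by auto
  qed
  then have "3 * \<bar>t\<bar> = 3"
    using iso[OF e] T by (simp add: disp_norm_axis)
  then have "t = 1 \<or> t = -1" by linarith
  then show ?thesis using T \<open>x = 0\<close> by auto
qed

lemma isometry_fixing_axis:
  assumes lin: "linear_map_on (pt_span \<times> UNIV) T"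
    and surj: "T ` (pt_span \<times> UNIV) = pt_span \<times> UNIV"
    and iso: "\<And>z. z \<in> pt_span \<times> UNIV \<Longrightarrow> disp_norm (T z) = disp_norm z"
    and axis: "T (0, 1) = (0, 1)"
  shows "\<exists>S. linear_map_on pt_span S \<and> S ` pt_span = pt_span \<and>
    (\<forall>x\<in>pt_span. \<forall>t. T (x, t) = (S x, t)) \<and>
    (\<forall>x\<in>pt_span. hull_norm (S x) = hull_norm x \<and> (\<forall>t. tilt (S x) t = tilt x t))"
proof -
  let ?Y = "pt_span \<times> (UNIV :: real set)"
  define S where "S x = fst (T (x, 0))" for x
  have e: "(0, t) \<in> ?Y" for t using subspace_0[OF subspace_pt_span] by simp
  have Tsplit: "T (x, t) = T (x, 0) + (0, t)" if "x \<in> pt_span" for x t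
    using linear_map_on_add[OF lin, of "(x, 0)" "(0, t)"] that e[of t]
      linear_map_on_scale[OF lin, of "(0, 1)" t] e[of 1] axis by simp
  \<comment> \<open>A priori \<open>T\<close> might shift the last coordinate by an amount
    \<open>s\<close> depending on \<open>x\<close>. The two limits give
    \<open>hull_norm (S x) \<plusminus> 3 * s = hull_norm x\<close>, hence
    \<open>s = 0\<close>.\<close>
  have snd0: "snd (T (x, 0)) = 0 \<and> hull_norm (S x) = hull_norm x" if x: "x \<in> pt_span" for x
  proof -
    define s where "s = snd (T (x, 0))"
    have Tx: "T (x, t) = (S x, t + s)" for t
      using Tsplit[OF x, of t] by (simp add: S_def s_def prod_eq_iff)
    have eq: "disp_norm (S x, t + s) = disp_norm (x, t)" for t
      using iso[of "(x, t)"] x Tx[of t] by simp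
    have "((\<lambda>t. disp_norm (x, t + 0) - 3 * t) \<longlongrightarrow> hull_norm (S x) + 3 * s) at_top"
      using disp_norm_tendsto[of "S x" s] by (simp add: eq)
    then have 1: "hull_norm (S x) + 3 * s = hull_norm x + 3 * 0"
      using disp_norm_tendsto[of x 0] by (rule tendsto_unique[OF trivial_limit_at_top_linorder])
    \<comment> \<open>Central symmetry turns the behaviour at minus infinity into one at plus
      infinity for \<open>- x\<close>, where \<open>s\<close> has the opposite sign.\<close>
    have eq': "disp_norm (- S x, t - s) = disp_norm (- x, t)" for t
      using eq[of "- t"] disp_norm_minus[of "(S x, - t + s)"] disp_norm_minus[of "(x, - t)"] by simp
    have "((\<lambda>t. disp_norm (- x, t + 0) - 3 * t) \<longlongrightarrow> hull_norm (- S x) + 3 * (- s)) at_top"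
      using disp_norm_tendsto[of "- S x" "- s"] by (simp add: eq')
    then have 2: "hull_norm (- S x) + 3 * (- s) = hull_norm (- x) + 3 * 0"
      using disp_norm_tendsto[of "- x" 0] by (rule tendsto_unique[OF trivial_limit_at_top_linorder])
    have "hull_norm (- y) = hull_norm y" for y
      using hull_norm_scale[of "-1" y] by simp
    then show ?thesis using 1 2 unfolding s_def by simp
  qed
  have TS: "T (x, t) = (S x, t)" if "x \<in> pt_span" for x t
    using Tsplit[OF that, of t] snd0[OF that] by (simp add: S_def prod_eq_iff)
  have "linear_map_on pt_span S"
    unfolding linear_map_on_def
  proof (intro conjI ballI allI)
    fix x y c assume x: "x \<in> pt_span" and y: "y \<in> pt_span"
    show "S (x + y) = S x + S y"
      using linear_map_on_add[OF lin, of "(x, 0)" "(y, 0)"] x y by (simp add: S_def)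
    show "S (c *\<^sub>R x) = c *\<^sub>R S x"
      using linear_map_on_scale[OF lin, of "(x, 0)" c] x by (simp add: S_def)
  qed
  moreover have "S ` pt_span = pt_span"
  proof
    show "S ` pt_span \<subseteq> pt_span"
    proof
      fix y assume "y \<in> S ` pt_span"
      then obtain x where x: "x \<in> pt_span" "y = S x" by blast
      then have "T (x, 0) \<in> ?Y" using surj by blast
      then show "y \<in> pt_span" using TS x by simp
    qed
    show "pt_span \<subseteq> S ` pt_span"
    proof
      fix y assume "y \<in> pt_span"
      then have "(y, 0) \<in> T ` ?Y" using surj by simp
      then obtain x t where "x \<in> pt_span" "T (x, t) = (y, 0)" by (elim imageE SigmaE) simp
      then show "y \<in> S ` pt_span" using TS by auto
    qed
  qed
  moreover have "hull_norm (S x) = hull_norm x \<and> (\<forall>t. tilt (S x) t = tilt x t)" if x: "x \<in> pt_span" for x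
  proof (intro conjI allI)
    show h: "hull_norm (S x) = hull_norm x" using snd0[OF x] by blast
    show "tilt (S x) t = tilt x t" for t
      using iso[of "(x, t)"] TS[OF x, of t] x h by (simp add: disp_norm_def)
  qed
  ultimately show ?thesis using TS by blast
qed

text \<open>Differences of points of the closure lie in the kernel of \<open>ell\<close>, and there
  \<open>tilt x 0\<close> is \<open>3 * norm x\<close>. So distances between these points are
  preserved without first showing that \<open>S\<close> preserves \<open>norm\<close> on all of
  \<open>pt_span\<close>.\<close>

lemma linear_tilt_isometry_points:
  assumes lin: "linear_map_on pt_span S" and surj: "S ` pt_span = pt_span"
    and iso: "\<And>x. x \<in> pt_span \<Longrightarrow> hull_norm (S x) = hull_norm x \<and> (\<forall>t. tilt (S x) t = tilt x t)"
  shows "S ` closure (pt ` M) = closure (pt ` M)"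
    and "\<And>u v. u \<in> closure (pt ` M) \<Longrightarrow> v \<in> closure (pt ` M) \<Longrightarrow> norm (S u - S v) = norm (u - v)"
proof -
  have *: "S u \<in> closure (pt ` M) \<longleftrightarrow> u \<in> closure (pt ` M)" if "u \<in> pt_span" for u
    using iso[OF that] by (simp add: closure_pt_iff_tilt)
  show "S ` closure (pt ` M) = closure (pt ` M)"
  proof
    show "S ` closure (pt ` M) \<subseteq> closure (pt ` M)"
      using * closure_pt_subset by blast
    show "closure (pt ` M) \<subseteq> S ` closure (pt ` M)"
      using * closure_pt_subset surj by (smt (verit, best) image_iff subset_iff)
  qed
  fix u v assume uv: "u \<in> closure (pt ` M)" "v \<in> closure (pt ` M)"
  have sp: "u \<in> pt_span" "v \<in> pt_span" using uv closure_pt_subset by auto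
  then have "u - v \<in> pt_span" by (rule subspace_diff[OF subspace_pt_span])
  then have "tilt (S u - S v) 0 = tilt (u - v) 0"
    using iso linear_map_on_diff[OF lin subspace_pt_span sp] by metis
  moreover have "S u \<in> closure (pt ` M)" "S v \<in> closure (pt ` M)"
    using uv *[OF sp(1)] *[OF sp(2)] by simp_all
  then have "ell (u - v) = 0" "ell (S u - S v) = 0"
    using uv by (simp_all add: ell_diff closure_pt_iff)
  ultimately show "norm (S u - S v) = norm (u - v)"
    by (simp add: tilt_def norm_Pair)
qed

end

section \<open>Transport of a separable Banach space to real sequences\<close>

instance bcontfun :: (metric_space, banach) banach ..

lemma mtopology_dist_eq_top_of_set: "Metric_space.mtopology S dist = top_of_set S"
  for S :: "'a::metric_space set"
proof -
  interpret Submetric UNIV dist S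
    by unfold_locales auto
  show ?thesis
    using mtopology_submetric by (simp add: mtopology_is_euclidean)
qed

locale separable_subspace =
  fixes S D :: "'y::banach set"
  assumes subspace: "subspace S" and closed: "closed S"
    and countable: "countable D" and D_subset: "D \<subseteq> S" and dense: "S \<subseteq> closure D"
begin

text \<open>A point of a separable metric space is determined by its distances to a dense sequence;
  this embeds the space into the carrier type of real sequences.\<close>

definition code :: "'y \<Rightarrow> nat \<Rightarrow> real" where
  "code x n = dist x (from_nat_into D n)"

lemma zero_in: "0 \<in> S"
  by (rule subspace_0[OF subspace])

lemma add_in: "x \<in> S \<Longrightarrow> y \<in> S \<Longrightarrow> x + y \<in> S"
  by (rule subspace_add[OF subspace])

lemma diff_in: "x \<in> S \<Longrightarrow> y \<in> S \<Longrightarrow> x - y \<in> S"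
  by (rule subspace_diff[OF subspace])

lemma scale_in: "x \<in> S \<Longrightarrow> c *\<^sub>R x \<in> S"
  by (rule subspace_scale[OF subspace])

lemma inj_code: "inj_on code S"
proof (rule inj_onI, rule ccontr)
  fix x y assume xy: "x \<in> S" "y \<in> S" "code x = code y" "x \<noteq> y"
  have "\<exists>q\<in>D. dist q x < dist x y / 2"
    using dense xy closure_approachable[of x D] by (auto dest!: subsetD spec[of _ "dist x y / 2"])
  then obtain q where q: "q \<in> D" "dist q x < dist x y / 2" by blast
  obtain n where "from_nat_into D n = q"
    using from_nat_into_surj[OF countable q(1)] by blast
  then have "dist x q = dist y q"
    using fun_cong[OF xy(3), of n] by (simp add: code_def)
  then show False
    using q(2) dist_triangle[of x y q] by (simp add: dist_commute)
qed

definition decode :: "(nat \<Rightarrow> real) \<Rightarrow> 'y" where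
  "decode = inv_into S code"

lemma decode_code [simp]: "x \<in> S \<Longrightarrow> decode (code x) = x"
  by (simp add: decode_def inv_into_f_f[OF inj_code])

lemma decode_in: "u \<in> code ` S \<Longrightarrow> decode u \<in> S"
  by auto

lemma code_decode: "u \<in> code ` S \<Longrightarrow> code (decode u) = u"
  by auto

definition space :: "(real, nat \<Rightarrow> real) module" where
  "space = \<lparr>carrier = code ` S, mult = (\<lambda>u v. u), one = code 0, zero = code 0,
     add = (\<lambda>u v. code (decode u + decode v)), smult = (\<lambda>c u. code (c *\<^sub>R decode u))\<rparr>"

lemma space_simps [simp]:
  "carrier space = code ` S" "zero space = code 0"
  "add space u v = code (decode u + decode v)" "smult space c u = code (c *\<^sub>R decode u)"
  by (auto simp: space_def)

lemma abelian_group_space: "abelian_group space"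
proof (rule abelian_groupI)
  fix u assume "u \<in> carrier space"
  then have u: "decode u \<in> S" by auto
  show "\<exists>v\<in>carrier space. v \<oplus>\<^bsub>space\<^esub> u = \<zero>\<^bsub>space\<^esub>"
    by (rule bexI[of _ "code (- decode u)"]) (use u scale_in[OF u, of "-1"] in auto)
qed (auto simp: add_in zero_in add_ac)

lemma module_space: "module (ring_of_type_algebra :: real ring) space"
proof (rule moduleI[OF cring_from_type_algebra abelian_group_space])
qed (auto simp: ring_of_type_algebra_def add_in scale_in scaleR_left_distrib scaleR_right_distrib)

lemma minus_space:
  assumes "u \<in> carrier space" "v \<in> carrier space"
  shows "u \<ominus>\<^bsub>space\<^esub> v = code (decode u - decode v)"
proof -
  interpret abelian_group space by (rule abelian_group_space)
  have v: "decode v \<in> S" and u: "decode u \<in> S" using assms by auto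
  have nv: "- decode v \<in> S" using scale_in[OF v, of "-1"] by simp
  have "\<ominus>\<^bsub>space\<^esub> v = code (- decode v)"
    by (rule minus_equality) (use assms v nv in auto)
  then show ?thesis
    using assms nv by (simp add: a_minus_def)
qed

text \<open>Serves both the original norm and the renorming. Definiteness comes from the lower
  bound.\<close>

lemma real_normed_space_space:
  assumes tri: "\<And>x y. x \<in> S \<Longrightarrow> y \<in> S \<Longrightarrow> nrm (x + y) \<le> nrm x + nrm y"
    and sc: "\<And>c x. x \<in> S \<Longrightarrow> nrm (c *\<^sub>R x) = \<bar>c\<bar> * nrm x"
    and low: "0 < a" "\<And>x. x \<in> S \<Longrightarrow> a * norm x \<le> nrm x"
  shows "real_normed_space space (\<lambda>u. nrm (decode u))"
proof -
  interpret module "ring_of_type_algebra :: real ring" space by (rule module_space)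
  have nn: "0 \<le> nrm x" if "x \<in> S" for x
    using low(2)[OF that] low(1) by (meson mult_nonneg_nonneg norm_ge_zero less_imp_le order_trans)
  have z: "nrm x = 0 \<longleftrightarrow> x = 0" if "x \<in> S" for x
  proof
    assume "nrm x = 0"
    then show "x = 0" using low(2)[OF that] low(1) by (simp add: mult_le_0_iff)
  next
    assume "x = 0"
    then show "nrm x = 0" using sc[OF that, of 0] by simp
  qed
  show ?thesis
    by unfold_locales (auto simp: nn z tri sc add_in scale_in zero_in inj_on_eq_iff[OF inj_code])
qed

definition space_norm :: "(nat \<Rightarrow> real) \<Rightarrow> real" where
  "space_norm u = norm (decode u)"

lemma normed_space: "real_normed_space space space_norm"
  unfolding space_norm_def by (rule real_normed_space_space[where a = 1]) (auto simp: norm_triangle_ineq)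

lemma Metric_space_space: "Metric_space (code ` S) (norm_dist space space_norm)"
  using real_normed_space.Metric_space_norm_dist[OF normed_space] by simp

lemma norm_dist_space:
  assumes "x \<in> S" "y \<in> S"
  shows "norm_dist space space_norm (code x) (code y) = dist x y"
  using assms by (simp add: norm_dist_def minus_space space_norm_def diff_in dist_norm)

lemma homeomorphic_code: "homeomorphic_map (top_of_set S) (norm_topology space space_norm) code"
proof -
  interpret M12: Metric_space12 S dist "code ` S" "norm_dist space space_norm"
    by (intro Metric_space12.intro Metric_space_space Metric_space_space) (unfold_locales, auto simp: dist_triangle dist_commute)
  show ?thesis
    using M12.isometry_imp_homeomorphic_map[of code] norm_dist_space
    by (simp add: norm_topology_def mtopology_dist_eq_top_of_set)
qed

lemma banach_space: "real_banach_space space space_norm"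
proof -
  interpret V: real_normed_space space space_norm by (rule normed_space)
  interpret MV: Metric_space "code ` S" "norm_dist space space_norm" by (rule Metric_space_space)
  have "MV.mcomplete"
    unfolding MV.mcomplete_def
  proof (intro allI impI)
    fix \<sigma> assume C: "MV.MCauchy \<sigma>"
    then have r: "\<sigma> n \<in> code ` S" for n by (auto simp: MV.MCauchy_def)
    have ds: "decode (\<sigma> n) \<in> S" for n using decode_in[OF r] .
    have dd: "norm_dist space space_norm (\<sigma> n) (\<sigma> m) = dist (decode (\<sigma> n)) (decode (\<sigma> m))" for n m
      using norm_dist_space[OF ds ds] by (simp add: code_decode[OF r])
    have "Cauchy (\<lambda>n. decode (\<sigma> n))"
      using C by (auto simp: MV.MCauchy_def Cauchy_def dd)
    then obtain x where x: "(\<lambda>n. decode (\<sigma> n)) \<longlonglongrightarrow> x"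
      using Cauchy_convergent_iff convergent_def by blast
    have xS: "x \<in> S" using closed ds x by (meson closed_sequentially)
    have "norm_dist space space_norm (\<sigma> n) (code x) = dist (decode (\<sigma> n)) x" for n
      using norm_dist_space[OF ds xS] by (simp add: code_decode[OF r])
    then have "limitin MV.mtopology \<sigma> (code x) sequentially"
      using x xS r by (auto simp: MV.limitin_metric tendsto_iff)
    then show "\<exists>x. limitin MV.mtopology \<sigma> x sequentially" by blast
  qed
  then show ?thesis
    by unfold_locales simp
qed

lemma separable_space_space: "separable_space (norm_topology space space_norm)"
proof -
  have "separable_space (top_of_set S)"
    unfolding separable_space_def
    using countable D_subset dense
    by (intro exI[of _ D]) (auto simp: closure_of_subtopology Int_absorb1)
  then show ?thesis
    using homeomorphic_separable_space homeomorphic_map_imp_homeomorphic_space[OF homeomorphic_code] by blast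
qed

text \<open>Reduces displayability of the transported space to an action on \<open>S\<close>. The
  assumption \<open>all\<close> is the rigidity statement; \<open>emb\<close> is openness onto the
  image, in the strong form that one vector suffices to recognise a neighbourhood.\<close>

theorem displayable_space:
  fixes H :: "('h, 'b) monoid_scheme" and R :: "'h \<Rightarrow> 'y \<Rightarrow> 'y" and nrm :: "'y \<Rightarrow> real"
  assumes H: "group H" "topspace TH = carrier H"
    and tri: "\<And>x y. x \<in> S \<Longrightarrow> y \<in> S \<Longrightarrow> nrm (x + y) \<le> nrm x + nrm y"
    and sc: "\<And>c x. x \<in> S \<Longrightarrow> nrm (c *\<^sub>R x) = \<bar>c\<bar> * nrm x"
    and ab: "0 < a" "\<And>x. x \<in> S \<Longrightarrow> a * norm x \<le> nrm x"
      "0 < b" "\<And>x. x \<in> S \<Longrightarrow> nrm x \<le> b * norm x"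
    and lin: "\<And>h. h \<in> carrier H \<Longrightarrow> linear_map_on S (R h)"
    and onto: "\<And>h. h \<in> carrier H \<Longrightarrow> R h ` S = S"
    and iso: "\<And>h x. h \<in> carrier H \<Longrightarrow> x \<in> S \<Longrightarrow> nrm (R h x) = nrm x"
    and mult: "\<And>h h' x. h \<in> carrier H \<Longrightarrow> h' \<in> carrier H \<Longrightarrow> x \<in> S \<Longrightarrow> R (h \<otimes>\<^bsub>H\<^esub> h') x = R h (R h' x)"
    and one: "\<And>x. x \<in> S \<Longrightarrow> R \<one>\<^bsub>H\<^esub> x = x"
    and all: "\<And>f. linear_map_on S f \<Longrightarrow> f ` S = S \<Longrightarrow> (\<And>x. x \<in> S \<Longrightarrow> nrm (f x) = nrm x)
      \<Longrightarrow> \<exists>h\<in>carrier H. \<forall>x\<in>S. f x = R h x"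
    and cont: "\<And>x. x \<in> S \<Longrightarrow> continuous_map TH euclidean (\<lambda>h. R h x)"
    and inj: "\<And>h h'. h \<in> carrier H \<Longrightarrow> h' \<in> carrier H \<Longrightarrow> (\<And>x. x \<in> S \<Longrightarrow> R h x = R h' x) \<Longrightarrow> h = h'"
    and emb: "\<And>U h. openin TH U \<Longrightarrow> h \<in> U \<Longrightarrow>
      \<exists>x\<in>S. \<exists>e>0. \<forall>h'\<in>carrier H. dist (R h' x) (R h x) < e \<longrightarrow> h' \<in> U"
  shows "displayable H TH space space_norm"
proof -
  interpret H: group H by (rule H(1))
  let ?C = "code ` S"
  let ?N = "\<lambda>u. nrm (decode u)"
  define \<rho> where "\<rho> h = restrict (\<lambda>u. code (R h (decode u))) ?C" for h
  have RS: "R h x \<in> S" if "h \<in> carrier H" "x \<in> S" for h x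
    using onto[OF that(1)] that(2) by blast
  have \<rho>_code: "\<rho> h (code x) = code (R h x)" if "x \<in> S" for h x
    using that by (simp add: \<rho>_def)
  have \<rho>_lin: "\<rho> h \<in> linear_operators space" if h: "h \<in> carrier H" for h
    unfolding linear_operators_def
    using RS[OF h] linear_map_on_add[OF lin[OF h]] linear_map_on_scale[OF lin[OF h]]
    by (auto simp: \<rho>_def add_in scale_in)
  have \<rho>_bdd: "\<rho> h \<in> bounded_operators space space_norm" if h: "h \<in> carrier H" for h
  proof -
    have "space_norm (\<rho> h (code x)) \<le> (b / a) * space_norm (code x)" if x: "x \<in> S" for x
    proof -
      have "a * norm (R h x) \<le> b * norm x"
        using ab(2)[OF RS[OF h x]] ab(4)[OF x] iso[OF h x] by linarith
      then show ?thesis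
        using RS[OF h x] x ab(1) by (simp add: \<rho>_code space_norm_def field_simps)
    qed
    then show ?thesis
      using \<rho>_lin[OF h] by (auto simp: bounded_operators_def intro!: exI[of _ "b / a"])
  qed
  have \<rho>_mult: "\<rho> (h \<otimes>\<^bsub>H\<^esub> h') = compose ?C (\<rho> h) (\<rho> h')" if "h \<in> carrier H" "h' \<in> carrier H" for h h'
    using that RS by (auto simp: compose_def \<rho>_def mult fun_eq_iff restrict_def)
  have \<rho>_one: "\<rho> \<one>\<^bsub>H\<^esub> = (\<lambda>u\<in>?C. u)"
    by (auto simp: \<rho>_def one fun_eq_iff restrict_def)
  have \<rho>_image: "\<rho> h ` ?C = ?C" if "h \<in> carrier H" for h
  proof -
    have "\<rho> h ` ?C = code ` (R h ` S)"
      by (auto simp: image_image \<rho>_code)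
    then show ?thesis by (simp add: onto[OF that])
  qed
  have \<rho>_inv: "\<rho> (inv\<^bsub>H\<^esub> h) (\<rho> h u) = u" if "h \<in> carrier H" "u \<in> ?C" for h u
    using fun_cong[OF \<rho>_mult[of "inv\<^bsub>H\<^esub> h" h], of u] that by (simp add: \<rho>_one compose_def)
  have \<rho>_bij: "bij_betw (\<rho> h) ?C ?C" if h: "h \<in> carrier H" for h
    unfolding bij_betw_def using \<rho>_image[OF h] \<rho>_inv[OF h] by (metis inj_on_inverseI)
  have \<rho>_inv_into: "restrict (inv_into ?C (\<rho> h)) ?C = \<rho> (inv\<^bsub>H\<^esub> h)" if h: "h \<in> carrier H" for h
  proof
    fix u
    show "restrict (inv_into ?C (\<rho> h)) ?C u = \<rho> (inv\<^bsub>H\<^esub> h) u"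
    proof (cases "u \<in> ?C")
      case True
      then obtain v where v: "v \<in> ?C" "u = \<rho> h v" using \<rho>_image[OF h] by blast
      then show ?thesis
        using \<rho>_bij[OF h] \<rho>_inv[OF h v(1)] True by (simp add: bij_betw_def)
    next
      case False
      then show ?thesis by (simp add: \<rho>_def restrict_def)
    qed
  qed
  have \<rho>_Bij: "\<rho> h \<in> Bij ?C" if "h \<in> carrier H" for h
    using \<rho>_bij[OF that] by (simp add: Bij_def \<rho>_def)
  have \<rho>_hom: "\<rho> \<in> hom H (GL space space_norm)"
  proof (rule homI)
    fix h assume h: "h \<in> carrier H"
    then show "\<rho> h \<in> carrier (GL space space_norm)"
      using \<rho>_bdd[OF h] \<rho>_bdd[of "inv\<^bsub>H\<^esub> h"] \<rho>_bij[OF h] by (simp add: GL_def \<rho>_inv_into)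
  next
    fix h h' assume "h \<in> carrier H" "h' \<in> carrier H"
    then show "\<rho> (h \<otimes>\<^bsub>H\<^esub> h') = \<rho> h \<otimes>\<^bsub>GL space space_norm\<^esub> \<rho> h'"
      using \<rho>_Bij by (simp add: GL_def BijGroup_def \<rho>_mult)
  qed
  have top_norm: "topspace (norm_topology space space_norm) = ?C"
    using homeomorphic_imp_surjective_map[OF homeomorphic_code] by simp
  have \<rho>_cont: "continuous_map TH (strong_operator_topology space space_norm) \<rho>"
    unfolding strong_operator_topology_def continuous_map_componentwise
  proof (intro conjI ballI)
    show "\<rho> ` topspace TH \<subseteq> extensional (carrier space)"
      by (auto simp: \<rho>_def)
    fix u assume "u \<in> carrier space"
    then obtain x where x: "x \<in> S" "u = code x" by auto
    have "continuous_map TH (top_of_set S) (\<lambda>h. R h x)"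
      using cont[OF x(1)] RS x H(2) by (auto simp: continuous_map_in_subtopology)
    then have "continuous_map TH (norm_topology space space_norm) (code \<circ> (\<lambda>h. R h x))"
      by (rule continuous_map_compose) (rule homeomorphic_imp_continuous_map[OF homeomorphic_code])
    then show "continuous_map TH (norm_topology space space_norm) (\<lambda>h. \<rho> h u)"
      by (simp add: x \<rho>_code o_def)
  qed
  have \<rho>_inj: "inj_on \<rho> (carrier H)"
  proof (rule inj_onI)
    fix h h' assume h: "h \<in> carrier H" "h' \<in> carrier H" and eq: "\<rho> h = \<rho> h'"
    show "h = h'"
    proof (rule inj[OF h])
      fix x assume x: "x \<in> S"
      have "code (R h x) = code (R h' x)"
        using fun_cong[OF eq, of "code x"] x by (simp add: \<rho>_code)
      then show "R h x = R h' x"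
        using inj_onD[OF inj_code] RS h x by blast
    qed
  qed
  interpret MV: Metric_space ?C "norm_dist space space_norm" by (rule Metric_space_space)
  have \<rho>_open: "open_map TH (subtopology (strong_operator_topology space space_norm) (\<rho> ` carrier H)) \<rho>"
    unfolding open_map_def
  proof (intro allI impI)
    fix U assume U: "openin TH U"
    have Usub: "U \<subseteq> carrier H" using openin_subset[OF U] H(2) by simp
    show "openin (subtopology (strong_operator_topology space space_norm) (\<rho> ` carrier H)) (\<rho> ` U)"
    proof (subst openin_subopen, intro ballI)
      fix f assume "f \<in> \<rho> ` U"
      then obtain h where h: "h \<in> U" "f = \<rho> h" by blast
      have hH: "h \<in> carrier H" using h Usub by blast
      obtain x e where x: "x \<in> S" "0 < e" "\<forall>h'\<in>carrier H. dist (R h' x) (R h x) < e \<longrightarrow> h' \<in> U"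
        using emb[OF U h(1)] by blast
      \<comment> \<open>By \<open>emb\<close>, evaluation at the single vector \<open>x\<close>
        already keeps \<open>h\<close> away from the complement of \<open>U\<close>, so a subbasic
        set of the product topology is enough.\<close>
      define W where "W = {g \<in> topspace (strong_operator_topology space space_norm).
        g (code x) \<in> MV.mball (code (R h x)) e}"
      have "openin (strong_operator_topology space space_norm) W"
        unfolding W_def strong_operator_topology_def
        by (rule openin_continuous_map_preimage[OF continuous_map_product_projection])
          (use x(1) in \<open>auto simp: norm_topology_def\<close>)
      then have "openin (subtopology (strong_operator_topology space space_norm) (\<rho> ` carrier H))
          (\<rho> ` carrier H \<inter> W)"
        by (rule openin_subtopology_Int2)
      moreover have "f \<in> \<rho> ` carrier H \<inter> W"
      proof -
        have "\<rho> h \<in> topspace (strong_operator_topology space space_norm)"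
          using continuous_map_image_subset_topspace[OF \<rho>_cont] hH H(2) by blast
        then show ?thesis
          using h(2) hH x RS[OF hH x(1)] by (auto simp: W_def \<rho>_code)
      qed
      moreover have "\<rho> ` carrier H \<inter> W \<subseteq> \<rho> ` U"
      proof
        fix g assume g: "g \<in> \<rho> ` carrier H \<inter> W"
        then obtain h' where h': "h' \<in> carrier H" "g = \<rho> h'" by blast
        have "norm_dist space space_norm (code (R h x)) (code (R h' x)) < e"
          using g h'(2) x(1) by (simp add: W_def \<rho>_code)
        then have "dist (R h x) (R h' x) < e"
          by (simp only: norm_dist_space[OF RS[OF hH x(1)] RS[OF h'(1) x(1)]])
        then show "g \<in> \<rho> ` U" using x(3) h' by (simp add: dist_commute)
      qed
      ultimately show "\<exists>T. openin (subtopology (strong_operator_topology space space_norm) (\<rho> ` carrier H)) T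
          \<and> f \<in> T \<and> T \<subseteq> \<rho> ` U" by blast
    qed
  qed
  have \<rho>_homeo: "homeomorphic_map TH (subtopology (strong_operator_topology space space_norm) (\<rho> ` carrier H)) \<rho>"
  proof (rule bijective_open_imp_homeomorphic_map[OF _ \<rho>_open])
    show "continuous_map TH (subtopology (strong_operator_topology space space_norm) (\<rho> ` carrier H)) \<rho>"
      using \<rho>_cont H(2) by (simp add: continuous_map_in_subtopology)
    show "\<rho> ` topspace TH = topspace (subtopology (strong_operator_topology space space_norm) (\<rho> ` carrier H))"
      using \<rho>_cont H(2) by (auto simp: continuous_map_def)
    show "inj_on \<rho> (topspace TH)" using \<rho>_inj H(2) by simp
  qed
  have N': "real_normed_space space ?N"
    by (rule real_normed_space_space[OF tri sc ab(1,2)])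
  then have equiv: "equivalent_norm space space_norm ?N"
    unfolding equivalent_norm_def using ab by (auto simp: space_norm_def)
  have "\<rho> ` carrier H = Isom space ?N"
  proof
    show "\<rho> ` carrier H \<subseteq> Isom space ?N"
      using \<rho>_lin \<rho>_image RS iso by (auto simp: Isom_def \<rho>_code)
    show "Isom space ?N \<subseteq> \<rho> ` carrier H"
    proof
      fix f assume f: "f \<in> Isom space ?N"
      define g where "g x = decode (f (code x))" for x
      have fE: "f \<in> ?C \<rightarrow>\<^sub>E ?C" and fim: "f ` ?C = ?C"
        and fadd: "\<And>u v. u \<in> ?C \<Longrightarrow> v \<in> ?C \<Longrightarrow> f (code (decode u + decode v)) = code (decode (f u) + decode (f v))"
        and fsc: "\<And>c u. u \<in> ?C \<Longrightarrow> f (code (c *\<^sub>R decode u)) = code (c *\<^sub>R decode (f u))"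
        and fiso: "\<And>u. u \<in> ?C \<Longrightarrow> nrm (decode (f u)) = nrm (decode u)"
        using f unfolding Isom_def linear_operators_def space_simps by auto
      have fC: "f (code x) \<in> ?C" if "x \<in> S" for x using fE that by auto
      have gS: "g x \<in> S" if "x \<in> S" for x
        unfolding g_def by (rule decode_in[OF fC[OF that]])
      have "linear_map_on S g"
        unfolding linear_map_on_def
      proof (intro conjI ballI allI)
        fix x y c assume x: "x \<in> S" and y: "y \<in> S"
        show "g (x + y) = g x + g y"
          using fadd[of "code x" "code y"] x y add_in[OF gS[OF x] gS[OF y]] by (simp add: g_def)
        show "g (c *\<^sub>R x) = c *\<^sub>R g x"
          using fsc[of "code x" c] x scale_in[OF gS[OF x]] by (simp add: g_def)
      qed
      moreover have "g ` S = S"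
      proof -
        have "g ` S = decode ` (f ` ?C)" by (simp add: g_def image_image)
        also have "\<dots> = S" unfolding fim by (force simp: image_image)
        finally show ?thesis .
      qed
      moreover have "nrm (g x) = nrm x" if "x \<in> S" for x
        using fiso[of "code x"] that by (simp add: g_def)
      ultimately obtain h where h: "h \<in> carrier H" "\<forall>x\<in>S. g x = R h x"
        using all by blast
      have "f = \<rho> h"
      proof
        fix u
        show "f u = \<rho> h u"
        proof (cases "u \<in> ?C")
          case True
          then obtain x where x: "x \<in> S" "u = code x" by blast
          have "f u = code (g x)" using code_decode[OF fC[OF x(1)]] x by (simp add: g_def)
          then show ?thesis using h x by (simp add: \<rho>_code)
        next
          case False
          then show ?thesis using fE by (auto simp: \<rho>_def PiE_def extensional_def)
        qed
      qed
      then show "f \<in> \<rho> ` carrier H" using h(1) by blast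
    qed
  qed
  then show ?thesis
    unfolding displayable_def display_def using \<rho>_hom \<rho>_homeo equiv by blast
qed

end

section \<open>Closed spans and translation operators\<close>

text \<open>An \<open>e / 3\<close> argument: convergence passes from \<open>A\<close> to its span
  by linearity and to the closure by the common Lipschitz constant. Linearity is relative to
  \<open>V\<close> because the isometries in question are only known on a subspace.\<close>

lemma tendsto_on_closure_span:
  fixes f :: "'a::real_normed_vector \<Rightarrow> 'b::real_normed_vector"
  assumes V: "subspace V" "closure (span A) \<subseteq> V"
    and F: "\<And>n. linear_map_on V (F n)" "\<And>n x. x \<in> V \<Longrightarrow> norm (F n x) \<le> K * norm x"
    and f: "linear_map_on V f" "\<And>x. x \<in> V \<Longrightarrow> norm (f x) \<le> K * norm x"
    and conv: "\<And>a. a \<in> A \<Longrightarrow> ((\<lambda>n. F n a) \<longlongrightarrow> f a) net"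
    and x: "x \<in> closure (span A)"
  shows "((\<lambda>n. F n x) \<longlongrightarrow> f x) net"
proof -
  have spanV: "span A \<subseteq> V" using V(2) closure_subset[of "span A"] by blast
  have sp: "y \<in> V \<and> ((\<lambda>n. F n y) \<longlongrightarrow> f y) net" if "y \<in> span A" for y
    using that
  proof (induction rule: span_induct_alt)
    case base
    have "F n 0 = 0" "f 0 = 0" for n
      using linear_map_on_scale[OF F(1)[of n] subspace_0[OF V(1)], of 0]
        linear_map_on_scale[OF f(1) subspace_0[OF V(1)], of 0] by auto
    then show ?case using subspace_0[OF V(1)] by simp
  next
    case (step c a y)
    have aV: "a \<in> V" using spanV span_base[OF step(1)] by blast
    have yV: "y \<in> V" using step(2) by blast
    have caV: "c *\<^sub>R a \<in> V" by (rule subspace_scale[OF V(1) aV])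
    have "((\<lambda>n. c *\<^sub>R F n a + F n y) \<longlongrightarrow> c *\<^sub>R f a + f y) net"
      by (rule tendsto_add[OF tendsto_scaleR[OF tendsto_const conv[OF step(1)]] conjunct2[OF step(2)]])
    then show ?case
      using subspace_add[OF V(1) caV yV]
      by (simp add: linear_map_on_add[OF F(1) caV yV] linear_map_on_add[OF f(1) caV yV]
          linear_map_on_scale[OF F(1) aV] linear_map_on_scale[OF f(1) aV])
  qed
  have xV: "x \<in> V" using x V(2) by blast
  show ?thesis
  proof (rule tendstoI)
    fix e :: real assume e: "0 < e"
    \<comment> \<open>\<open>K\<close> might vanish or be negative; \<open>L\<close> can be divided
      by.\<close>
    define L where "L = max K 1"
    have L: "0 < L" "K \<le> L" by (auto simp: L_def)
    have "0 < e / (3 * L)" using e L by simp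
    then obtain y where y: "y \<in> span A" "dist y x < e / (3 * L)"
      using x unfolding closure_approachable by blast
    have yV: "y \<in> V" using y(1) spanV by blast
    have d: "norm (x - y) < e / (3 * L)" using y(2) by (simp add: dist_norm norm_minus_commute)
    have xy: "x - y \<in> V" by (rule subspace_diff[OF V(1) xV yV])
    have small: "norm (h x - h y) < e / 3"
      if "linear_map_on V h" "\<And>z. z \<in> V \<Longrightarrow> norm (h z) \<le> K * norm z" for h :: "'a \<Rightarrow> 'b"
    proof -
      have "norm (h x - h y) \<le> K * norm (x - y)"
        using that(2)[OF xy] by (simp add: linear_map_on_diff[OF that(1) V(1) xV yV])
      also have "\<dots> \<le> L * norm (x - y)" using L by (intro mult_right_mono) auto
      also have "\<dots> < L * (e / (3 * L))" using d L by (intro mult_strict_left_mono) auto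
      also have "\<dots> = e / 3" using L by simp
      finally show ?thesis .
    qed
    have "\<forall>\<^sub>F n in net. dist (F n y) (f y) < e / 3"
      using tendstoD[OF conjunct2[OF sp[OF y(1)]], of "e / 3"] e by simp
    then show "\<forall>\<^sub>F n in net. dist (F n x) (f x) < e"
    proof eventually_elim
      case (elim n)
      have "dist (F n x) (f x) \<le> dist (F n x) (F n y) + dist (F n y) (f y) + dist (f y) (f x)"
        using dist_triangle[of "F n x" "f x" "F n y"] dist_triangle[of "F n y" "f x" "f y"] by linarith
      then show ?case
        using elim small[OF F(1) F(2), of n] small[OF f] by (simp add: dist_norm norm_minus_commute)
    qed
  qed
qed

text \<open>Rational combinations, coded by finite lists, are countable. Their closure is a subspace
  because rational scalars approximate real ones, and hence it contains the span.\<close>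

lemma separable_closure_span:
  fixes A :: "'a::real_normed_vector set"
  assumes "countable A"
  obtains D where "countable D" "D \<subseteq> span A" "closure (span A) \<subseteq> closure D"
proof -
  define comb where "comb xs = sum_list (map (\<lambda>(q, a). q *\<^sub>R a) xs)" for xs :: "(real \<times> 'a) list"
  define D where "D = comb ` lists (\<rat> \<times> A)"
  have "countable D"
    unfolding D_def using assms countable_rat by (intro countable_image countable_lists countable_SIGMA)
  moreover have "D \<subseteq> span A"
  proof -
    have "comb xs \<in> span A" if "xs \<in> lists (\<rat> \<times> A)" for xs
      using that by (induction xs) (auto simp: comb_def span_zero intro: span_add span_scale span_base)
    then show ?thesis by (auto simp: D_def)
  qed
  moreover have "subspace (closure D)"
  proof (rule subspaceI)
    have "comb [] \<in> D" unfolding D_def by blast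
    then show "0 \<in> closure D" using closure_subset[of D] by (auto simp: comb_def)
    fix x y assume "x \<in> closure D" and "y \<in> closure D"
    then obtain f g where fg: "\<forall>n. f n \<in> D" "f \<longlonglongrightarrow> x" "\<forall>n. g n \<in> D" "g \<longlonglongrightarrow> y"
      unfolding closure_sequential by metis
    have "f n + g n \<in> D" for n
    proof -
      obtain xs ys where "f n = comb xs" "xs \<in> lists (\<rat> \<times> A)" "g n = comb ys" "ys \<in> lists (\<rat> \<times> A)"
        using fg(1,3) unfolding D_def by blast
      then show ?thesis
        unfolding D_def by (intro image_eqI[of _ _ "xs @ ys"]) (auto simp: comb_def)
    qed
    moreover have "(\<lambda>n. f n + g n) \<longlonglongrightarrow> x + y" using fg by (intro tendsto_intros)
    ultimately show "x + y \<in> closure D"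
      unfolding closure_sequential by (intro exI[of _ "\<lambda>n. f n + g n"]) simp
  next
    fix x and c :: real assume "x \<in> closure D"
    then obtain f where f: "\<forall>n. f n \<in> D" "f \<longlonglongrightarrow> x"
      unfolding closure_sequential by metis
    have "c \<in> closure \<rat>" by (simp add: Rats_closure_real)
    then obtain q where q: "\<forall>n. q n \<in> \<rat>" "q \<longlonglongrightarrow> c"
      unfolding closure_sequential by metis
    have "q n *\<^sub>R f n \<in> D" for n
    proof -
      obtain xs where xs: "f n = comb xs" "xs \<in> lists (\<rat> \<times> A)"
        using f(1) unfolding D_def by blast
      have "q n *\<^sub>R comb xs = comb (map (\<lambda>(p, a). (q n * p, a)) xs)"
        unfolding comb_def by (induction xs) (auto simp: scaleR_add_right)
      moreover have "map (\<lambda>(p, a). (q n * p, a)) xs \<in> lists (\<rat> \<times> A)"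
        using xs(2) q(1) by (induction xs) auto
      ultimately show ?thesis unfolding D_def xs(1) by (rule image_eqI)
    qed
    moreover have "(\<lambda>n. q n *\<^sub>R f n) \<longlonglongrightarrow> c *\<^sub>R x" using f q by (intro tendsto_intros)
    ultimately show "c *\<^sub>R x \<in> closure D"
      unfolding closure_sequential by (intro exI[of _ "\<lambda>n. q n *\<^sub>R f n"]) simp
  qed
  moreover have "A \<subseteq> D"
  proof
    fix a assume "a \<in> A"
    then have "comb [(1, a)] \<in> D" unfolding D_def by (intro imageI) auto
    then show "a \<in> D" by (simp add: comb_def)
  qed
  then have "A \<subseteq> closure D" using closure_subset[of D] by blast
  ultimately show ?thesis
    using that by (metis closed_closure closure_minimal span_minimal)
qed

section \<open>Relabellings of coordinates as linear isometries\<close>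

context small_metric
begin

text \<open>The two maps are inverse on the whole type, not just on \<open>M\<close>, because
  \<open>translate\<close> relabels every index, including those outside \<open>M\<close>.\<close>

definition symmetry :: "('p \<Rightarrow> 'p) \<Rightarrow> ('p \<Rightarrow> 'p) \<Rightarrow> bool" where
  "symmetry \<phi> \<psi> \<longleftrightarrow> (\<forall>q. \<psi> (\<phi> q) = q \<and> \<phi> (\<psi> q) = q) \<and> \<phi> ` M \<subseteq> M \<and> \<psi> ` M \<subseteq> M \<and>
    (\<forall>p\<in>M. \<forall>q\<in>M. d (\<phi> p) (\<phi> q) = d p q)"

lemma symmetry_sym: "symmetry \<phi> \<psi> \<Longrightarrow> symmetry \<psi> \<phi>"
  unfolding symmetry_def by (metis image_subset_iff)

text \<open>Functions are pulled back, so the inverse \<open>\<psi>\<close> of the intended motion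
  \<open>\<phi>\<close> appears; \<open>map_option\<close> leaves the index \<open>None\<close> in
  place.\<close>

definition translate :: "('p \<Rightarrow> 'p) \<Rightarrow> ('p option discrete \<Rightarrow>\<^sub>C real) \<Rightarrow> 'p option discrete \<Rightarrow>\<^sub>C real" where
  "translate \<psi> x = Bcontfun (\<lambda>i. apply_bcontfun x (discrete (map_option \<psi> (of_discrete i))))"

lemma apply_translate:
  "apply_bcontfun (translate \<psi> x) i = apply_bcontfun x (discrete (map_option \<psi> (of_discrete i)))"
proof -
  have "(\<lambda>i. apply_bcontfun x (discrete (map_option \<psi> (of_discrete i)))) \<in> bcontfun"
    by (rule bcontfun_normI[where b = "norm x"])
      (auto simp: continuous_on_open_vimage open_discrete norm_bounded simp del: real_norm_def)
  then show ?thesis by (simp add: translate_def Bcontfun_inverse)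
qed

lemma translate_add: "translate \<psi> (x + y) = translate \<psi> x + translate \<psi> y"
  by (rule bcontfun_eqI) (simp add: apply_translate)

lemma translate_scale: "translate \<psi> (c *\<^sub>R x) = c *\<^sub>R translate \<psi> x"
  by (rule bcontfun_eqI) (simp add: apply_translate)

lemma linear_translate: "linear (translate \<psi>)"
  by (rule linearI) (auto simp: translate_add translate_scale)

lemma translate_comp: "translate \<psi> (translate \<psi>' x) = translate (\<lambda>q. \<psi>' (\<psi> q)) x"
  by (rule bcontfun_eqI) (simp add: apply_translate discrete_inverse option.map_comp o_def)

lemma translate_id: "translate (\<lambda>q. q) x = x"
  by (rule bcontfun_eqI) (simp add: apply_translate option.map_ident of_discrete_inverse)

lemma translate_inverse:
  assumes "symmetry \<phi> \<psi>"
  shows "translate \<phi> (translate \<psi> x) = x"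
  using assms by (simp add: translate_comp translate_id symmetry_def)

lemma norm_translate_le: "norm (translate \<psi> x) \<le> norm x"
  by (rule norm_bound) (metis apply_translate norm_bounded)

lemma norm_translate: "symmetry \<phi> \<psi> \<Longrightarrow> norm (translate \<psi> x) = norm x"
  using norm_translate_le[of \<psi> x] norm_translate_le[of \<phi> "translate \<psi> x"]
  by (simp add: translate_inverse)

lemma ell_translate: "ell (translate \<psi> x) = ell x"
  by (simp add: ell_def apply_translate discrete_inverse)

lemma translate_pt:
  assumes s: "symmetry \<phi> \<psi>" and p: "p \<in> M"
  shows "translate \<psi> (pt p) = pt (\<phi> p)"
proof (rule bcontfun_eqI)
  fix i :: "'p option discrete"
  have \<phi>p: "\<phi> p \<in> M" using s p by (auto simp: symmetry_def)
  have M: "\<psi> q \<in> M \<longleftrightarrow> q \<in> M" for q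
    using s unfolding symmetry_def by (metis image_subset_iff)
  have d: "d p (\<psi> q) = d (\<phi> p) q" if "q \<in> M" for q
    using s p that unfolding symmetry_def by (metis image_subset_iff)
  show "apply_bcontfun (translate \<psi> (pt p)) i = apply_bcontfun (pt (\<phi> p)) i"
    by (auto simp: apply_translate apply_pt[OF p] apply_pt[OF \<phi>p] discrete_inverse M d split: option.split)
qed

lemma hull_norm_translate_le:
  assumes s: "symmetry \<phi> \<psi>"
  shows "hull_norm (translate \<psi> x) \<le> hull_norm x"
proof (rule field_le_epsilon)
  fix e :: real assume e: "0 < e"
  obtain A c where A: "finite A" "A \<subseteq> M"
    "(\<Sum>p\<in>A. \<bar>c p\<bar>) + 2 * norm (x - (\<Sum>p\<in>A. c p *\<^sub>R pt p)) < hull_norm x + e"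
    using hull_norm_approx[of x "hull_norm x + e"] e by auto
  have inj: "inj_on \<phi> A" using s by (intro inj_on_inverseI[of _ \<psi>]) (auto simp: symmetry_def)
  have \<psi>\<phi>: "\<psi> (\<phi> p) = p" for p using s by (simp add: symmetry_def)
  have "hull_norm (translate \<psi> x) \<le> (\<Sum>q\<in>\<phi> ` A. \<bar>c (\<psi> q)\<bar>)
      + 2 * norm (translate \<psi> x - (\<Sum>q\<in>\<phi> ` A. c (\<psi> q) *\<^sub>R pt q))"
    by (rule hull_norm_le) (use A s in \<open>auto simp: symmetry_def\<close>)
  also have "(\<Sum>q\<in>\<phi> ` A. \<bar>c (\<psi> q)\<bar>) = (\<Sum>p\<in>A. \<bar>c p\<bar>)"
    by (simp add: sum.reindex[OF inj] \<psi>\<phi>)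
  also have "(\<Sum>q\<in>\<phi> ` A. c (\<psi> q) *\<^sub>R pt q) = (\<Sum>p\<in>A. c p *\<^sub>R translate \<psi> (pt p))"
    unfolding sum.reindex[OF inj] o_def \<psi>\<phi>
    by (rule sum.cong) (use A(2) in \<open>auto simp: translate_pt[OF s]\<close>)
  also have "\<dots> = translate \<psi> (\<Sum>p\<in>A. c p *\<^sub>R pt p)"
    by (simp add: linear_sum[OF linear_translate] translate_scale)
  also have "norm (translate \<psi> x - translate \<psi> (\<Sum>p\<in>A. c p *\<^sub>R pt p)) = norm (x - (\<Sum>p\<in>A. c p *\<^sub>R pt p))"
    by (simp only: linear_diff[OF linear_translate, symmetric] norm_translate[OF s])
  finally show "hull_norm (translate \<psi> x) \<le> hull_norm x + e"
    using A(3) by linarith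
qed

lemma hull_norm_translate: "symmetry \<phi> \<psi> \<Longrightarrow> hull_norm (translate \<psi> x) = hull_norm x"
  using hull_norm_translate_le[of \<phi> \<psi> x] hull_norm_translate_le[OF symmetry_sym, of \<phi> \<psi> "translate \<psi> x"]
  by (simp add: translate_inverse)

lemma tilt_translate: "symmetry \<phi> \<psi> \<Longrightarrow> tilt (translate \<psi> x) t = tilt x t"
  by (simp add: tilt_def ell_translate norm_translate)

lemma continuous_on_translate: "continuous_on S (translate \<psi>)"
  by (rule linear_continuous_on)
    (use norm_translate_le[of \<psi>] in \<open>auto intro!: bounded_linear_intro[of _ 1] simp: translate_add translate_scale\<close>)

lemma translate_pt_span_subset:
  assumes s: "symmetry \<phi> \<psi>"
  shows "translate \<psi> ` pt_span \<subseteq> pt_span"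
proof -
  have "translate \<psi> ` pt ` M \<subseteq> pt ` M"
    using translate_pt[OF s] s by (auto simp: symmetry_def)
  then have "translate \<psi> ` span (pt ` M) \<subseteq> span (pt ` M)"
    unfolding linear_span_image[OF linear_translate, symmetric] by (rule span_mono)
  then have "translate \<psi> ` span (pt ` M) \<subseteq> pt_span"
    unfolding pt_span_def using closure_subset[of "span (pt ` M)"] by blast
  then show ?thesis
    unfolding pt_span_def
    by (intro image_closure_subset[OF continuous_on_translate closed_closure])
qed

lemma translate_pt_span:
  assumes s: "symmetry \<phi> \<psi>"
  shows "translate \<psi> ` pt_span = pt_span"
proof
  show "pt_span \<subseteq> translate \<psi> ` pt_span"
  proof
    fix x assume "x \<in> pt_span"
    then have "translate \<phi> x \<in> pt_span" using translate_pt_span_subset[OF symmetry_sym[OF s]] by blast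
    moreover have "x = translate \<psi> (translate \<phi> x)" using translate_inverse[OF symmetry_sym[OF s]] by simp
    ultimately show "x \<in> translate \<psi> ` pt_span" by (rule rev_image_eqI)
  qed
qed (rule translate_pt_span_subset[OF s])

end

section \<open>A metric space with prescribed isometries\<close>

text \<open>By continuity on the closure of \<open>A \<times> B\<close>. It extends distance ranges
  from the group points to the completed levels.\<close>

lemma norm_diff_in_closed:
  fixes x y :: "'a::real_normed_vector"
  assumes "x \<in> closure A" "y \<in> closure B" "closed C" "\<And>a b. a \<in> A \<Longrightarrow> b \<in> B \<Longrightarrow> norm (a - b) \<in> C"
  shows "norm (x - y) \<in> C"
proof -
  have "(\<lambda>z. norm (fst z - snd z)) ` closure (A \<times> B) \<subseteq> C"
    by (rule image_closure_subset) (use assms in \<open>auto intro!: continuous_intros\<close>)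
  moreover have "(x, y) \<in> closure (A \<times> B)" using assms by (simp add: closure_Times)
  ultimately have "norm (fst (x, y) - snd (x, y)) \<in> C" by blast
  then show ?thesis by simp
qed

lemma mcomplete_dist_closed:
  fixes S :: "'a::complete_space set"
  assumes "closed S"
  shows "Metric_space.mcomplete S dist"
proof -
  interpret Submetric UNIV dist S
    by unfold_locales auto
  show ?thesis
    by (rule closedin_mcomplete_imp_mcomplete)
      (use assms in \<open>simp_all add: complete_UNIV\<close>)
qed

text \<open>The metric space on which the Banach space is built consists of countably many copies
  (levels) of the group. Besides the distances inside the levels, the distances between points
  of different levels record the right translations by the elements \<open>h i\<close>; since left
  translations are exactly the maps that commute with all right translations, this leaves no
  room for isometries other than limits of left translations.\<close>

locale leveled_group = group G + Metric_space "carrier G" d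
  for G (structure) and d +
  fixes h :: "nat \<Rightarrow> 'a"
  assumes left_inv: "\<lbrakk>a \<in> carrier G; x \<in> carrier G; y \<in> carrier G\<rbrakk> \<Longrightarrow> d (a \<otimes> x) (a \<otimes> y) = d x y"
    and d_small: "d x y \<le> 1/8"
    and right_cont: "\<lbrakk>\<And>n. u n \<in> carrier G; \<And>n. v n \<in> carrier G; k \<in> carrier G; (\<lambda>n. d (u n) (v n)) \<longlonglongrightarrow> 0\<rbrakk>
      \<Longrightarrow> (\<lambda>n. d (u n \<otimes> k) (v n \<otimes> k)) \<longlonglongrightarrow> 0"
    and h_in [simp]: "h i \<in> carrier G" and h0 [simp]: "h 0 = \<one>" and h1 [simp]: "h (Suc 0) = \<one>"
    and h_dense: "a \<in> carrier G \<Longrightarrow> \<exists>i. (\<lambda>n. d (h (Suc (i n))) a) \<longlonglongrightarrow> 0"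
begin

text \<open>Distances from level 0 to a positive level \<open>j\<close> lie between
  \<open>base 0 j\<close> and \<open>base 0 j + coef 0 j / 8\<close>. These intervals are disjoint
  and lie below 3/8, the least distance between two positive levels, so the levels can be told apart
  by distances alone.\<close>

definition base :: "nat \<Rightarrow> nat \<Rightarrow> real" where
  "base i j = (if i = 0 \<or> j = 0 then 1/4 + (1/2) ^ (i + j) / 8 else 3/8)"

text \<open>Decays along with \<open>base\<close>, which keeps those intervals apart; positive, so
  that the minimal distance is attained exactly by the pairs whose twisted first components agree;
  below 1, as the Lipschitz estimate wants it.\<close>

definition coef :: "nat \<Rightarrow> nat \<Rightarrow> real" where
  "coef i j = (if i = 0 \<or> j = 0 then (1/2) ^ (i + j) / 8 else 1/8)"

text \<open>The right factor for a point of level \<open>i\<close> seen from level \<open>j\<close>.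
  Thus \<open>(a, i)\<close> is matched with \<open>(a \<otimes> h i, 0)\<close>, and positive
  levels are matched identically; since \<open>h (Suc 0)\<close> is the unit, so are the levels 0
  and 1.\<close>

definition twist :: "nat \<Rightarrow> nat \<Rightarrow> 'a" where
  "twist i j = (if j = 0 then h i else \<one>)"

abbreviation P :: "('a \<times> nat) set" where
  "P \<equiv> carrier G \<times> UNIV"

text \<open>Taking the translates by \<open>h i\<close> into account inside level \<open>i\<close>
  makes right multiplication by \<open>h i\<close> nonexpansive there, on which the triangle
  inequality across levels relies. By \<open>right_cont\<close> this does not change convergence in
  a level.\<close>

definition ldist :: "'a \<times> nat \<Rightarrow> 'a \<times> nat \<Rightarrow> real" where
  "ldist p q = (if p \<in> P \<and> q \<in> P then
     (if snd p = snd q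
      then max (d (fst p) (fst q)) (d (fst p \<otimes> h (snd p)) (fst q \<otimes> h (snd q)))
      else base (snd p) (snd q) + coef (snd p) (snd q) *
        d (fst p \<otimes> twist (snd p) (snd q)) (fst q \<otimes> twist (snd q) (snd p)))
     else 0)"

lemma ldist_same:
  "a \<in> carrier G \<Longrightarrow> b \<in> carrier G \<Longrightarrow> ldist (a, i) (b, i) = max (d a b) (d (a \<otimes> h i) (b \<otimes> h i))"
  by (simp add: ldist_def)

lemma ldist_diff:
  "a \<in> carrier G \<Longrightarrow> b \<in> carrier G \<Longrightarrow> i \<noteq> j \<Longrightarrow>
    ldist (a, i) (b, j) = base i j + coef i j * d (a \<otimes> twist i j) (b \<otimes> twist j i)"
  by (simp add: ldist_def)

lemma twist_in [simp]: "twist i j \<in> carrier G"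
  by (simp add: twist_def)

lemma coef_bounds: "0 < coef i j" "coef i j \<le> 1/8"
  by (auto simp: coef_def power_le_one)

lemma base_bounds: "1/4 \<le> base i j" "base i j \<le> 3/8"
  by (auto simp: base_def power_le_one)

lemma base_sym: "base i j = base j i" and coef_sym: "coef i j = coef j i"
  by (auto simp: base_def coef_def add.commute)

lemma ldist_diff_bounds:
  assumes "a \<in> carrier G" "b \<in> carrier G" "i \<noteq> j"
  shows "base i j \<le> ldist (a, i) (b, j)" "ldist (a, i) (b, j) \<le> base i j + coef i j / 8"
proof -
  let ?d = "d (a \<otimes> twist i j) (b \<otimes> twist j i)"
  have "0 \<le> coef i j * ?d" "coef i j * ?d \<le> coef i j * (1/8)"
    using coef_bounds(1)[of i j] d_small by (auto intro!: mult_left_mono)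
  then show "base i j \<le> ldist (a, i) (b, j)" "ldist (a, i) (b, j) \<le> base i j + coef i j / 8"
    using assms by (auto simp: ldist_diff)
qed

lemma ldist_diff_ge: "a \<in> carrier G \<Longrightarrow> b \<in> carrier G \<Longrightarrow> i \<noteq> j \<Longrightarrow> 1/4 \<le> ldist (a, i) (b, j)"
  using ldist_diff_bounds(1)[of a b i j] base_bounds(1)[of i j] by linarith

lemma ldist_diff_le: "a \<in> carrier G \<Longrightarrow> b \<in> carrier G \<Longrightarrow> i \<noteq> j \<Longrightarrow> ldist (a, i) (b, j) \<le> 1/2"
  using ldist_diff_bounds(2)[of a b i j] base_bounds(2)[of i j] coef_bounds(2)[of i j] by linarith

lemma ldist_same_le: "a \<in> carrier G \<Longrightarrow> b \<in> carrier G \<Longrightarrow> ldist (a, i) (b, i) \<le> 1/8"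
  using d_small[of a b] d_small[of "a \<otimes> h i" "b \<otimes> h i"] by (simp add: ldist_same)

lemma ldist_same_twist:
  assumes "a \<in> carrier G" "b \<in> carrier G"
  shows "d (a \<otimes> twist i j) (b \<otimes> twist i j) \<le> ldist (a, i) (b, i)"
  using assms by (simp add: ldist_same twist_def)

lemma ldist_sym: "ldist p q = ldist q p"
  unfolding ldist_def
  by (auto simp: base_sym[of "snd p" "snd q"] coef_sym[of "snd p" "snd q"] commute[of "fst p" "fst q"]
      commute[of "fst p \<otimes> h (snd p)"] commute[of "fst p \<otimes> twist (snd p) (snd q)"])

lemma ldist_lipschitz:
  assumes "a \<in> carrier G" "b \<in> carrier G" "c \<in> carrier G" "i \<noteq> j"
  shows "ldist (a, i) (c, j) \<le> ldist (a, i) (b, i) + ldist (b, i) (c, j)"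
proof -
  have "d (a \<otimes> twist i j) (c \<otimes> twist j i) \<le> ldist (a, i) (b, i) + d (b \<otimes> twist i j) (c \<otimes> twist j i)"
    using triangle[of "a \<otimes> twist i j" "b \<otimes> twist i j" "c \<otimes> twist j i"] ldist_same_twist[of a b i j] assms
    by simp
  then have "coef i j * d (a \<otimes> twist i j) (c \<otimes> twist j i)
      \<le> coef i j * (ldist (a, i) (b, i) + d (b \<otimes> twist i j) (c \<otimes> twist j i))"
    using coef_bounds(1)[of i j] by (intro mult_left_mono) auto
  moreover have "coef i j * ldist (a, i) (b, i) \<le> 1 * ldist (a, i) (b, i)"
    using coef_bounds(2)[of i j] assms by (intro mult_right_mono) (auto simp: ldist_same le_max_iff_disj)
  ultimately show ?thesis
    using assms by (simp add: ldist_diff distrib_left)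
qed

text \<open>Distances across levels lie in \<open>[1/4, 1/2]\<close>, so two changes of level always
  cost enough; the Lipschitz estimate handles a single change.\<close>

lemma ldist_triangle:
  assumes "p \<in> P" "q \<in> P" "r \<in> P"
  shows "ldist p r \<le> ldist p q + ldist q r"
proof -
  obtain a i b j c k where pqr: "p = (a, i)" "q = (b, j)" "r = (c, k)"
    and in_G: "a \<in> carrier G" "b \<in> carrier G" "c \<in> carrier G"
    using assms by auto
  consider "i = j" "j = k" | "i = j" "j \<noteq> k" | "i \<noteq> j" "j = k" | "i \<noteq> j" "j \<noteq> k" "i = k"
    | "i \<noteq> j" "j \<noteq> k" "i \<noteq> k" by blast
  then show ?thesis
  proof cases
    case 1
    then show ?thesis
      using in_G triangle[of a b c] triangle[of "a \<otimes> h i" "b \<otimes> h i" "c \<otimes> h i"]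
      by (auto simp: pqr ldist_same max_def)
  next
    case 2
    then show ?thesis using ldist_lipschitz[of a b c j k] in_G by (simp add: pqr)
  next
    case 3
    then show ?thesis
      using ldist_lipschitz[of c b a k i, unfolded ldist_sym[of "(c, k)" "(a, i)"]
          ldist_sym[of "(b, k)" "(a, i)"] ldist_sym[of "(c, k)" "(b, k)"]] in_G
      by (simp add: pqr)
  next
    case 4
    then show ?thesis
      using ldist_same_le[of a c k] ldist_diff_ge[of a b k j] ldist_diff_ge[of b c j k] in_G by (simp add: pqr)
  next
    case 5
    then show ?thesis
      using ldist_diff_le[of a c i k] ldist_diff_ge[of a b i j] ldist_diff_ge[of b c j k] in_G by (simp add: pqr)
  qed
qed

lemma Metric_space_ldist: "Metric_space P ldist"
proof
  fix p q :: "'a \<times> nat"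
  show "0 \<le> ldist p q"
    using base_bounds(1)[of "snd p" "snd q"] coef_bounds(1)[of "snd p" "snd q"]
    by (auto simp: ldist_def le_max_iff_disj intro!: add_nonneg_nonneg mult_nonneg_nonneg)
  show "ldist p q = ldist q p" by (rule ldist_sym)
next
  fix p q assume pq: "p \<in> P" "q \<in> P"
  obtain a i b j where p: "p = (a, i)" "q = (b, j)" and G: "a \<in> carrier G" "b \<in> carrier G"
    using pq by auto
  show "ldist p q = 0 \<longleftrightarrow> p = q"
  proof (cases "i = j")
    case True
    have "0 \<le> d (a \<otimes> h j) (b \<otimes> h j)" by simp
    moreover have "0 \<le> d a b" by simp
    ultimately have "max (d a b) (d (a \<otimes> h j) (b \<otimes> h j)) = 0 \<longleftrightarrow> d a b = 0 \<and> d (a \<otimes> h j) (b \<otimes> h j) = 0"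
      by linarith
    then show ?thesis using G True by (auto simp: p ldist_same)
  next
    case False
    then show ?thesis using ldist_diff_ge[OF G False] by (auto simp: p)
  qed
next
  fix p q r assume "p \<in> P" "q \<in> P" "r \<in> P"
  then show "ldist p r \<le> ldist p q + ldist q r" by (rule ldist_triangle)
qed

sublocale L: small_metric P ldist
proof (intro small_metric.intro Metric_space_ldist small_metric_axioms.intro)
  fix p q assume pq: "p \<in> P" "q \<in> P"
  obtain a i b j where p: "p = (a, i)" "q = (b, j)" and G: "a \<in> carrier G" "b \<in> carrier G"
    using pq by auto
  show "ldist p q \<le> 1/2"
    using ldist_same_le[OF G, of j] ldist_diff_le[OF G, of i j] by (cases "i = j") (auto simp: p)
qed

text \<open>The identity outside the carrier, so that \<open>act (inv g)\<close> inverts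
  \<open>act g\<close> on the whole type, as \<open>symmetry\<close> demands.\<close>

definition act :: "'a \<Rightarrow> 'a \<times> nat \<Rightarrow> 'a \<times> nat" where
  "act g q = (if fst q \<in> carrier G then (g \<otimes> fst q, snd q) else q)"

lemma act_pair [simp]: "a \<in> carrier G \<Longrightarrow> act g (a, i) = (g \<otimes> a, i)"
  by (simp add: act_def)

lemma act_mult: "g \<in> carrier G \<Longrightarrow> g' \<in> carrier G \<Longrightarrow> act (g \<otimes> g') q = act g (act g' q)"
  by (simp add: act_def m_assoc)

lemma act_one: "act \<one> q = q"
  by (cases q) (simp add: act_def)

lemma ldist_left_inv:
  assumes "g \<in> carrier G" "a \<in> carrier G" "b \<in> carrier G"
  shows "ldist (g \<otimes> a, i) (g \<otimes> b, j) = ldist (a, i) (b, j)"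
  using assms by (simp add: ldist_def m_assoc left_inv)

lemma symmetry_act:
  assumes g: "g \<in> carrier G"
  shows "L.symmetry (act g) (act (inv g))"
  unfolding L.symmetry_def
proof (intro conjI allI ballI)
  fix q
  show "act (inv g) (act g q) = q"
    using act_mult[of "inv g" g q] g by (simp add: act_one)
  show "act g (act (inv g) q) = q"
    using act_mult[of g "inv g" q] g by (simp add: act_one)
next
  show "act g ` P \<subseteq> P" "act (inv g) ` P \<subseteq> P" using g by auto
next
  fix p q assume "p \<in> P" "q \<in> P"
  then show "ldist (act g p) (act g q) = ldist p q"
    using g by (auto simp: ldist_left_inv)
qed

definition tr :: "'a \<Rightarrow> (('a \<times> nat) option discrete \<Rightarrow>\<^sub>C real) \<Rightarrow> ('a \<times> nat) option discrete \<Rightarrow>\<^sub>C real" where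
  "tr g = L.translate (act (inv g))"

lemma tr_pt: "g \<in> carrier G \<Longrightarrow> a \<in> carrier G \<Longrightarrow> tr g (L.pt (a, i)) = L.pt (g \<otimes> a, i)"
  unfolding tr_def by (subst L.translate_pt[OF symmetry_act]) auto

lemma tr_mult:
  assumes "g \<in> carrier G" "g' \<in> carrier G"
  shows "tr (g \<otimes> g') x = tr g (tr g' x)"
proof -
  have "act (inv (g \<otimes> g')) = (\<lambda>q. act (inv g') (act (inv g) q))"
    using assms by (simp add: inv_mult_group act_mult fun_eq_iff)
  then show ?thesis by (simp add: tr_def L.translate_comp)
qed

lemma tr_one: "tr \<one> x = x"
proof -
  have "act \<one> = (\<lambda>q. q)" by (simp add: act_one fun_eq_iff)
  then show ?thesis by (simp add: tr_def L.translate_id)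
qed

lemma norm_tr: "g \<in> carrier G \<Longrightarrow> norm (tr g x) = norm x"
  unfolding tr_def by (rule L.norm_translate[OF symmetry_act])

lemma linear_tr: "linear (tr g)"
  unfolding tr_def by (rule L.linear_translate)

lemma linear_map_on_tr: "linear_map_on S (tr g)"
  by (simp add: linear_map_on_def linear_add[OF linear_tr] linear_scale[OF linear_tr])

lemma dist_pt: "p \<in> P \<Longrightarrow> q \<in> P \<Longrightarrow> dist (L.pt p) (L.pt q) = ldist p q"
  by (simp only: dist_norm L.norm_pt_diff)

lemma ldist_same_tendsto:
  assumes "\<And>n. u n \<in> carrier G" "\<And>n. v n \<in> carrier G" "(\<lambda>n. d (u n) (v n)) \<longlonglongrightarrow> 0"
  shows "(\<lambda>n. ldist (u n, i) (v n, i)) \<longlonglongrightarrow> 0"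
proof -
  have "(\<lambda>n. max (d (u n) (v n)) (d (u n \<otimes> h i) (v n \<otimes> h i))) \<longlonglongrightarrow> max 0 0"
    by (intro tendsto_max assms right_cont h_in)
  then show ?thesis using assms by (simp add: ldist_same)
qed

lemma pt_diff_tendsto:
  assumes "\<And>n. u n \<in> carrier G" "\<And>n. v n \<in> carrier G" "(\<lambda>n. d (u n) (v n)) \<longlonglongrightarrow> 0"
  shows "(\<lambda>n. L.pt (u n, i) - L.pt (v n, i)) \<longlonglongrightarrow> 0"
  by (rule tendsto_norm_zero_cancel) (use ldist_same_tendsto[OF assms] assms in \<open>simp add: L.norm_pt_diff\<close>)

lemma pt_tendsto:
  assumes "\<And>n. u n \<in> carrier G" "a \<in> carrier G" "(\<lambda>n. d (u n) a) \<longlonglongrightarrow> 0"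
  shows "(\<lambda>n. L.pt (u n, i)) \<longlonglongrightarrow> L.pt (a, i)"
  using pt_diff_tendsto[of u "\<lambda>_. a" i] assms by (simp add: LIM_zero_iff)

lemma pt_tendsto_imp:
  assumes "\<And>n. u n \<in> carrier G" "a \<in> carrier G" "(\<lambda>n. L.pt (u n, i)) \<longlonglongrightarrow> L.pt (a, i)"
  shows "(\<lambda>n. d (u n) a) \<longlonglongrightarrow> 0"
proof -
  have "(\<lambda>n. norm (L.pt (u n, i) - L.pt (a, i))) \<longlonglongrightarrow> 0"
    using assms(3) by (intro tendsto_norm_zero) (simp add: LIM_zero_iff)
  then have "(\<lambda>n. ldist (u n, i) (a, i)) \<longlonglongrightarrow> 0"
    using assms by (simp add: L.norm_pt_diff)
  then show ?thesis
    by (rule tendsto_sandwich[OF _ _ tendsto_const, rotated 2]) (use assms in \<open>simp_all add: ldist_same\<close>)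
qed

definition level :: "nat \<Rightarrow> (('a \<times> nat) option discrete \<Rightarrow>\<^sub>C real) set" where
  "level i = closure ((\<lambda>a. L.pt (a, i)) ` carrier G)"

lemma pt_in_level: "a \<in> carrier G \<Longrightarrow> L.pt (a, i) \<in> level i"
  unfolding level_def using closure_subset[of "(\<lambda>a. L.pt (a, i)) ` carrier G"] by blast

lemma level_subset: "level i \<subseteq> closure (L.pt ` P)"
  unfolding level_def by (rule closure_mono) auto

lemma level_approx:
  assumes "x \<in> level i"
  obtains u where "\<And>n. u n \<in> carrier G" "(\<lambda>n. L.pt (u n, i)) \<longlonglongrightarrow> x"
proof -
  obtain f where f: "\<forall>n. f n \<in> (\<lambda>a. L.pt (a, i)) ` carrier G" "f \<longlonglongrightarrow> x"
    using assms unfolding level_def closure_sequential by metis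
  then obtain u where "\<forall>n. u n \<in> carrier G \<and> f n = L.pt (u n, i)"
    unfolding image_iff by metis
  then have "\<And>n. u n \<in> carrier G" and "f = (\<lambda>n. L.pt (u n, i))" by auto
  then show ?thesis using that[of u] f(2) by simp
qed

text \<open>Different levels are at least 1/4 apart, so all peaks within 1/16 of \<open>x\<close>
  sit on one level.\<close>

lemma level_cover:
  assumes "x \<in> closure (L.pt ` P)"
  obtains i where "x \<in> level i"
proof -
  have approx: "\<exists>p\<in>P. dist (L.pt p) x < e" if "0 < e" for e
    using assms[unfolded closure_approachable, rule_format, OF that] by blast
  obtain p where p: "p \<in> P" "dist (L.pt p) x < 1/16"
    using approx[of "1/16"] by auto
  obtain a i where ai: "p = (a, i)" "a \<in> carrier G" using p(1) by auto
  have "x \<in> level i"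
    unfolding level_def closure_approachable
  proof (intro allI impI)
    fix e :: real assume "0 < e"
    then have "0 < min e (1/16)" by simp
    then obtain q where q: "q \<in> P" "dist (L.pt q) x < min e (1/16)"
      using approx by blast
    obtain b j where bj: "q = (b, j)" "b \<in> carrier G" using q(1) by auto
    have "ldist p q < 1/8"
      using dist_triangle2[of "L.pt p" "L.pt q" x] p q by (simp add: dist_pt)
    then have "i = j" using ldist_diff_ge[OF ai(2) bj(2), of i j] ai bj by (cases "i = j") auto
    then show "\<exists>y\<in>(\<lambda>a. L.pt (a, i)) ` carrier G. dist y x < e"
      using q(2) bj by auto
  qed
  then show ?thesis using that by blast
qed

lemma level_same_dist: "x \<in> level i \<Longrightarrow> y \<in> level i \<Longrightarrow> norm (x - y) \<le> 1/8"
  using norm_diff_in_closed[of x "(\<lambda>a. L.pt (a, i)) ` carrier G" y "(\<lambda>a. L.pt (a, i)) ` carrier G" "{..1/8}"]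
    ldist_same_le unfolding level_def by (fastforce simp: L.norm_pt_diff simp del: le_divide_eq_numeral1)

lemma level_diff_dist:
  assumes "x \<in> level i" "y \<in> level j" "i \<noteq> j"
  shows "norm (x - y) \<in> {base i j .. base i j + coef i j / 8}"
  by (rule norm_diff_in_closed[of x "(\<lambda>a. L.pt (a, i)) ` carrier G" y "(\<lambda>a. L.pt (a, j)) ` carrier G"])
    (use assms ldist_diff_bounds in \<open>auto simp: level_def L.norm_pt_diff\<close>)

lemma level_positive_dist:
  assumes "x \<in> level i" "y \<in> level j" "i \<noteq> j" "0 < i" "0 < j"
  shows "3/8 \<le> norm (x - y)"
  using level_diff_dist[OF assms(1-3)] assms(4,5) by (simp add: base_def)

text \<open>With \<open>level_positive_dist\<close> this singles out level 0 metrically: from a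
  point of any other level, some distance is at least 3/8. The extreme case here is
  \<open>j = 1\<close>.\<close>

lemma level_zero_dist:
  assumes "x \<in> level 0" "y \<in> closure (L.pt ` P)"
  shows "norm (x - y) < 3/8"
proof -
  obtain j where j: "y \<in> level j" using level_cover[OF assms(2)] by blast
  show ?thesis
  proof (cases "j = 0")
    case True
    then show ?thesis using level_same_dist[of x 0 y] assms(1) j by simp
  next
    case False
    then have "(1/2::real) ^ j \<le> 1/2" using power_decreasing[of 1 j "1/2::real"] by simp
    then show ?thesis
      using level_diff_dist[OF assms(1) j] False by (simp add: base_def coef_def)
  qed
qed

text \<open>Halving beats the width of the intervals: \<open>2 * w \<le> v\<close> gives
  \<open>w / 8 + w / 64 < v / 8\<close>.\<close>

lemma zero_level_ranges_disjoint:
  assumes "0 < i" "0 < j" "s \<in> {base 0 i .. base 0 i + coef 0 i / 8}" "s \<in> {base 0 j .. base 0 j + coef 0 j / 8}"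
  shows "i = j"
proof (rule ccontr)
  have *: False if "i < j" "s \<in> {base 0 i .. base 0 i + coef 0 i / 8}" "s \<in> {base 0 j .. base 0 j + coef 0 j / 8}" for i j
  proof -
    define v w :: real where "v = (1/2) ^ i" and "w = (1/2) ^ j"
    have "(1/2::real) ^ j \<le> (1/2) ^ Suc i"
      using that(1) by (intro power_decreasing) auto
    then have "2 * w \<le> v" by (simp add: v_def w_def)
    moreover have "0 < v" by (simp add: v_def)
    moreover have "1/4 + v / 8 \<le> s" "s \<le> 1/4 + w / 8 + w / 64"
      using that(2,3) by (auto simp: base_def coef_def v_def w_def)
    ultimately show False by linarith
  qed
  assume "i \<noteq> j"
  then show False using *[of i j] *[of j i] assms by linarith
qed

end

context leveled_group
begin

text \<open>Countably many peaks suffice. This gives separability, and it restricts the test of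
  convergence to the peaks that chains of matched pairs can reach from the unit.\<close>

lemma pt_span_eq: "L.pt_span = closure (span (range (\<lambda>(i, j). L.pt (h (Suc i), j))))"
proof -
  let ?A = "range (\<lambda>(i, j). L.pt (h (Suc i), j))"
  have in_A: "L.pt (h (Suc i), j) \<in> ?A" for i j
    by (rule rev_image_eqI[of "(i, j)"]) auto
  have closA: "L.pt (a, j) \<in> closure ?A" if a: "a \<in> carrier G" for a j
  proof -
    obtain i where "(\<lambda>n. d (h (Suc (i n))) a) \<longlonglongrightarrow> 0" using h_dense[OF a] by (rule exE)
    then have "(\<lambda>n. L.pt (h (Suc (i n)), j)) \<longlonglongrightarrow> L.pt (a, j)"
      using a by (intro pt_tendsto) auto
    then show ?thesis
      unfolding closure_sequential using in_A by (intro exI[of _ "\<lambda>n. L.pt (h (Suc (i n)), j)"]) simp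
  qed
  show ?thesis
  proof
    have "L.pt ` P \<subseteq> closure (span ?A)"
      using closA closure_mono[OF span_superset[of ?A]] by auto
    then have "span (L.pt ` P) \<subseteq> closure (span ?A)"
      by (intro span_minimal subspace_closure subspace_span)
    then show "L.pt_span \<subseteq> closure (span ?A)"
      unfolding L.pt_span_def by (intro closure_minimal closed_closure)
    have "?A \<subseteq> L.pt ` P" by auto
    then show "closure (span ?A) \<subseteq> L.pt_span"
      unfolding L.pt_span_def by (intro closure_mono span_mono)
  qed
qed

end

text \<open>No single metric need be both left-invariant and complete, so \<open>e\<close> supplies
  completeness and \<open>d\<close> invariance. The assumptions link them only as far as the
  category argument requires.\<close>

locale complete_leveled_group = leveled_group +
  fixes e :: "'a \<Rightarrow> 'a \<Rightarrow> real"
  assumes Metric_space_e: "Metric_space (carrier G) e"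
    and e_cont: "\<lbrakk>a \<in> carrier G; 0 < r\<rbrakk> \<Longrightarrow> \<exists>s>0. \<forall>b\<in>carrier G. d b a < s \<longrightarrow> e b a < r"
    and e_complete: "\<lbrakk>\<And>n. u n \<in> carrier G; \<And>r. 0 < r \<Longrightarrow> \<exists>N. \<forall>m\<ge>N. \<forall>n\<ge>N. e (u m) (u n) < r\<rbrakk>
      \<Longrightarrow> \<exists>a\<in>carrier G. (\<lambda>n. d (u n) a) \<longlonglongrightarrow> 0"
begin

text \<open>The points of the completed level 0 where \<open>e\<close> has oscillation below
  \<open>r\<close>. These sets are relatively open and dense, and they intersect in the embedded
  group, as in the classical proof that completely metrizable subspaces are
  \<open>G\<close>-delta.\<close>

definition near_group :: "real \<Rightarrow> (('a \<times> nat) option discrete \<Rightarrow>\<^sub>C real) set" where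
  "near_group r = {x \<in> level 0. \<exists>s>0. \<forall>a\<in>carrier G. \<forall>b\<in>carrier G.
     dist (L.pt (a, 0)) x < s \<longrightarrow> dist (L.pt (b, 0)) x < s \<longrightarrow> e a b < r}"

lemma dist_pt_zero: "a \<in> carrier G \<Longrightarrow> b \<in> carrier G \<Longrightarrow> dist (L.pt (a, 0)) (L.pt (b, 0)) = d a b"
  by (simp add: dist_pt ldist_same)

lemma near_group_subset: "near_group r \<subseteq> level 0"
  by (auto simp: near_group_def)

lemma near_group_open:
  assumes "x \<in> near_group r"
  obtains s where "0 < s" "\<And>y. y \<in> level 0 \<Longrightarrow> dist y x < s \<Longrightarrow> y \<in> near_group r"
proof -
  obtain s where s: "0 < s" "\<And>a b. a \<in> carrier G \<Longrightarrow> b \<in> carrier G \<Longrightarrow>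
      dist (L.pt (a, 0)) x < s \<Longrightarrow> dist (L.pt (b, 0)) x < s \<Longrightarrow> e a b < r"
    using assms unfolding near_group_def by blast
  show ?thesis
  proof (rule that[of "s / 2"])
    show "0 < s / 2" using s(1) by simp
    fix y assume y: "y \<in> level 0" "dist y x < s / 2"
    have "e a b < r" if "a \<in> carrier G" "b \<in> carrier G"
      "dist (L.pt (a, 0)) y < s / 2" "dist (L.pt (b, 0)) y < s / 2" for a b
    proof (rule s(2)[OF that(1,2)])
      show "dist (L.pt (a, 0)) x < s"
        using dist_triangle[of "L.pt (a, 0)" x y] that(3) y(2) by linarith
      show "dist (L.pt (b, 0)) x < s"
        using dist_triangle[of "L.pt (b, 0)" x y] that(4) y(2) by linarith
    qed
    then show "y \<in> near_group r"
      using s(1) y(1) unfolding near_group_def by (intro CollectI conjI exI[of _ "s / 2"]) auto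
  qed
qed

lemma pt_near_group:
  assumes a: "a \<in> carrier G" and "0 < r"
  shows "L.pt (a, 0) \<in> near_group r"
proof -
  interpret E: Metric_space "carrier G" e by (rule Metric_space_e)
  obtain s where s: "0 < s" "\<And>b. b \<in> carrier G \<Longrightarrow> d b a < s \<Longrightarrow> e b a < r / 2"
    using e_cont[OF a, of "r / 2"] assms(2) by auto
  have "e b c < r" if "b \<in> carrier G" "c \<in> carrier G"
    "dist (L.pt (b, 0)) (L.pt (a, 0)) < s" "dist (L.pt (c, 0)) (L.pt (a, 0)) < s" for b c
  proof -
    have "e b a < r / 2" "e c a < r / 2"
      using s(2)[OF that(1)] s(2)[OF that(2)] that a by (simp_all add: dist_pt_zero)
    then show ?thesis using E.triangle[of b a c] E.commute[of a c] that a by simp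
  qed
  then show ?thesis
    unfolding near_group_def using s(1) pt_in_level[OF a] by (intro CollectI conjI exI[of _ s]) auto
qed

text \<open>Vanishing oscillation makes any sequence of group points approaching \<open>x\<close>
  Cauchy for \<open>e\<close>, so its limit exists in the group.\<close>

lemma near_group_Inter:
  assumes "\<And>n. x \<in> near_group (inverse (real (Suc n)))"
  obtains a where "a \<in> carrier G" "x = L.pt (a, 0)"
proof -
  have "x \<in> level 0" using assms[of 0] by (simp add: near_group_def)
  then obtain u where u: "\<And>n. u n \<in> carrier G" "(\<lambda>n. L.pt (u n, 0)) \<longlonglongrightarrow> x"
    by (rule level_approx) blast
  have "\<exists>N. \<forall>m\<ge>N. \<forall>n\<ge>N. e (u m) (u n) < r" if "0 < r" for r
  proof -
    obtain k where k: "inverse (real (Suc k)) < r" using reals_Archimedean[OF \<open>0 < r\<close>] by blast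
    obtain s where s: "0 < s" "\<And>a b. a \<in> carrier G \<Longrightarrow> b \<in> carrier G \<Longrightarrow>
      dist (L.pt (a, 0)) x < s \<Longrightarrow> dist (L.pt (b, 0)) x < s \<Longrightarrow> e a b < inverse (real (Suc k))"
      using assms[of k] unfolding near_group_def by blast
    obtain N where N: "\<And>n. n \<ge> N \<Longrightarrow> dist (L.pt (u n, 0)) x < s"
      using tendstoD[OF u(2) s(1)] unfolding eventually_sequentially by blast
    have "e (u m) (u n) < r" if "m \<ge> N" "n \<ge> N" for m n
      using s(2)[OF u(1) u(1) N[OF that(1)] N[OF that(2)]] k by linarith
    then show ?thesis by blast
  qed
  then obtain a where a: "a \<in> carrier G" "(\<lambda>n. d (u n) a) \<longlonglongrightarrow> 0"
    using e_complete[of u] u(1) by blast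
  then have "(\<lambda>n. L.pt (u n, 0)) \<longlonglongrightarrow> L.pt (a, 0)"
    using u(1) by (intro pt_tendsto)
  then have "x = L.pt (a, 0)" using u(2) LIMSEQ_unique by blast
  then show ?thesis using that a(1) by blast
qed

lemma near_group_dense:
  assumes "x \<in> level 0" "0 < r" "0 < s"
  shows "\<exists>y\<in>near_group r. dist y x < s"
proof -
  obtain a where "a \<in> carrier G" "dist (L.pt (a, 0)) x < s"
    using assms(1,3) unfolding level_def closure_approachable by blast
  then show ?thesis using pt_near_group[OF _ assms(2)] by blast
qed

text \<open>Baire category: both \<open>G\<close> and its preimage under \<open>S\<close> contain dense \<open>G\<^sub>\<delta>\<close> sets
  of \<open>level 0\<close>, hence they meet.\<close>

lemma isometry_maps_group_point:
  assumes S: "S ` level 0 = level 0"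
    and iso: "\<And>x y. x \<in> level 0 \<Longrightarrow> y \<in> level 0 \<Longrightarrow> dist (S x) (S y) = dist x y"
  obtains a b where "a \<in> carrier G" "b \<in> carrier G" "S (L.pt (a, 0)) = L.pt (b, 0)"
proof -
  interpret M: Metric_space "level 0" dist
    by unfold_locales (auto simp: dist_commute dist_triangle)
  define r :: "nat \<Rightarrow> real" where "r n = inverse (real (Suc n))" for n
  have r_pos: "0 < r n" for n by (simp add: r_def)
  define A where "A n = near_group (r n)" for n
  define B where "B n = {x \<in> level 0. S x \<in> near_group (r n)}" for n
  have opn: "openin M.mtopology W"
    if sub: "W \<subseteq> level 0" and nhd: "\<And>x. x \<in> W \<Longrightarrow> \<exists>s>0. \<forall>y\<in>level 0. dist y x < s \<longrightarrow> y \<in> W" for W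
    unfolding M.openin_mtopology
  proof (intro conjI allI impI sub)
    fix x assume x: "x \<in> W"
    obtain s where "s > 0" "\<forall>y\<in>level 0. dist y x < s \<longrightarrow> y \<in> W" using nhd[OF x] by auto
    then show "\<exists>s>0. M.mball x s \<subseteq> W" by (intro exI[of _ s]) (auto simp: dist_commute)
  qed
  have dns: "M.mtopology closure_of W = level 0"
    if sub: "W \<subseteq> level 0" and near: "\<And>x s. x \<in> level 0 \<Longrightarrow> 0 < s \<Longrightarrow> \<exists>y\<in>W. dist y x < s" for W
  proof
    show "M.mtopology closure_of W \<subseteq> level 0"
      using closure_of_subset_topspace[of M.mtopology W] by simp
    show "level 0 \<subseteq> M.mtopology closure_of W"
    proof
      fix x assume x: "x \<in> level 0"
      have "\<exists>y\<in>W. y \<in> M.mball x s" if "0 < s" for s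
        using near[OF x that] x sub by (auto simp: dist_commute)
      then show "x \<in> M.mtopology closure_of W" using x by (simp add: M.metric_closure_of)
    qed
  qed
  have Ao: "openin M.mtopology (A n)" for n
    unfolding A_def
  proof (rule opn[OF near_group_subset])
    fix x assume "x \<in> near_group (r n)"
    then show "\<exists>s>0. \<forall>y\<in>level 0. dist y x < s \<longrightarrow> y \<in> near_group (r n)"
      by (rule near_group_open) blast
  qed
  have Ad: "M.mtopology closure_of (A n) = level 0" for n
    unfolding A_def using near_group_dense[OF _ r_pos] by (intro dns near_group_subset)
  have Bo: "openin M.mtopology (B n)" for n
  proof (rule opn)
    show "B n \<subseteq> level 0" by (auto simp: B_def)
    fix x assume x: "x \<in> B n"
    then obtain s where s: "0 < s" "\<And>y. y \<in> level 0 \<Longrightarrow> dist y (S x) < s \<Longrightarrow> y \<in> near_group (r n)"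
      unfolding B_def using near_group_open[of "S x" "r n"] by blast
    have "y \<in> B n" if "y \<in> level 0" "dist y x < s" for y
      using that x S iso[of y x] by (auto simp: B_def intro!: s(2))
    then show "\<exists>s>0. \<forall>y\<in>level 0. dist y x < s \<longrightarrow> y \<in> B n" using s(1) by blast
  qed
  have Bd: "M.mtopology closure_of (B n) = level 0" for n
  proof (rule dns)
    show "B n \<subseteq> level 0" by (auto simp: B_def)
    fix x s assume x: "x \<in> level 0" "(0::real) < s"
    then have "S x \<in> level 0" using S by blast
    then obtain z where z: "z \<in> near_group (r n)" "dist z (S x) < s"
      using near_group_dense[of "S x" "r n" s] x r_pos by auto
    have "z \<in> level 0" using z(1) by (simp add: near_group_def)
    \<comment> \<open>Surjectivity of \<open>S\<close> enters here: it pulls a dense set back to a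
      dense set.\<close>
    then obtain y where "y \<in> level 0" "z = S y" using S by blast
    then show "\<exists>y\<in>B n. dist y x < s"
      using z iso x by (intro bexI[of _ y]) (auto simp: B_def)
  qed
  have "M.mcomplete"
    by (rule mcomplete_dist_closed) (simp add: level_def)
  moreover have "countable (range A \<union> range B)" by simp
  moreover have "openin M.mtopology W \<and> M.mtopology closure_of W = level 0" if "W \<in> range A \<union> range B" for W
    using that Ao Ad Bo Bd by blast
  ultimately have cl: "M.mtopology closure_of \<Inter>(range A \<union> range B) = level 0"
    by (rule M.metric_Baire_category)
  have "\<Inter>(range A \<union> range B) \<noteq> {}"
  proof
    assume "\<Inter>(range A \<union> range B) = {}"
    from cl[unfolded this] have "level 0 = {}" by simp
    then show False using pt_in_level[OF one_closed, of 0] by simp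
  qed
  then obtain x where "x \<in> \<Inter>(range A \<union> range B)" by blast
  then have xA: "x \<in> A n" and xB: "x \<in> B n" for n by auto
  have "x \<in> near_group (inverse (real (Suc n)))" for n
    using xA[of n] unfolding A_def r_def .
  then obtain a where a: "a \<in> carrier G" "x = L.pt (a, 0)"
    by (rule near_group_Inter)
  have "S x \<in> near_group (inverse (real (Suc n)))" for n
    using xB[of n] unfolding B_def r_def by blast
  then obtain b where b: "b \<in> carrier G" "S x = L.pt (b, 0)"
    by (rule near_group_Inter)
  show ?thesis
    using that[OF a(1) b(1)] a(2) b(2) by simp
qed

text \<open>The distance pattern in \<open>base\<close> forces levels to be preserved. Matched pairs
  then spread translations that approximate \<open>S\<close> at one peak to enough peaks to
  determine \<open>S\<close>, and one group point sent to a group point makes these translations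
  converge.\<close>

lemma tilt_isometry_is_translation:
  assumes lin: "linear_map_on L.pt_span S" and onto: "S ` L.pt_span = L.pt_span"
    and pres: "\<And>x. x \<in> L.pt_span \<Longrightarrow> L.hull_norm (S x) = L.hull_norm x \<and> (\<forall>t. L.tilt (S x) t = L.tilt x t)"
  shows "\<exists>g\<in>carrier G. \<forall>x\<in>L.pt_span. S x = tr g x"
proof -
  let ?M = "closure (L.pt ` P)"
  have SM: "S ` ?M = ?M"
    by (rule L.linear_tilt_isometry_points(1)[OF lin onto pres])
  have iso: "norm (S x - S y) = norm (x - y)" if "x \<in> ?M" "y \<in> ?M" for x y
    by (rule L.linear_tilt_isometry_points(2)[OF lin onto pres that])
  have levM: "x \<in> ?M" if "x \<in> level i" for x i using that level_subset by blast
  have ptM: "L.pt (a, i) \<in> ?M" if "a \<in> carrier G" for a i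
    using levM[OF pt_in_level[OF that]] .
  have SinM: "S x \<in> ?M" if "x \<in> ?M" for x
    using imageI[OF that, of S] unfolding SM .
  have zero: "x \<in> level 0 \<longleftrightarrow> S x \<in> level 0" if x: "x \<in> ?M" for x
  proof
    assume x0: "x \<in> level 0"
    obtain i where i: "S x \<in> level i" by (rule level_cover[OF SinM[OF x]])
    have "i = 0"
    proof (rule ccontr)
      assume "i \<noteq> 0"
      \<comment> \<open>\<open>Suc i\<close> is merely some positive level other than
        \<open>i\<close>.\<close>
      then have "3/8 \<le> norm (S x - L.pt (\<one>, Suc i))"
        using level_positive_dist[OF i pt_in_level[OF one_closed, of "Suc i"]] by simp
      moreover have "L.pt (\<one>, Suc i) \<in> S ` ?M"
        unfolding SM by (rule ptM[OF one_closed])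
      then obtain z where "L.pt (\<one>, Suc i) = S z" "z \<in> ?M" by (rule imageE)
      ultimately show False using iso[of x z] level_zero_dist[OF x0, of z] x by simp
    qed
    then show "S x \<in> level 0" using i by simp
  next
    assume x0: "S x \<in> level 0"
    obtain i where i: "x \<in> level i" by (rule level_cover[OF x])
    have "i = 0"
    proof (rule ccontr)
      assume "i \<noteq> 0"
      then have "3/8 \<le> norm (x - L.pt (\<one>, Suc i))"
        using level_positive_dist[OF i pt_in_level[OF one_closed, of "Suc i"]] by simp
      then show False
        using iso[OF x ptM[OF one_closed, of "Suc i"]]
          level_zero_dist[OF x0 SinM[OF ptM[OF one_closed, of "Suc i"]]] by simp
    qed
    then show "x \<in> level 0" using i by simp
  qed
  have S_level: "S x \<in> level i" if x: "x \<in> level i" for x i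
  proof (cases "i = 0")
    case True
    then show ?thesis using zero[OF levM[OF x]] x by simp
  next
    case False
    obtain j where j: "S x \<in> level j" by (rule level_cover[OF SinM[OF levM[OF x]]])
    \<comment> \<open>A reference point whose image is again on level 0: its distance to
      \<open>x\<close> reveals the level of \<open>x\<close> and, being preserved, also that of
      \<open>S x\<close>.\<close>
    let ?w = "L.pt (\<one>, 0)"
    have w: "?w \<in> level 0" "S ?w \<in> level 0"
      using pt_in_level[OF one_closed, of 0] zero[OF ptM[OF one_closed, of 0]] by auto
    have "j \<noteq> 0"
    proof
      assume "j = 0"
      then have "x \<in> level 0" using j zero[OF levM[OF x]] by simp
      then show False using level_diff_dist[OF w(1) x] level_same_dist[of ?w 0 x] w(1) False
        base_bounds(1)[of 0 i] by auto
    qed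
    have "norm (?w - x) \<in> {base 0 i .. base 0 i + coef 0 i / 8}"
      using level_diff_dist[OF w(1) x] False by simp
    moreover have "norm (?w - x) \<in> {base 0 j .. base 0 j + coef 0 j / 8}"
      using level_diff_dist[OF w(2) j] \<open>j \<noteq> 0\<close> iso[OF ptM[OF one_closed, of 0] levM[OF x]] by simp
    ultimately have "i = j"
      using zero_level_ranges_disjoint[of i j] False \<open>j \<noteq> 0\<close> by blast
    then show ?thesis using j by simp
  qed
  \<comment> \<open>So far the image of the unit is only a point of the completion, and
    \<open>g\<close> need not converge in the group.\<close>
  obtain g where g: "\<And>n. g n \<in> carrier G" "(\<lambda>n. L.pt (g n, 0)) \<longlonglongrightarrow> S (L.pt (\<one>, 0))"
    by (rule level_approx[OF S_level[OF pt_in_level[OF one_closed, of 0]]]) blast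
  define Q where "Q a i \<longleftrightarrow> (\<lambda>n. L.pt (g n \<otimes> a, i)) \<longlonglongrightarrow> S (L.pt (a, i))" for a i
  text \<open>Two points of different levels at minimal distance determine each other.\<close>
  have edge: "Q b j" if G: "a \<in> carrier G" "b \<in> carrier G" and ij: "i \<noteq> j"
    and match: "a \<otimes> twist i j = b \<otimes> twist j i" and Qa: "Q a i" for a b i j
  proof -
    obtain u where u: "\<And>n. u n \<in> carrier G" "(\<lambda>n. L.pt (u n, j)) \<longlonglongrightarrow> S (L.pt (b, j))"
      by (rule level_approx[OF S_level[OF pt_in_level[OF G(2), of j]]]) blast
    have "(\<lambda>n. norm (L.pt (g n \<otimes> a, i) - L.pt (u n, j))) \<longlonglongrightarrow> norm (S (L.pt (a, i)) - S (L.pt (b, j)))"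
      using Qa u(2) unfolding Q_def by (intro tendsto_intros)
    moreover have "norm (S (L.pt (a, i)) - S (L.pt (b, j))) = base i j"
      using iso[OF ptM ptM, of a b i j] G ij match by (simp add: L.norm_pt_diff ldist_diff)
    moreover have "norm (L.pt (g n \<otimes> a, i) - L.pt (u n, j))
        = base i j + coef i j * d (g n \<otimes> b \<otimes> twist j i) (u n \<otimes> twist j i)" for n
      using g(1)[of n] u(1)[of n] G ij match by (simp add: L.norm_pt_diff ldist_diff m_assoc)
    ultimately have "(\<lambda>n. base i j + coef i j * d (g n \<otimes> b \<otimes> twist j i) (u n \<otimes> twist j i)) \<longlonglongrightarrow> base i j"
      by simp
    then have "(\<lambda>n. inverse (coef i j) * ((base i j + coef i j * d (g n \<otimes> b \<otimes> twist j i) (u n \<otimes> twist j i)) - base i j))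
        \<longlonglongrightarrow> inverse (coef i j) * (base i j - base i j)"
      by (intro tendsto_intros)
    then have "(\<lambda>n. d (g n \<otimes> b \<otimes> twist j i) (u n \<otimes> twist j i)) \<longlonglongrightarrow> 0"
      using coef_bounds(1)[of i j] by simp
    \<comment> \<open>The common right factor is removed by multiplying with its inverse, which
      \<open>right_cont\<close> allows.\<close>
    then have "(\<lambda>n. d (g n \<otimes> b \<otimes> twist j i \<otimes> inv (twist j i)) (u n \<otimes> twist j i \<otimes> inv (twist j i))) \<longlonglongrightarrow> 0"
      by (rule right_cont[rotated 3]) (use g(1) u(1) G in auto)
    then have "(\<lambda>n. d (g n \<otimes> b) (u n)) \<longlonglongrightarrow> 0"
      using g(1) u(1) G by (simp add: m_assoc)
    then have "(\<lambda>n. (L.pt (g n \<otimes> b, j) - L.pt (u n, j)) + L.pt (u n, j)) \<longlonglongrightarrow> 0 + S (L.pt (b, j))"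
      using g(1) u G by (intro tendsto_add pt_diff_tendsto) auto
    then show ?thesis by (simp add: Q_def)
  qed
  have Q10: "Q \<one> 0" using g by (simp add: Q_def)
  have up1: "Q a (Suc 0)" if "Q a 0" "a \<in> carrier G" for a
    by (rule edge[OF that(2,2) _ _ that(1)]) (auto simp: twist_def)
  have up: "Q a j" if "Q a 0" "a \<in> carrier G" for a j
  proof (cases "j = 0 \<or> j = Suc 0")
    case True
    then show ?thesis using that up1 by auto
  next
    case False
    then show ?thesis
      by (intro edge[OF that(2,2) _ _ up1[OF that], of j]) (auto simp: twist_def)
  qed
  \<comment> \<open>The route leads from the unit at level 0 to the unit at level
    \<open>Suc i\<close>, whose match at level 0 is \<open>h (Suc i)\<close>, and from there to all
    levels.\<close>
  have Qh: "Q (h (Suc i)) j" for i j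
  proof (rule up)
    show "Q (h (Suc i)) 0"
      by (rule edge[OF _ _ _ _ up[OF Q10 one_closed, of "Suc i"]]) (auto simp: twist_def)
  qed simp
  let ?A = "range (\<lambda>(i, j). L.pt (h (Suc i), j))"
  have norm_S: "norm (S x) \<le> 2 * norm x" if "x \<in> L.pt_span" for x
    using pres[OF that] L.hull_norm_ge(1)[of "S x"] L.hull_norm_le_norm[of x] by simp
  have lim: "(\<lambda>n. tr (g n) x) \<longlonglongrightarrow> S x" if x: "x \<in> L.pt_span" for x
  proof (rule tendsto_on_closure_span[where V = L.pt_span and A = ?A and K = 2 and F = "\<lambda>n. tr (g n)" and f = S])
    show "(\<lambda>n. tr (g n) a) \<longlonglongrightarrow> S a" if "a \<in> ?A" for a
      using that Qh g(1) unfolding Q_def by (auto simp: tr_pt)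
  qed (use x norm_S in \<open>auto simp: L.subspace_pt_span pt_span_eq[symmetric] linear_map_on_tr norm_tr g(1) lin\<close>)
  have S0: "S ` level 0 = level 0"
  proof
    show "S ` level 0 \<subseteq> level 0" using S_level by blast
    show "level 0 \<subseteq> S ` level 0"
    proof
      fix y assume y: "y \<in> level 0"
      have "y \<in> S ` ?M" unfolding SM by (rule levM[OF y])
      then obtain x where "y = S x" "x \<in> ?M" by (rule imageE)
      then show "y \<in> S ` level 0" using zero y by blast
    qed
  qed
  obtain a b where ab: "a \<in> carrier G" "b \<in> carrier G" "S (L.pt (a, 0)) = L.pt (b, 0)"
    by (rule isometry_maps_group_point[OF S0]) (auto simp: dist_norm iso levM)
  have "(\<lambda>n. L.pt (g n \<otimes> a, 0)) \<longlonglongrightarrow> L.pt (b, 0)"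
    using lim[of "L.pt (a, 0)"] ab L.pt_in_span[of "(a, 0)"] g(1) by (simp add: tr_pt)
  then have "(\<lambda>n. d (g n \<otimes> a) b) \<longlonglongrightarrow> 0"
    using g(1) ab by (intro pt_tendsto_imp[of _ b 0]) auto
  then have "(\<lambda>n. d (g n \<otimes> a \<otimes> inv a) (b \<otimes> inv a)) \<longlonglongrightarrow> 0"
    by (rule right_cont[rotated 3]) (use g(1) ab in auto)
  then have g_lim: "(\<lambda>n. d (g n) (b \<otimes> inv a)) \<longlonglongrightarrow> 0"
    using g(1) ab by (simp add: m_assoc)
  \<comment> \<open>The same sequence also tends to the translation by
    \<open>b \<otimes> inv a\<close>; limits being unique, \<open>S\<close> is this
    translation.\<close>
  have lim': "(\<lambda>n. tr (g n) x) \<longlonglongrightarrow> tr (b \<otimes> inv a) x" if x: "x \<in> L.pt_span" for x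
  proof (rule tendsto_on_closure_span[where V = L.pt_span and A = ?A and K = 2 and F = "\<lambda>n. tr (g n)"
        and f = "tr (b \<otimes> inv a)"])
    show "(\<lambda>n. tr (g n) p) \<longlonglongrightarrow> tr (b \<otimes> inv a) p" if p: "p \<in> ?A" for p
    proof -
      obtain i j where p: "p = L.pt (h (Suc i), j)" using p by auto
      have "(\<lambda>n. L.pt (g n \<otimes> h (Suc i), j)) \<longlonglongrightarrow> L.pt (b \<otimes> inv a \<otimes> h (Suc i), j)"
        using g(1) ab g_lim by (intro pt_tendsto right_cont) auto
      then show ?thesis using g(1) ab by (simp add: p tr_pt)
    qed
  qed (use x ab in \<open>auto simp: L.subspace_pt_span pt_span_eq[symmetric] linear_map_on_tr norm_tr g(1)\<close>)
  show ?thesis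
    using LIMSEQ_unique[OF lim lim'] ab by (intro bexI[of _ "b \<otimes> inv a"]) auto
qed

end

section \<open>Displaying a Polish group\<close>

text \<open>By left invariance, \<open>d (u n) (v n)\<close> measures how far
  \<open>inv (u n) \<otimes> v n\<close> is from the unit. Right multiplication by \<open>k\<close>
  conjugates this element by \<open>k\<close>, and conjugation is continuous at the unit.\<close>

lemma (in topological_group) right_mult_tendsto:
  assumes d: "Metric_space (carrier G) d" "Metric_space.mtopology (carrier G) d = T"
    and left_inv: "\<And>a x y. a \<in> carrier G \<Longrightarrow> x \<in> carrier G \<Longrightarrow> y \<in> carrier G \<Longrightarrow> d (a \<otimes> x) (a \<otimes> y) = d x y"
    and u: "\<And>n. u n \<in> carrier G" and v: "\<And>n. v n \<in> carrier G" and k: "k \<in> carrier G"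
    and lim: "(\<lambda>n. d (u n) (v n)) \<longlonglongrightarrow> 0"
  shows "(\<lambda>n. d (u n \<otimes> k) (v n \<otimes> k)) \<longlonglongrightarrow> 0"
proof -
  interpret D: Metric_space "carrier G" d by (rule d(1))
  have to_one: "d x y = d (inv x \<otimes> y) \<one>" if "x \<in> carrier G" "y \<in> carrier G" for x y
  proof -
    have "d x y = d \<one> (inv x \<otimes> y)" using left_inv[of "inv x" x y] that by simp
    also have "\<dots> = d (inv x \<otimes> y) \<one>" by (rule D.commute)
    finally show ?thesis .
  qed
  have "continuous_map T (prod_topology T T) (\<lambda>x. (x, k))"
    using k by (intro continuous_map_pairedI) (auto simp: topspace_eq_carrier)
  from continuous_map_compose[OF this continuous_mult]
  have "continuous_map T T (\<lambda>x. x \<otimes> k)" by (simp add: o_def)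
  from continuous_map_compose[OF this continuous_map_left_mult[of "inv k"]]
  have conj: "continuous_map T T (\<lambda>x. inv k \<otimes> (x \<otimes> k))" using k by (simp add: o_def)
  have "limitin T (\<lambda>n. inv (u n) \<otimes> v n) \<one> sequentially"
    unfolding d(2)[symmetric] D.limitin_metric_dist_null
    using lim u v unfolding to_one[OF u v] by simp
  from continuous_map_limit[OF conj this]
  have "limitin T (\<lambda>n. inv k \<otimes> (inv (u n) \<otimes> v n \<otimes> k)) \<one> sequentially"
    using k by (simp add: o_def)
  then have "(\<lambda>n. d (inv k \<otimes> (inv (u n) \<otimes> v n \<otimes> k)) \<one>) \<longlonglongrightarrow> 0"
    unfolding d(2)[symmetric] D.limitin_metric_dist_null by blast
  moreover have "d (u n \<otimes> k) (v n \<otimes> k) = d (inv k \<otimes> (inv (u n) \<otimes> v n \<otimes> k)) \<one>" for n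
    using u[of n] v[of n] k to_one[of "u n \<otimes> k" "v n \<otimes> k"] by (simp add: inv_mult_group m_assoc)
  ultimately show ?thesis by simp
qed

lemma (in polish_group) exists_complete_leveled_group:
  obtains d h e where "complete_leveled_group G d h e" "Metric_space.mtopology (carrier G) d = T"
proof -
  obtain M e where Me: "Metric_space M e" "Metric_space.mcomplete M e" "T = Metric_space.mtopology M e"
    using completely_metrizable unfolding completely_metrizable_space_def by blast
  have M: "M = carrier G"
    using Me(3) topspace_eq_carrier Metric_space.topspace_mtopology[OF Me(1)] by simp
  note Me = Me[unfolded M]
  interpret E: Metric_space "carrier G" e by (rule Me(1))
  have "metrizable_space T" using E.metrizable_space_mtopology Me(3) by simp
  then obtain d where d: "Metric_space (carrier G) d" "Metric_space.mtopology (carrier G) d = T"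
    "\<And>a x y. a \<in> carrier G \<Longrightarrow> x \<in> carrier G \<Longrightarrow> y \<in> carrier G \<Longrightarrow> d (a \<otimes> x) (a \<otimes> y) = d x y"
    "\<And>x y. d x y \<le> 1/8"
    by (rule left_invariant_metric[of "1/8"]) auto
  interpret D: Metric_space "carrier G" d by (rule d(1))
  obtain C where C: "countable C" "C \<subseteq> carrier G" "T closure_of C = carrier G"
    using separable unfolding separable_space_def topspace_eq_carrier by blast
  have near: "\<exists>c\<in>C. d c a < r" if "a \<in> carrier G" "0 < r" for a r
  proof -
    have "a \<in> D.mtopology closure_of C" using that C(3) d(2) by simp
    then show ?thesis using that(2) by (auto simp: D.metric_closure_of D.commute)
  qed
  have "C \<noteq> {}" using near[OF one_closed, of 1] by auto
  \<comment> \<open>The places 0 and 1 are reserved for the unit, and the dense sequence starts at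
    place 2.\<close>
  define h where "h i = (if i \<le> 1 then \<one> else from_nat_into C (i - 2))" for i :: nat
  have hC: "\<exists>i. c = h (Suc i)" if c: "c \<in> C" for c
  proof -
    obtain m where "from_nat_into C m = c" using from_nat_into_surj[OF C(1) c] by blast
    then show ?thesis by (intro exI[of _ "Suc m"]) (simp add: h_def)
  qed
  have "complete_leveled_group G d h e"
  proof
    show "a \<in> carrier G \<Longrightarrow> x \<in> carrier G \<Longrightarrow> y \<in> carrier G \<Longrightarrow> d (a \<otimes> x) (a \<otimes> y) = d x y" for a x y
      by (rule d(3))
    show "d x y \<le> 1/8" for x y by (rule d(4))
    show "(\<lambda>n. d (u n \<otimes> k) (v n \<otimes> k)) \<longlonglongrightarrow> 0"
      if "\<And>n. u n \<in> carrier G" "\<And>n. v n \<in> carrier G" "k \<in> carrier G" "(\<lambda>n. d (u n) (v n)) \<longlonglongrightarrow> 0" for u v k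
      by (rule right_mult_tendsto[OF d(1-3) that])
    show "h i \<in> carrier G" for i
      using from_nat_into[OF \<open>C \<noteq> {}\<close>, of "i - 2"] C(2) by (auto simp: h_def)
    show "h 0 = \<one>" "h (Suc 0) = \<one>" by (simp_all add: h_def)
    show "\<exists>i. (\<lambda>n. d (h (Suc (i n))) a) \<longlonglongrightarrow> 0" if a: "a \<in> carrier G" for a
    proof -
      have "\<forall>n. \<exists>i. d (h (Suc i)) a < inverse (real (Suc n))"
      proof
        fix n
        obtain c where "c \<in> C" "d c a < inverse (real (Suc n))"
          using near[OF a, of "inverse (real (Suc n))"] by auto
        then show "\<exists>i. d (h (Suc i)) a < inverse (real (Suc n))" using hC[of c] by auto
      qed
      then obtain i where i: "\<And>n. d (h (Suc (i n))) a < inverse (real (Suc n))" by metis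
      have "(\<lambda>n. d (h (Suc (i n))) a) \<longlonglongrightarrow> 0"
        by (rule tendsto_sandwich[OF _ _ tendsto_const LIMSEQ_inverse_real_of_nat])
          (use i in \<open>auto simp: less_imp_le\<close>)
      then show ?thesis by blast
    qed
    show "\<exists>s>0. \<forall>b\<in>carrier G. d b a < s \<longrightarrow> e b a < r" if a: "a \<in> carrier G" and r: "0 < r" for a r
    proof -
      have "openin D.mtopology (E.mball a r)" using Me(3) d(2) by simp
      moreover have "a \<in> E.mball a r" using a r by simp
      ultimately obtain s where "s > 0" "D.mball a s \<subseteq> E.mball a r"
        unfolding D.openin_mtopology by blast
      then show ?thesis using a by (intro exI[of _ s]) (auto simp: D.commute E.commute subset_iff)
    qed
    show "\<exists>a\<in>carrier G. (\<lambda>n. d (u n) a) \<longlonglongrightarrow> 0"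
      if u: "\<And>n. u n \<in> carrier G" and c: "\<And>r. 0 < r \<Longrightarrow> \<exists>N. \<forall>m\<ge>N. \<forall>n\<ge>N. e (u m) (u n) < r" for u
    proof -
      have "E.MCauchy u" unfolding E.MCauchy_def using u c by blast
      then obtain a where "limitin T u a sequentially"
        using Me(2) unfolding E.mcomplete_def Me(3) by blast
      then have "a \<in> carrier G \<and> (\<lambda>n. d (u n) a) \<longlonglongrightarrow> 0"
        unfolding d(2)[symmetric] D.limitin_metric_dist_null by blast
      then show ?thesis by blast
    qed
  qed
  then show ?thesis using that d(2) by blast
qed

context leveled_group
begin

text \<open>At peaks this is continuity of right multiplication by a fixed element; equal norms of
  the operators spread it to the closed span. Sequences suffice, as \<open>d\<close> metrizes the
  group.\<close>

lemma continuous_map_tr: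
  assumes x: "x \<in> L.pt_span"
  shows "continuous_map mtopology euclidean (\<lambda>g. tr g x)"
proof -
  have seq: "(\<lambda>n. tr (u n) x) \<longlonglongrightarrow> tr a x"
    if u: "\<And>n. u n \<in> carrier G" and a: "a \<in> carrier G" and lim: "(\<lambda>n. d (u n) a) \<longlonglongrightarrow> 0" for u a
  proof (rule tendsto_on_closure_span[where V = L.pt_span and A = "L.pt ` P" and K = 1
        and F = "\<lambda>n. tr (u n)" and f = "tr a"])
    show "(\<lambda>n. tr (u n) p) \<longlonglongrightarrow> tr a p" if p: "p \<in> L.pt ` P" for p
    proof -
      obtain b i where p: "p = L.pt (b, i)" "b \<in> carrier G" using p by auto
      have "(\<lambda>n. L.pt (u n \<otimes> b, i)) \<longlonglongrightarrow> L.pt (a \<otimes> b, i)"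
        by (rule pt_tendsto) (use u a p right_cont[OF u _ p(2) lim] in auto)
      then show ?thesis using u a p by (simp add: tr_pt)
    qed
  qed (use x u a in \<open>auto simp: L.subspace_pt_span L.pt_span_def[symmetric] linear_map_on_tr norm_tr\<close>)
  have "\<exists>s>0. \<forall>g. g \<in> carrier G \<and> d a g < s \<longrightarrow> dist (tr a x) (tr g x) < r"
    if a: "a \<in> carrier G" and r: "0 < r" for a r
  proof (rule ccontr)
    assume no: "\<not> ?thesis"
    have "\<forall>n. \<exists>g. g \<in> carrier G \<and> d a g < inverse (real (Suc n)) \<and> r \<le> dist (tr a x) (tr g x)"
    proof
      fix n
      have "0 < inverse (real (Suc n))" by simp
      then have "\<not> (\<forall>g. g \<in> carrier G \<and> d a g < inverse (real (Suc n)) \<longrightarrow> dist (tr a x) (tr g x) < r)"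
        using no by (metis (no_types, lifting))
      then show "\<exists>g. g \<in> carrier G \<and> d a g < inverse (real (Suc n)) \<and> r \<le> dist (tr a x) (tr g x)"
        by (simp only: not_all not_imp not_less conj_assoc)
    qed
    then obtain u where u: "\<And>n. u n \<in> carrier G" "\<And>n. d a (u n) < inverse (real (Suc n))"
      "\<And>n. r \<le> dist (tr a x) (tr (u n) x)" by metis
    have "(\<lambda>n. d (u n) a) \<longlonglongrightarrow> 0"
      by (rule tendsto_sandwich[OF _ _ tendsto_const LIMSEQ_inverse_real_of_nat])
        (use u(2) in \<open>auto simp: less_imp_le commute[of _ a]\<close>)
    then have "(\<lambda>n. tr (u n) x) \<longlonglongrightarrow> tr a x" by (rule seq[OF u(1) a])
    then obtain n where "dist (tr (u n) x) (tr a x) < r"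
      using metric_LIMSEQ_D[OF _ r] by (metis (no_types, lifting) order_refl)
    then show False using u(3)[of n] by (simp add: dist_commute)
  qed
  then have "continuous_map mtopology (Metric_space.mtopology UNIV dist) (\<lambda>g. tr g x)"
    by (intro metric_continuous_map[OF Met_TC.Metric_space_axioms, THEN iffD2] conjI ballI allI impI)
      (simp_all only: subset_UNIV)
  then show ?thesis by (simp only: mtopology_is_euclidean)
qed

end

lemma group_sign_group: "group sign_group"
  by (rule groupI) (auto simp: sign_group_def)

context complete_leveled_group
begin

definition disp_space :: "((('a \<times> nat) option discrete \<Rightarrow>\<^sub>C real) \<times> real) set" where
  "disp_space = L.pt_span \<times> UNIV"

text \<open>The sign acts as a scalar on the whole product and the group on the first factor only,
  so the sign can be read off from the image of \<open>(0, 1)\<close>.\<close>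

definition disp_map :: "int \<times> 'a \<Rightarrow> (('a \<times> nat) option discrete \<Rightarrow>\<^sub>C real) \<times> real
    \<Rightarrow> (('a \<times> nat) option discrete \<Rightarrow>\<^sub>C real) \<times> real" where
  "disp_map = (\<lambda>(s, g) z. real_of_int s *\<^sub>R (tr g (fst z), snd z))"

lemma subspace_disp_space: "subspace disp_space"
  unfolding disp_space_def by (intro subspace_Times L.subspace_pt_span subspace_UNIV)

lemma tr_pt_span: "g \<in> carrier G \<Longrightarrow> tr g ` L.pt_span = L.pt_span"
  unfolding tr_def by (rule L.translate_pt_span[OF symmetry_act])

lemma tr_in_pt_span: "g \<in> carrier G \<Longrightarrow> x \<in> L.pt_span \<Longrightarrow> tr g x \<in> L.pt_span"
  using tr_pt_span by blast

lemma disp_isometry: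
  assumes lin: "linear_map_on disp_space f" and onto: "f ` disp_space = disp_space"
    and iso: "\<And>z. z \<in> disp_space \<Longrightarrow> L.disp_norm (f z) = L.disp_norm z"
  shows "\<exists>s\<in>{-1, 1}. \<exists>g\<in>carrier G. \<forall>z\<in>disp_space. f z = disp_map (s, g) z"
proof -
  have fixing: "\<exists>g\<in>carrier G. \<forall>z\<in>disp_space. f z = (tr g (fst z), snd z)"
    if lin: "linear_map_on disp_space f" and onto: "f ` disp_space = disp_space"
    and iso: "\<And>z. z \<in> disp_space \<Longrightarrow> L.disp_norm (f z) = L.disp_norm z"
    and axis: "f (0, 1) = (0, 1)" for f
  proof -
    obtain S where S: "linear_map_on L.pt_span S" "S ` L.pt_span = L.pt_span"
      "\<forall>x\<in>L.pt_span. \<forall>t. f (x, t) = (S x, t)"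
      "\<forall>x\<in>L.pt_span. L.hull_norm (S x) = L.hull_norm x \<and> (\<forall>t. L.tilt (S x) t = L.tilt x t)"
      using L.isometry_fixing_axis[of f] lin onto iso axis unfolding disp_space_def by blast
    obtain g where "g \<in> carrier G" "\<forall>x\<in>L.pt_span. S x = tr g x"
      using tilt_isometry_is_translation[OF S(1,2)] S(4) by blast
    then show ?thesis using S(3) by (intro bexI[of _ g]) (auto simp: disp_space_def)
  qed
  have "f (0, 1) = (0, 1) \<or> f (0, 1) = (0, -1)"
    by (rule L.isometry_axis[OF lin[unfolded disp_space_def] onto[unfolded disp_space_def]
          iso[unfolded disp_space_def]])
  then show ?thesis
  proof
    assume "f (0, 1) = (0, 1)"
    then obtain g where "g \<in> carrier G" "\<forall>z\<in>disp_space. f z = (tr g (fst z), snd z)"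
      using fixing[OF lin onto iso] by blast
    then show ?thesis by (intro bexI[of _ 1] bexI[of _ g]) (auto simp: disp_map_def)
  next
    assume neg: "f (0, 1) = (0, -1)"
    have minus: "uminus ` disp_space = disp_space"
    proof
      show "uminus ` disp_space \<subseteq> disp_space"
        using subspace_neg[OF subspace_disp_space] by blast
      show "disp_space \<subseteq> uminus ` disp_space"
      proof
        fix z assume "z \<in> disp_space"
        then have "- z \<in> disp_space" by (rule subspace_neg[OF subspace_disp_space])
        then show "z \<in> uminus ` disp_space" by (rule rev_image_eqI) simp
      qed
    qed
    \<comment> \<open>Negation is itself an isometry, so \<open>- f\<close> falls under the case
      that fixes \<open>(0, 1)\<close>.\<close>
    have "linear_map_on disp_space (\<lambda>z. - f z)"
      using lin by (simp add: linear_map_on_def)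
    moreover have "(\<lambda>z. - f z) ` disp_space = disp_space"
    proof -
      have "(\<lambda>z. - f z) ` disp_space = uminus ` (f ` disp_space)" by (simp add: image_image)
      then show ?thesis by (simp only: onto minus)
    qed
    moreover have "L.disp_norm (- f z) = L.disp_norm z" if "z \<in> disp_space" for z
      using iso[OF that] by (simp add: L.disp_norm_minus)
    ultimately obtain g where g: "g \<in> carrier G" "\<forall>z\<in>disp_space. - f z = (tr g (fst z), snd z)"
      using fixing[of "\<lambda>z. - f z"] neg by auto
    have "f z = disp_map (-1, g) z" if "z \<in> disp_space" for z
    proof -
      have "f z = - (- f z)" by simp
      also have "- f z = (tr g (fst z), snd z)" using g(2) that by blast
      finally show ?thesis by (simp add: disp_map_def)
    qed
    then show ?thesis using g(1) by (intro bexI[of _ "-1"] bexI[of _ g]) auto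
  qed
qed

lemma separable_disp_space: "\<exists>D. separable_subspace disp_space D"
proof -
  let ?A = "range (\<lambda>(i, j). L.pt (h (Suc i), j))"
  have "countable ?A" by simp
  then obtain D where D: "countable D" "D \<subseteq> span ?A" "closure (span ?A) \<subseteq> closure D"
    by (rule separable_closure_span)
  have "separable_subspace disp_space (D \<times> \<rat>)"
  proof
    show "subspace disp_space" by (rule subspace_disp_space)
    show "closed disp_space" unfolding disp_space_def by (intro closed_Times L.closed_pt_span closed_UNIV)
    show "countable (D \<times> (\<rat> :: real set))" using D(1) countable_rat by (rule countable_SIGMA)
    show "D \<times> \<rat> \<subseteq> disp_space"
      using D(2) closure_subset[of "span ?A"] unfolding disp_space_def pt_span_eq by auto
    show "disp_space \<subseteq> closure (D \<times> \<rat>)"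
      using D(3) unfolding disp_space_def pt_span_eq closure_Times Rats_closure_real by auto
  qed
  then show ?thesis by blast
qed

lemma disp_map_in: "s \<in> {-1, 1} \<Longrightarrow> g \<in> carrier G \<Longrightarrow> z \<in> disp_space \<Longrightarrow> disp_map (s, g) z \<in> disp_space"
  unfolding disp_map_def disp_space_def
  using subspace_neg[OF L.subspace_pt_span] by (auto simp: tr_in_pt_span)

lemma disp_map_mult:
  assumes "g \<in> carrier G" "g' \<in> carrier G"
  shows "disp_map (s * s', g \<otimes> g') z = disp_map (s, g) (disp_map (s', g') z)"
  by (simp add: disp_map_def tr_mult[OF assms] linear_scale[OF linear_tr])

lemma disp_map_one: "disp_map (1, \<one>) z = z"
  by (simp add: disp_map_def tr_one)

lemma disp_norm_disp_map:
  assumes "s \<in> {-1, 1}" "g \<in> carrier G"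
  shows "L.disp_norm (disp_map (s, g) z) = L.disp_norm z"
proof -
  have "L.disp_norm (tr g (fst z), snd z) = L.disp_norm z"
    by (simp add: L.disp_norm_def tr_def L.hull_norm_translate[OF symmetry_act[OF assms(2)]]
        L.tilt_translate[OF symmetry_act[OF assms(2)]])
  then show ?thesis
    using assms(1) by (auto simp only: disp_map_def case_prod_conv L.disp_norm_scale)
qed

lemma disp_map_onto:
  assumes s: "s \<in> {-1, 1}" and g: "g \<in> carrier G"
  shows "disp_map (s, g) ` disp_space = disp_space"
proof
  show "disp_map (s, g) ` disp_space \<subseteq> disp_space" using disp_map_in[OF s g] by blast
  show "disp_space \<subseteq> disp_map (s, g) ` disp_space"
  proof
    fix z assume z: "z \<in> disp_space"
    have "disp_map (s, inv g) z \<in> disp_space" by (rule disp_map_in) (use s g z in auto)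
    moreover have "disp_map (s, g) (disp_map (s, inv g) z) = z"
      using disp_map_mult[of g "inv g" s s z] s g by (auto simp: disp_map_one)
    ultimately show "z \<in> disp_map (s, g) ` disp_space" by (metis imageI)
  qed
qed

theorem displayable_on_disp_space:
  assumes "separable_subspace disp_space D"
  shows "displayable (sign_group \<times>\<times> G) (prod_topology sign_topology mtopology)
    (separable_subspace.space disp_space D) (separable_subspace.space_norm disp_space D)"
proof (rule separable_subspace.displayable_space[OF assms, where R = disp_map and nrm = L.disp_norm
      and a = 1 and b = 16])
  let ?H = "sign_group \<times>\<times> G"
  have cH: "carrier ?H = {-1, 1} \<times> carrier G" by (simp add: sign_group_def)
  show "group ?H" by (rule DirProd_group[OF group_sign_group is_group])
  show "topspace (prod_topology sign_topology mtopology) = carrier ?H"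
    by (simp add: sign_topology_def sign_group_def)
  show "L.disp_norm (z + w) \<le> L.disp_norm z + L.disp_norm w" for z w by (rule L.disp_norm_triangle)
  show "L.disp_norm (c *\<^sub>R z) = \<bar>c\<bar> * L.disp_norm z" for c z by (rule L.disp_norm_scale)
  show "1 * norm z \<le> L.disp_norm z" for z using L.disp_norm_ge[of z] by simp
  show "L.disp_norm z \<le> 16 * norm z" for z by (rule L.disp_norm_le)
  show "linear_map_on disp_space (disp_map k)" for k
    by (cases k) (simp add: disp_map_def linear_map_on_def linear_add[OF linear_tr] linear_scale[OF linear_tr]
        scaleR_add_right distrib_left mult.left_commute)
  show "disp_map k ` disp_space = disp_space" if "k \<in> carrier ?H" for k
    using that disp_map_onto unfolding cH by blast
  show "L.disp_norm (disp_map k z) = L.disp_norm z" if "k \<in> carrier ?H" for k z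
    using that disp_norm_disp_map unfolding cH by blast
  show "disp_map (k \<otimes>\<^bsub>?H\<^esub> k') z = disp_map k (disp_map k' z)"
    if "k \<in> carrier ?H" "k' \<in> carrier ?H" for k k' z
  proof -
    obtain s g s' g' where k: "k = (s, g)" "k' = (s', g')" by (metis surj_pair)
    then have "g \<in> carrier G" "g' \<in> carrier G" using that by (auto simp: cH)
    moreover have "k \<otimes>\<^bsub>?H\<^esub> k' = (s * s', g \<otimes> g')" by (simp add: k sign_group_def)
    ultimately show ?thesis by (simp only: k disp_map_mult)
  qed
  show "disp_map \<one>\<^bsub>?H\<^esub> z = z" for z
    using disp_map_one by (simp add: sign_group_def)
  show "\<exists>k\<in>carrier ?H. \<forall>z\<in>disp_space. f z = disp_map k z"
    if "linear_map_on disp_space f" "f ` disp_space = disp_space"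
      "\<And>z. z \<in> disp_space \<Longrightarrow> L.disp_norm (f z) = L.disp_norm z" for f
    using disp_isometry[OF that] unfolding cH by blast
  show "continuous_map (prod_topology sign_topology mtopology) euclidean (\<lambda>k. disp_map k z)"
    if z: "z \<in> disp_space" for z
  proof -
    have x: "fst z \<in> L.pt_span" using z by (auto simp: disp_space_def)
    have "continuous_map sign_topology euclideanreal real_of_int"
      by (simp add: sign_topology_def)
    then have 1: "continuous_map (prod_topology sign_topology mtopology) euclideanreal (\<lambda>k. real_of_int (fst k))"
      using continuous_map_compose[OF continuous_map_fst] by (fastforce simp: o_def)
    have 2: "continuous_map (prod_topology sign_topology mtopology) euclidean (\<lambda>k. tr (snd k) (fst z))"
      using continuous_map_compose[OF continuous_map_snd continuous_map_tr[OF x]] by (simp add: o_def)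
    have "continuous_map (prod_topology sign_topology mtopology) (prod_topology euclideanreal euclidean)
        (\<lambda>k. (real_of_int (fst k), tr (snd k) (fst z)))"
      by (rule continuous_map_pairedI[OF 1 2])
    then have "continuous_map (prod_topology sign_topology mtopology) euclidean
        (\<lambda>k. (real_of_int (fst k), tr (snd k) (fst z)))"
      by simp
    moreover have "continuous_map euclidean euclidean
        (\<lambda>p :: real \<times> (('a \<times> nat) option discrete \<Rightarrow>\<^sub>C real). (fst p *\<^sub>R snd p, fst p * snd z))"
      unfolding continuous_map_iff_continuous2
      by (intro continuous_on_Pair continuous_on_scaleR continuous_on_mult continuous_on_fst
          continuous_on_snd continuous_on_id continuous_on_const)
    ultimately have "continuous_map (prod_topology sign_topology mtopology) euclidean
        ((\<lambda>p. (fst p *\<^sub>R snd p, fst p * snd z)) \<circ> (\<lambda>k. (real_of_int (fst k), tr (snd k) (fst z))))"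
      by (rule continuous_map_compose)
    then show ?thesis by (simp add: o_def disp_map_def case_prod_beta)
  qed
  \<comment> \<open>One test vector detects the whole group element: its last coordinate shows the
    sign, its first one the distance \<open>d g' g\<close>. It serves injectivity and openness
    alike.\<close>
  have base_pt: "(L.pt (\<one>, 0), 1) \<in> disp_space"
    by (simp add: disp_space_def L.pt_in_span)
  have at_base: "disp_map (s, g) (L.pt (\<one>, 0), 1) = real_of_int s *\<^sub>R (L.pt (g, 0), 1)" if "g \<in> carrier G" for s g
    using that by (simp add: disp_map_def tr_pt)
  \<comment> \<open>With \<open>r \<le> 1\<close>, the distance stays below 2, the gap between the
    two signs.\<close>
  have close: "s = s' \<and> d g' g < r"
    if "s \<in> {-1, 1}" "s' \<in> {-1, 1}" "g \<in> carrier G" "g' \<in> carrier G" "r \<le> 1"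
      "dist (disp_map (s', g') (L.pt (\<one>, 0), 1)) (disp_map (s, g) (L.pt (\<one>, 0), 1)) < r"
    for s s' :: int and g g' r
  proof -
    have *: "dist (real_of_int s' *\<^sub>R (L.pt (g', 0), 1::real)) (real_of_int s *\<^sub>R (L.pt (g, 0), 1)) < r"
      using that(6) unfolding at_base[OF that(3)] at_base[OF that(4)] .
    have "dist (real_of_int s') (real_of_int s) < r"
      using le_less_trans[OF dist_snd_le *] by simp
    then have s: "s = s'" using that(1,2,5) by (auto simp: dist_real_def)
    have "dist (real_of_int s *\<^sub>R L.pt (g', 0)) (real_of_int s *\<^sub>R L.pt (g, 0)) < r"
      using le_less_trans[OF dist_fst_le *] s by simp
    then have "dist (L.pt (g', 0)) (L.pt (g, 0)) < r"
      using that(1) by (auto simp: dist_norm norm_minus_commute simp flip: scaleR_diff_right)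
    then have "d g' g < r" using that(3,4) by (simp add: dist_pt ldist_same)
    then show ?thesis using s by blast
  qed
  show "k = k'" if k: "k \<in> carrier ?H" "k' \<in> carrier ?H"
    and eq: "\<And>z. z \<in> disp_space \<Longrightarrow> disp_map k z = disp_map k' z" for k k'
  proof -
    obtain s g s' g' where kk: "k = (s, g)" "k' = (s', g')" by (metis surj_pair)
    have in_H: "s \<in> {-1, 1}" "s' \<in> {-1, 1}" "g \<in> carrier G" "g' \<in> carrier G"
      using k unfolding cH kk by auto
    have *: "s = s' \<and> d g' g < r" if "0 < r" "r \<le> 1" for r
      by (rule close[OF in_H that(2)]) (use eq[OF base_pt] that(1) in \<open>simp add: kk\<close>)
    have "d g' g \<le> 0"
    proof (rule field_le_epsilon)
      fix r :: real assume "0 < r"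
      then show "d g' g \<le> 0 + r" using *[of "min r 1"] by auto
    qed
    then have "d g' g = 0" using nonneg[of g' g] by linarith
    then show ?thesis using *[of 1] in_H by (simp add: kk)
  qed
  show "\<exists>z\<in>disp_space. \<exists>r>0. \<forall>k'\<in>carrier ?H. dist (disp_map k' z) (disp_map k z) < r \<longrightarrow> k' \<in> U"
    if U: "openin (prod_topology sign_topology mtopology) U" and k: "k \<in> U" for U k
  proof -
    obtain s g where kk: "k = (s, g)" by (cases k)
    obtain A B where AB: "openin sign_topology A" "openin mtopology B" "s \<in> A" "g \<in> B" "A \<times> B \<subseteq> U"
      using U[unfolded openin_prod_topology_alt, rule_format, OF k[unfolded kk]] by blast
    have s: "s \<in> {-1, 1}" and g: "g \<in> carrier G"
      using openin_subset[OF AB(1)] openin_subset[OF AB(2)] AB(3,4) by (auto simp: sign_topology_def)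
    obtain r where r: "r > 0" "mball g r \<subseteq> B" using AB(2,4) unfolding openin_mtopology by blast
    have "k' \<in> U" if k': "k' \<in> carrier ?H"
      "dist (disp_map k' (L.pt (\<one>, 0), 1)) (disp_map k (L.pt (\<one>, 0), 1)) < min r 1" for k'
    proof -
      obtain s' g' where kk': "k' = (s', g')" by (cases k')
      have in_H: "s' \<in> {-1, 1}" "g' \<in> carrier G" using k'(1) unfolding cH kk' by auto
      have "s = s' \<and> d g' g < min r 1"
        by (rule close[OF s in_H(1) g in_H(2)]) (use k'(2) in \<open>simp_all add: kk kk'\<close>)
      then have "s' \<in> A" "g' \<in> B" using AB(3) r(2) g in_H(2) by (auto simp: commute subset_iff)
      then show ?thesis using AB(5) by (auto simp: kk')
    qed
    then have "\<forall>k'\<in>carrier ?H. dist (disp_map k' (L.pt (\<one>, 0), 1)) (disp_map k (L.pt (\<one>, 0), 1)) < min r 1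
        \<longrightarrow> k' \<in> U" by blast
    moreover have "0 < min r 1" using r(1) by simp
    ultimately show ?thesis using base_pt by blast
  qed
qed simp_all

end

theorem theorem31:
  fixes G :: "('g, 'b) monoid_scheme" and T :: "'g topology"
  assumes "polish_group G T"
  shows "\<exists>(V :: (real, nat \<Rightarrow> real) module) N.
    real_banach_space V N \<and> separable_space (norm_topology V N) \<and>
    displayable (sign_group \<times>\<times> G) (prod_topology sign_topology T) V N"
proof -
  interpret polish_group G T by (rule assms)
  obtain d h e where clg: "complete_leveled_group G d h e" and T: "Metric_space.mtopology (carrier G) d = T"
    by (rule exists_complete_leveled_group)
  interpret CL: complete_leveled_group G d h e by (rule clg)
  obtain D where D: "separable_subspace CL.disp_space D"
    using CL.separable_disp_space by blast
  show ?thesis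
    using separable_subspace.banach_space[OF D] separable_subspace.separable_space_space[OF D]
      CL.displayable_on_disp_space[OF D] unfolding T by blast
qed


end
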